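(* Let $\{Z_i\}_{i\ge 1}=\{(Y_i,W_i,X_i)\}_{i\ge1}$ be observations of $Z=(Y,W,X)$, and let the model classes $\mathcal F_Y,\mathcal F_W$, the losses $\ell_R$, the $K$-fold partition $\{\mathcal I_k\}$, the out-of-fold ranks $\widehat U_i,\widehat V_i$, the target $\rho_C$ and the estimators $\widehat\rho_C,\widetilde\rho_C,\breve\rho_C$ be as defined in the context. Assume: (1) The sample is i.i.d.; $Y,W\in[0,1]$ and $X\in\mathcal X\subset\mathbb R^p$ with $\mathcal X$ compact. For almost every $x\in\mathcal X$, the conditional CDFs $F_{Y\mid X}(\cdot\mid x)$ and $F_{W\mid X}(\cdot\mid x)$ are continuous and strictly increasing, and admit conditional densities $f_{Y\mid X},f_{W\mid X}$ that are continuous on their supports and are locally bounded and strictly positive almost everywhere. (2) For each $R\in\{Y,W\}$, $F_{R\mid X}\in\mathcal F_R$; and with $\mathcal Q_R(F):=\mathbb E[\ell_R(F;R,X)]$ for $F\in\mathcal F_R$, the minimizer of $\mathcal Q_R$ over $\mathcal F_R$ is unique in the function sense and is attained by $F_{R\mid X}$: if $\mathcal Q_R(\widetilde F)=\inf_{G\in\mathcal F_R}\mathcal Q_R(G)$, then $\widetilde F=F_{R\mid X}$ almost everywhere. (3) For each $R\in\{Y,W\}$ and each fold $k$, with $\mathcal Q^{(-k)}_{R,n}(F):=\frac1{n_{ck}}\sum_{i\in\mathcal I_k^c}\ell_R(F;R_i,X_i)$ and $\widehat F^{(-k)}_{R\mid X}\in\arg\min_{F\in\mathcal F_R}\mathcal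 Q^{(-k)}_{R,n}(F)$: (i) $\sup_{F\in\mathcal F_R}|\mathcal Q^{(-k)}_{R,n}(F)-\mathcal Q_R(F)|\xrightarrow{p}0$; (ii) there is a measurable map $\varphi_R:[0,1]\times\mathcal X\times\mathcal Z\to\mathbb R$ (not depending on $k$) such that $$\sup_{(r,x)\in[0,1]\times\mathcal X}\left|\sqrt{n_{ck}}\big(\widehat F^{(-k)}_{R\mid X}(r\mid x)-F_{R\mid X}(r\mid x)\big)-\frac1{\sqrt{n_{ck}}}\sum_{j\in\mathcal I_k^c}\varphi_R(r,x;Z_j)\right|\xrightarrow{p}0,$$ $\mathbb E[\varphi_R(r,x;Z)]=0$ for all $(r,x)$, and $\mathbb E\big[\sup_{(r,x)}|\varphi_R(r,x;Z)|^{2+\delta}\big]<\infty$ for some $\delta>0$. Let $\psi_A,\psi_U,\psi_V$ be the functions of $Z$ defined in the context. Then, as $n\to\infty$, $$\sqrt n(\breve\rho_C-\rho_C)\Rightarrow\mathcal N(0,\sigma^2_{\mathrm{cov}}),\qquad \sqrt n(\widehat\rho_C-\rho_C)\Rightarrow\mathcal N(0,\sigma^2_{\mathrm{ols}}),\qquad \sqrt n(\widetilde\rho_C-\rho_C)\Rightarrow\mathcal N(0,\sigma^2_{\mathrm{corr}}),$$ where the corresponding influence functions are $$\psi_{\mathrm{cov}}(Z)=12\,\psi_A(Z),\quad \psi_{\mathrm{ols}}(Z)=12\{\psi_A(Z)-\rho_C\,\psi_V(Z)\},\quad \psi_{\mathrm{corr}}(Z)=12\Big\{\psi_A(Z)-\frac{\rho_C}2\big(\psi_U(Z)+\psi_V(Z)\big)\Big\},$$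 that is, $\sqrt n(\breve\rho_C-\rho_C)$, $\sqrt n(\widehat\rho_C-\rho_C)$ and $\sqrt n(\widetilde\rho_C-\rho_C)$ equal $n^{-1/2}\sum_{i=1}^n\psi_\bullet(Z_i)+o_p(1)$ with $\bullet=\mathrm{cov},\mathrm{ols},\mathrm{corr}$ respectively, and $$\sigma^2_{\mathrm{cov}}=\mathrm{Var}(\psi_{\mathrm{cov}}(Z)),\quad \sigma^2_{\mathrm{ols}}=\mathrm{Var}(\psi_{\mathrm{ols}}(Z)),\quad \sigma^2_{\mathrm{corr}}=\mathrm{Var}(\psi_{\mathrm{corr}}(Z)).$$
   Context: Setting. $Z=(Y,W,X)$ takes values in a space $\mathcal Z$; $Y,W$ are real outcomes already normalized to $[0,1]$ and $X$ is a covariate vector. $F_{R\mid X}(r\mid x)=\mathbb P(R\le r\mid X=x)$ for $R\in\{Y,W\}$. Conditional ranks: $U:=F_{Y\mid X}(Y\mid X)$, $V:=F_{W\mid X}(W\mid X)$. Target: $\rho_C:=\mathrm{Cov}(U,V)/\mathrm{Var}(V)$ (for continuous outcomes this equals $\mathrm{Cor}(U,V)$ and $12\,\mathbb E[(U-\tfrac12)(V-\tfrac12)]$). Model class (deep conditional transformation model). For $R\in\{Y,W\}$ and a parameter $\theta_R$ in a parameter space $\Theta_R$, put $F_{R\mid X}(r\mid x;\theta_R)=\Phi(T(r,x;\theta_R))$, $T(r,x;\theta_R)=\sum_{j=0}^J\beta_j(x;\theta_R)B_{j,J}(r)$, where $\Phi$ is the standard normal CDF, $B_{j,J}(u)=\binom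 Jj u^j(1-u)^{J-j}$ are Bernstein polynomials, and $\beta_j(x;\theta_R)=c(x;\theta_R)+\sum_{k=1}^j\log(1+e^{\Delta_k(x;\theta_R)})$ with $c,\Delta_1,\dots,\Delta_J$ outputs of a neural network with parameter $\theta_R$; thus $\beta_0\le\dots\le\beta_J$ and $T$ is nondecreasing in $r$. $\mathcal F_R:=\{F_{R\mid X}(\cdot\mid\cdot;\theta_R):\theta_R\in\Theta_R\}$. For $F\in\mathcal F_R$, $\ell_R(F;r,x)$ is the single-observation negative log-likelihood, $-\log\frac{\partial}{\partial r}F(r\mid x)$. Fixed-complexity regime: the network architecture, $J$, the classes $\mathcal F_R$ and the number of folds $K$ do not vary with $n$. Cross-fitting. $\{1,\dots,n\}$ is randomly partitioned into $K$ disjoint folds $\mathcal I_1,\dots,\mathcal I_K$; $\mathcal I_k^c$ is the complement of $\mathcal I_k$, $n_k=|\mathcal I_k|$, $n_{ck}=|\mathcal I_k^c|$, with $n_k/n\to1/K$ and $n_{ck}/n\to1-1/K$. For $i\in\mathcal I_k$ set $\widehat U_i:=\widehat F^{(-k)}_{Y\mid X}(Y_i\mid X_i)$, $\widehat V_i:=\widehat F^{(-k)}_{W\mid X}(W_i\mid X_i)$, where $\widehat F^{(-k)}_{R\mid X}$ is the empirical risk minimizer computed from $\mathcal I_k^c$. Estimators. With $\overline{\widehat U}=\frac1n\sum_i\widehat U_i$, $\overline{\widehat V}=\frac1n\sum_i\widehat V_i$: $$\widehat\rho_C=\frac{\sum_{i=1}^n(\widehat U_i-\overline{\widehat U})(\widehat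 V_i-\overline{\widehat V})}{\sum_{i=1}^n(\widehat V_i-\overline{\widehat V})^2},\quad \widetilde\rho_C=\frac{\sum_{i=1}^n(\widehat U_i-\overline{\widehat U})(\widehat V_i-\overline{\widehat V})}{\sqrt{\sum_{i=1}^n(\widehat U_i-\overline{\widehat U})^2\sum_{i=1}^n(\widehat V_i-\overline{\widehat V})^2}},\quad \breve\rho_C=\frac{12}{n}\sum_{i=1}^n(\widehat U_i-\tfrac12)(\widehat V_i-\tfrac12).$$ Influence functions. Let $\widetilde Z=(\widetilde Y,\widetilde W,\widetilde X)$ be an independent copy of $Z$, $\widetilde U=F_{Y\mid X}(\widetilde Y\mid\widetilde X)$, $\widetilde V=F_{W\mid X}(\widetilde W\mid\widetilde X)$, and with $\varphi_Y,\varphi_W$ from hypothesis (3)(ii) define $\gamma_Y(Z)=\mathbb E[(\widetilde V-\tfrac12)\varphi_Y(\widetilde Y,\widetilde X;Z)\mid Z]$, $\gamma_W(Z)=\mathbb E[(\widetilde U-\tfrac12)\varphi_W(\widetilde W,\widetilde X;Z)\mid Z]$, $\delta_Y(Z)=2\,\mathbb E[(\widetilde U-\tfrac12)\varphi_Y(\widetilde Y,\widetilde X;Z)\mid Z]$, $\delta_W(Z)=2\,\mathbb E[(\widetilde V-\tfrac12)\varphi_W(\widetilde W,\widetilde X;Z)\mid Z]$. With $A=\mathbb E[(U-\tfrac12)(V-\tfrac12)]=\rho_C/12$, $B_U=\mathbb E[(U-\tfrac12)^2]=\tfrac1{12}$, $B_V=\mathbb E[(V-\tfrac12)^2]=\tfrac1{12}$,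 set $\psi_A(Z)=\big((U-\tfrac12)(V-\tfrac12)-A\big)+\gamma_Y(Z)+\gamma_W(Z)$, $\psi_U(Z)=\big((U-\tfrac12)^2-B_U\big)+\delta_Y(Z)$, $\psi_V(Z)=\big((V-\tfrac12)^2-B_V\big)+\delta_W(Z)$.
   Formalization: The standard normal CDF Φ in the model class is replaced by the CDF of an arbitrary real law: with Φ normal, F(1|x)<1 for all members, so F_{R|X}∈𝓕_R contradicts outcomes in [0,1] with continuous CDFs. Positive derivatives and integrable losses are made explicit. *)

theory Defs
  imports "HOL-Probability.Probability"
begin

section \<open>Observations\<close>

type_synonym 'p obs = "real \<times> real \<times> (real ^ 'p)"

definition out_Y :: "'p::finite obs \<Rightarrow> real" where
  "out_Y z = fst z"

definition out_W :: "'p::finite obs \<Rightarrow> real" where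
  "out_W z = fst (snd z)"

definition covar :: "'p::finite obs \<Rightarrow> real ^ 'p" where
  "covar z = snd (snd z)"


section \<open>Convergence in probability, normal limits, covariance\<close>

text \<open>
  The suprema over \<open>[0,1] \<times> \<X>\<close> and over the model classes need not be measurable, and
  \<^const>\<open>measure\<close> is 0 on non-measurable sets. Convergence in probability is therefore
  convergence in outer probability, which is the usual notion for measurable sequences.
  The values are extended nonnegative so that an infinite supremum counts as infinite.
\<close>

definition conv_prob_zero :: "'a measure \<Rightarrow> (nat \<Rightarrow> 'a \<Rightarrow> ennreal) \<Rightarrow> bool" where
  "conv_prob_zero M f \<longleftrightarrow>
     (\<forall>\<epsilon>>0. (\<lambda>n. outer_measure_of M {\<omega> \<in> space M. ennreal \<epsilon> < f n \<omega>}) \<longlonglongrightarrow> 0)"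

text \<open>The limiting variance may vanish, in which case the limit law is the point mass at 0.\<close>

definition normal_law :: "real \<Rightarrow> real measure" where
  "normal_law v = (if v = 0 then return borel 0 else density lborel (normal_density 0 (sqrt v)))"

definition cov :: "'z measure \<Rightarrow> ('z \<Rightarrow> real) \<Rightarrow> ('z \<Rightarrow> real) \<Rightarrow> real" where
  "cov P f g =
     (\<integral>z. (f z - (\<integral>z'. f z' \<partial>P)) * (g z - (\<integral>z'. g z' \<partial>P)) \<partial>P)"

abbreviation var :: "'z measure \<Rightarrow> ('z \<Rightarrow> real) \<Rightarrow> real" where
  "var P f \<equiv> cov P f f"


section \<open>Conditional distribution functions and ranks\<close>

text \<open>
  \<open>F\<close> is a jointly measurable version of \<open>(r, x) \<mapsto> \<P>(R \<le> r | X = x)\<close>.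
\<close>

definition cond_cdf ::
  "'p::finite obs measure \<Rightarrow> ('p obs \<Rightarrow> real) \<Rightarrow> (real \<Rightarrow> real ^ 'p \<Rightarrow> real) \<Rightarrow> bool" where
  "cond_cdf P R F \<longleftrightarrow>
     (\<lambda>(r, x). F r x) \<in> borel_measurable borel \<and>
     (\<forall>r. AE z in P. F r (covar z) =
        real_cond_exp P (vimage_algebra (space P) covar borel)
          (indicator {z \<in> space P. R z \<le> r}) z)"

text \<open>
  Regularity of the conditional law at almost every covariate value. Continuity is on the whole
  line (there is no atom at 0); since the outcome lies in \<open>[0,1]\<close>, strict monotonicity is on
  \<open>[0,1]\<close>. The support of a density is the closure of the set where it does not vanish.
\<close>

definition cond_regular ::
  "'p::finite obs measure \<Rightarrow> (real \<Rightarrow> real ^ 'p \<Rightarrow> real) \<Rightarrow> (real \<Rightarrow> real ^ 'p \<Rightarrow> real) \<Rightarrow> bool" where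
  "cond_regular P F f \<longleftrightarrow>
     (AE x in distr P borel covar.
        continuous_on UNIV (\<lambda>r. F r x) \<and>
        strict_mono_on {0..1} (\<lambda>r. F r x) \<and>
        (\<forall>r. 0 \<le> f r x) \<and>
        (\<forall>r. set_integrable lborel {..r} (\<lambda>t. f t x) \<and> F r x = (LINT t:{..r}|lborel. f t x)) \<and>
        (let S = closure {t. f t x \<noteq> 0} in
           continuous_on S (\<lambda>t. f t x) \<and>
           (\<forall>t\<in>S. \<exists>e>0. bounded ((\<lambda>s. f s x) ` ball t e)) \<and>
           (AE t in lborel. t \<in> S \<longrightarrow> 0 < f t x)))"

definition cond_rank ::
  "('p::finite obs \<Rightarrow> real) \<Rightarrow> (real \<Rightarrow> real ^ 'p \<Rightarrow> real) \<Rightarrow> 'p obs \<Rightarrow> real" where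
  "cond_rank R F z = F (R z) (covar z)"


section \<open>The deep conditional transformation model\<close>

text \<open>
  A feed-forward network. Every unit may carry its own activation, and the parameter
  space below is an arbitrary set of parameters, so weight sharing, sparsity and skip
  connections are covered. Weights and biases of units beyond the layer widths are ignored.
\<close>

record nn_arch =
  nn_depth :: nat
  nn_width :: "nat \<Rightarrow> nat"
  nn_act :: "nat \<Rightarrow> nat \<Rightarrow> real \<Rightarrow> real"

record 'p nn_param =
  nn_input :: "nat \<Rightarrow> real ^ 'p"
  nn_weight :: "nat \<Rightarrow> nat \<Rightarrow> nat \<Rightarrow> real"
  nn_bias :: "nat \<Rightarrow> nat \<Rightarrow> real"

primrec nn_unit ::
  "nn_arch \<Rightarrow> 'p::finite nn_param \<Rightarrow> real ^ 'p \<Rightarrow> nat \<Rightarrow> nat \<Rightarrow> real" where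
  "nn_unit a \<theta> x 0 = (\<lambda>i. nn_act a 0 i (nn_input \<theta> i \<bullet> x + nn_bias \<theta> 0 i))"
| "nn_unit a \<theta> x (Suc l) = (\<lambda>i. nn_act a (Suc l) i
     ((\<Sum>j<nn_width a l. nn_weight \<theta> (Suc l) i j * nn_unit a \<theta> x l j) + nn_bias \<theta> (Suc l) i))"

definition nn_out ::
  "nn_arch \<Rightarrow> 'p::finite nn_param \<Rightarrow> real ^ 'p \<Rightarrow> nat \<Rightarrow> real" where
  "nn_out a \<theta> x i = nn_unit a \<theta> x (nn_depth a) i"

text \<open>Output unit 0 is the offset \<open>c\<close>, output unit \<open>k \<ge> 1\<close> is the increment \<open>\<Delta>\<^sub>k\<close>.\<close>

definition dctm_coeff ::
  "nn_arch \<Rightarrow> 'p::finite nn_param \<Rightarrow> real ^ 'p \<Rightarrow> nat \<Rightarrow> real" where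
  "dctm_coeff a \<theta> x j = nn_out a \<theta> x 0 + (\<Sum>k=1..j. ln (1 + exp (nn_out a \<theta> x k)))"

definition dctm_transform ::
  "nn_arch \<Rightarrow> nat \<Rightarrow> 'p::finite nn_param \<Rightarrow> real \<Rightarrow> real ^ 'p \<Rightarrow> real" where
  "dctm_transform a J \<theta> r x = (\<Sum>j=0..J. dctm_coeff a \<theta> x j * Bernstein J j r)"

text \<open>
  The distribution function \<open>\<Phi>\<close> of the transformation model is that of an arbitrary reference
  law \<open>N\<close> on the line; the normal model is \<open>N = std_normal_distribution\<close>. The normal
  distribution function takes values strictly between 0 and 1, so in the normal model
  every member has \<open>F(1 | x) < 1\<close>, whereas a conditional distribution function of an outcome in
  \<open>[0,1]\<close> has \<open>F(1 | x) = 1\<close>: correct specification is then impossible. Reference laws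
  with compact support (for instance the uniform law) admit correctly specified models.
\<close>

definition dctm_cdf ::
  "real measure \<Rightarrow> nn_arch \<Rightarrow> nat \<Rightarrow> 'p::finite nn_param \<Rightarrow> real \<Rightarrow> real ^ 'p \<Rightarrow> real" where
  "dctm_cdf N a J \<theta> r x = cdf N (dctm_transform a J \<theta> r x)"

definition dctm_class ::
  "real measure \<Rightarrow> nn_arch \<Rightarrow> nat \<Rightarrow> 'p::finite nn_param set
     \<Rightarrow> (real \<Rightarrow> real ^ 'p \<Rightarrow> real) set" where
  "dctm_class N a J \<Theta> = dctm_cdf N a J ` \<Theta>"


section \<open>Losses and risks\<close>

definition nll :: "(real \<Rightarrow> real ^ 'p \<Rightarrow> real) \<Rightarrow> real \<Rightarrow> real ^ 'p \<Rightarrow> real" where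
  "nll F r x = - ln (deriv (\<lambda>s. F s x) r)"

definition pop_risk ::
  "'p::finite obs measure \<Rightarrow> ('p obs \<Rightarrow> real) \<Rightarrow> (real \<Rightarrow> real ^ 'p \<Rightarrow> real) \<Rightarrow> real" where
  "pop_risk P R F = (\<integral>z. nll F (R z) (covar z) \<partial>P)"

definition emp_risk ::
  "('p::finite obs \<Rightarrow> real) \<Rightarrow> nat set \<Rightarrow> (nat \<Rightarrow> 'p obs) \<Rightarrow> (real \<Rightarrow> real ^ 'p \<Rightarrow> real) \<Rightarrow> real" where
  "emp_risk R S D F = (1 / real (card S)) * (\<Sum>i\<in>S. nll F (R (D i)) (covar (D i)))"

text \<open>
  The loss is real-valued with finite expectation on the model class. Without this,
  \<open>ln 0 = 0\<close> and the value 0 of undefined integrals would distort the risks. In the normal model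
  with \<open>J \<ge> 1\<close> and continuous activations it holds automatically, because the model
  densities are bounded and bounded away from 0 on \<open>[0,1] \<times> \<X>\<close>.
\<close>

definition loss_well_defined ::
  "'p::finite obs measure \<Rightarrow> ('p obs \<Rightarrow> real) \<Rightarrow> (real ^ 'p) set
     \<Rightarrow> (real \<Rightarrow> real ^ 'p \<Rightarrow> real) set \<Rightarrow> bool" where
  "loss_well_defined P R \<X> \<F> \<longleftrightarrow>
     (\<forall>F\<in>\<F>.
        (\<forall>x\<in>\<X>. \<forall>r\<in>{0<..<1}. \<exists>d>0. ((\<lambda>s. F s x) has_real_derivative d) (at r)) \<and>
        integrable P (\<lambda>z. nll F (R z) (covar z)))"

text \<open>
  Members of the class are conditional distribution functions on \<open>[0,1] \<times> \<X>\<close> only (the Bernstein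
  expansion is meaningless outside), so membership of \<open>F\<close> is equality with a member there.
\<close>

definition correctly_specified ::
  "(real ^ 'p) set \<Rightarrow> (real \<Rightarrow> real ^ 'p \<Rightarrow> real) set \<Rightarrow> (real \<Rightarrow> real ^ 'p \<Rightarrow> real) \<Rightarrow> bool" where
  "correctly_specified \<X> \<F> F \<longleftrightarrow>
     (\<exists>G\<in>\<F>. \<forall>r\<in>{0..1}. \<forall>x\<in>\<X>. F r x = G r x)"

definition unique_risk_minimizer ::
  "'p::finite obs measure \<Rightarrow> ('p obs \<Rightarrow> real)
     \<Rightarrow> (real \<Rightarrow> real ^ 'p \<Rightarrow> real) set \<Rightarrow> (real \<Rightarrow> real ^ 'p \<Rightarrow> real) \<Rightarrow> bool" where
  "unique_risk_minimizer P R \<F> F \<longleftrightarrow>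
     (\<forall>G\<in>\<F>. pop_risk P R F \<le> pop_risk P R G) \<and>
     (\<forall>F'. is_arg_min (pop_risk P R) (\<lambda>G. G \<in> \<F>) F' \<longrightarrow>
        (AE z in P. F' (R z) (covar z) = F (R z) (covar z)))"


section \<open>Cross-fitting\<close>

text \<open>
  \<open>\<kappa> n i \<omega>\<close> is the fold of observation \<open>i\<close> in the partition of the first \<open>n\<close> observations.
  Observations are numbered from 0 and folds are \<open>0, \<dots>, K - 1\<close>.
\<close>

definition fold_set :: "(nat \<Rightarrow> nat \<Rightarrow> 'a \<Rightarrow> nat) \<Rightarrow> nat \<Rightarrow> nat \<Rightarrow> 'a \<Rightarrow> nat set" where
  "fold_set \<kappa> n k \<omega> = {i. i < n \<and> \<kappa> n i \<omega> = k}"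

definition train_set :: "(nat \<Rightarrow> nat \<Rightarrow> 'a \<Rightarrow> nat) \<Rightarrow> nat \<Rightarrow> nat \<Rightarrow> 'a \<Rightarrow> nat set" where
  "train_set \<kappa> n k \<omega> = {..<n} - fold_set \<kappa> n k \<omega>"

text \<open>
  A random partition, independent of the sample, with asymptotically balanced folds.
\<close>

definition random_folds ::
  "'a measure \<Rightarrow> (nat \<Rightarrow> 'a \<Rightarrow> 'p::finite obs) \<Rightarrow> nat \<Rightarrow> (nat \<Rightarrow> nat \<Rightarrow> 'a \<Rightarrow> nat) \<Rightarrow> bool" where
  "random_folds M Z K \<kappa> \<longleftrightarrow>
     (\<forall>n. \<forall>i<n. \<forall>\<omega>\<in>space M. \<kappa> n i \<omega> < K) \<and>
     (\<forall>n. prob_space.indep_set M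
        (sets (vimage_algebra (space M) (\<lambda>\<omega>. \<lambda>i\<in>{..<n}. \<kappa> n i \<omega>) (PiM {..<n} (\<lambda>_. count_space UNIV))))
        (sets (vimage_algebra (space M) (\<lambda>\<omega>. \<lambda>i\<in>{..<n}. Z i \<omega>) (PiM {..<n} (\<lambda>_. borel))))) \<and>
     (\<forall>k<K. AE \<omega> in M.
        (\<lambda>n. real (card (fold_set \<kappa> n k \<omega>)) / real n) \<longlonglongrightarrow> 1 / real K \<and>
        (\<lambda>n. real (card (train_set \<kappa> n k \<omega>)) / real n) \<longlonglongrightarrow> 1 - 1 / real K)"

text \<open>
  An estimation rule maps an index set \<open>S\<close> and the observations with index in \<open>S\<close> to a fitted
  distribution function; the out-of-fold fit sees the training observations only.
\<close>

type_synonym 'p est_rule = "nat set \<Rightarrow> (nat \<Rightarrow> 'p obs) \<Rightarrow> real \<Rightarrow> real ^ 'p \<Rightarrow> real"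

definition oof_cdf ::
  "'p::finite est_rule \<Rightarrow> (nat \<Rightarrow> 'a \<Rightarrow> 'p obs) \<Rightarrow> (nat \<Rightarrow> nat \<Rightarrow> 'a \<Rightarrow> nat)
     \<Rightarrow> nat \<Rightarrow> nat \<Rightarrow> 'a \<Rightarrow> real \<Rightarrow> real ^ 'p \<Rightarrow> real" where
  "oof_cdf est Z \<kappa> n k \<omega> =
     est (train_set \<kappa> n k \<omega>) (\<lambda>i\<in>train_set \<kappa> n k \<omega>. Z i \<omega>)"

definition oof_rank ::
  "('p::finite obs \<Rightarrow> real) \<Rightarrow> 'p est_rule \<Rightarrow> (nat \<Rightarrow> 'a \<Rightarrow> 'p obs) \<Rightarrow> (nat \<Rightarrow> nat \<Rightarrow> 'a \<Rightarrow> nat)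
     \<Rightarrow> nat \<Rightarrow> 'a \<Rightarrow> nat \<Rightarrow> real" where
  "oof_rank R est Z \<kappa> n \<omega> i = oof_cdf est Z \<kappa> n (\<kappa> n i \<omega>) \<omega> (R (Z i \<omega>)) (covar (Z i \<omega>))"

definition is_erm ::
  "'a measure \<Rightarrow> ('p::finite obs \<Rightarrow> real) \<Rightarrow> (real \<Rightarrow> real ^ 'p \<Rightarrow> real) set \<Rightarrow> 'p est_rule
     \<Rightarrow> (nat \<Rightarrow> 'a \<Rightarrow> 'p obs) \<Rightarrow> nat \<Rightarrow> (nat \<Rightarrow> nat \<Rightarrow> 'a \<Rightarrow> nat) \<Rightarrow> bool" where
  "is_erm M R \<F> est Z K \<kappa> \<longleftrightarrow>
     (\<forall>n. \<forall>k<K. AE \<omega> in M.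
        is_arg_min (emp_risk R (train_set \<kappa> n k \<omega>) (\<lambda>i. Z i \<omega>)) (\<lambda>G. G \<in> \<F>)
          (oof_cdf est Z \<kappa> n k \<omega>))"

definition uniform_lln ::
  "'a measure \<Rightarrow> 'p::finite obs measure \<Rightarrow> ('p obs \<Rightarrow> real) \<Rightarrow> (real \<Rightarrow> real ^ 'p \<Rightarrow> real) set
     \<Rightarrow> (nat \<Rightarrow> 'a \<Rightarrow> 'p obs) \<Rightarrow> nat \<Rightarrow> (nat \<Rightarrow> nat \<Rightarrow> 'a \<Rightarrow> nat) \<Rightarrow> bool" where
  "uniform_lln M P R \<F> Z K \<kappa> \<longleftrightarrow>
     (\<forall>k<K. conv_prob_zero M (\<lambda>n \<omega>. SUP F\<in>\<F>.
        ennreal \<bar>emp_risk R (train_set \<kappa> n k \<omega>) (\<lambda>i. Z i \<omega>) F - pop_risk P R F\<bar>))"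

text \<open>
  The uniform linear expansion of the out-of-fold fits. The function \<open>\<phi>\<close> is
  total; only its values on \<open>[0,1] \<times> \<X> \<times> ([0,1] \<times> [0,1] \<times> \<X>)\<close> matter.
\<close>

definition linear_expansion ::
  "'a measure \<Rightarrow> (real ^ 'p) set \<Rightarrow> 'p::finite est_rule \<Rightarrow> (real \<Rightarrow> real ^ 'p \<Rightarrow> real)
     \<Rightarrow> (real \<Rightarrow> real ^ 'p \<Rightarrow> 'p obs \<Rightarrow> real)
     \<Rightarrow> (nat \<Rightarrow> 'a \<Rightarrow> 'p obs) \<Rightarrow> nat \<Rightarrow> (nat \<Rightarrow> nat \<Rightarrow> 'a \<Rightarrow> nat) \<Rightarrow> bool" where
  "linear_expansion M \<X> est F \<phi> Z K \<kappa> \<longleftrightarrow>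
     (\<forall>k<K. conv_prob_zero M (\<lambda>n \<omega>.
        let S = train_set \<kappa> n k \<omega> in
        SUP (r, x) \<in> {0..1} \<times> \<X>. ennreal
          \<bar>sqrt (card S) * (oof_cdf est Z \<kappa> n k \<omega> r x - F r x)
             - (1 / sqrt (card S)) * (\<Sum>j\<in>S. \<phi> r x (Z j \<omega>))\<bar>))"

definition expansion_kernel ::
  "'p::finite obs measure \<Rightarrow> (real ^ 'p) set \<Rightarrow> (real \<Rightarrow> real ^ 'p \<Rightarrow> 'p obs \<Rightarrow> real) \<Rightarrow> bool" where
  "expansion_kernel P \<X> \<phi> \<longleftrightarrow>
     (\<lambda>(r, x, z). \<phi> r x z) \<in> borel_measurable borel \<and>
     (\<forall>r\<in>{0..1}. \<forall>x\<in>\<X>. (\<integral>z. \<phi> r x z \<partial>P) = 0) \<and>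
     (\<exists>\<delta>>0. (\<integral>\<^sup>+z. (SUP (r, x) \<in> {0..1} \<times> \<X>. ennreal (\<bar>\<phi> r x z\<bar> powr (2 + \<delta>))) \<partial>P) < \<infinity>)"


section \<open>Target and estimators\<close>

definition rho_C :: "'z measure \<Rightarrow> ('z \<Rightarrow> real) \<Rightarrow> ('z \<Rightarrow> real) \<Rightarrow> real" where
  "rho_C P U V = cov P U V / var P V"

definition avg :: "nat \<Rightarrow> (nat \<Rightarrow> real) \<Rightarrow> real" where
  "avg n u = (1 / real n) * (\<Sum>i<n. u i)"

definition rho_ols :: "nat \<Rightarrow> (nat \<Rightarrow> real) \<Rightarrow> (nat \<Rightarrow> real) \<Rightarrow> real" where
  "rho_ols n u v =
     (\<Sum>i<n. (u i - avg n u) * (v i - avg n v)) / (\<Sum>i<n. (v i - avg n v)\<^sup>2)"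

definition rho_corr :: "nat \<Rightarrow> (nat \<Rightarrow> real) \<Rightarrow> (nat \<Rightarrow> real) \<Rightarrow> real" where
  "rho_corr n u v =
     (\<Sum>i<n. (u i - avg n u) * (v i - avg n v))
       / sqrt ((\<Sum>i<n. (u i - avg n u)\<^sup>2) * (\<Sum>i<n. (v i - avg n v)\<^sup>2))"

definition rho_cov :: "nat \<Rightarrow> (nat \<Rightarrow> real) \<Rightarrow> (nat \<Rightarrow> real) \<Rightarrow> real" where
  "rho_cov n u v = (12 / real n) * (\<Sum>i<n. (u i - 1/2) * (v i - 1/2))"


section \<open>Influence functions\<close>

text \<open>
  \<open>\<gamma>(Z)\<close> is a version of \<open>\<E>[g(Z', Z) | Z]\<close> for an independent copy \<open>Z'\<close> of \<open>Z\<close>. The pair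
  \<open>(Z, Z')\<close> is realised as the coordinates of \<open>P \<Otimes>\<^sub>M P\<close>.
\<close>

definition copy_cond_exp ::
  "'z measure \<Rightarrow> ('z \<Rightarrow> 'z \<Rightarrow> real) \<Rightarrow> ('z \<Rightarrow> real) \<Rightarrow> bool" where
  "copy_cond_exp P g \<gamma> \<longleftrightarrow>
     \<gamma> \<in> borel_measurable P \<and>
     (AE p in P \<Otimes>\<^sub>M P. \<gamma> (fst p) =
        real_cond_exp (P \<Otimes>\<^sub>M P) (vimage_algebra (space (P \<Otimes>\<^sub>M P)) fst P)
          (\<lambda>(z, z'). g z' z) p)"

definition psi_A ::
  "'z measure \<Rightarrow> ('z \<Rightarrow> real) \<Rightarrow> ('z \<Rightarrow> real) \<Rightarrow> ('z \<Rightarrow> real) \<Rightarrow> ('z \<Rightarrow> real) \<Rightarrow> 'z \<Rightarrow> real" where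
  "psi_A P U V \<gamma>Y \<gamma>W z =
     ((U z - 1/2) * (V z - 1/2) - (\<integral>z'. (U z' - 1/2) * (V z' - 1/2) \<partial>P)) + \<gamma>Y z + \<gamma>W z"

definition psi_sq ::
  "'z measure \<Rightarrow> ('z \<Rightarrow> real) \<Rightarrow> ('z \<Rightarrow> real) \<Rightarrow> 'z \<Rightarrow> real" where
  "psi_sq P U \<delta> z = ((U z - 1/2)\<^sup>2 - (\<integral>z'. (U z' - 1/2)\<^sup>2 \<partial>P)) + \<delta> z"

text \<open>
  \<open>T n\<close> is asymptotically normal around \<open>\<rho>\<close> with influence function \<open>\<psi>\<close>. Square integrability
  makes the asymptotic variance a genuine variance.
\<close>

definition asymp_normal_with_influence ::
  "'a measure \<Rightarrow> 'z measure \<Rightarrow> (nat \<Rightarrow> 'a \<Rightarrow> 'z) \<Rightarrow> (nat \<Rightarrow> 'a \<Rightarrow> real) \<Rightarrow> real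
     \<Rightarrow> ('z \<Rightarrow> real) \<Rightarrow> bool" where
  "asymp_normal_with_influence M P Z T \<rho> \<psi> \<longleftrightarrow>
     \<psi> \<in> borel_measurable P \<and> integrable P (\<lambda>z. (\<psi> z)\<^sup>2) \<and>
     weak_conv_m (\<lambda>n. distr M borel (\<lambda>\<omega>. sqrt n * (T n \<omega> - \<rho>))) (normal_law (var P \<psi>)) \<and>
     conv_prob_zero M (\<lambda>n \<omega>. ennreal
       \<bar>sqrt n * (T n \<omega> - \<rho>) - (1 / sqrt n) * (\<Sum>i<n. \<psi> (Z i \<omega>))\<bar>)"

end

theory Submission
  imports Defs
begin

text \<open>
  Each out-of-fold error (fitted minus true rank of observation \<open>i\<close>) is, up to a uniform
  \<open>o\<^sub>p(1 / sqrt n)\<close>, the average of \<open>\<phi>(R\<^sub>i, X\<^sub>i; Z\<^sub>j)\<close> over the training indices \<open>j\<close>. Since \<open>i\<close> is not a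
  training index for its own fold, these averages have second moment \<open>O(1 / n)\<close>, so no
  empirical-process argument is needed: products of two errors are negligible, and weighted sums of
  errors are two-sample U-statistics between a fold and its complement. Subtracting the projection on
  \<open>Z\<^sub>j\<close> (the functions \<open>\<gamma>\<close>, \<open>\<delta>\<close>) leaves a kernel that is degenerate in both arguments, hence a
  negligible double sum. The projections recombine because each observation is used for training in
  \<open>K - 1\<close> folds and the ratio of fold size to training size tends to \<open>1 / (K - 1)\<close>. So the empirical
  second moments of the ranks are asymptotically linear; the delta method at \<open>(\<rho>/12, 1/12, 1/12)\<close> (the
  conditional ranks are uniform) and the central limit theorem finish the proof.
\<close>

section \<open>Stochastic order symbols\<close>

text \<open>Two obstacles shape the proof. Fitted functions and suprema need not be measurable, so
  all stochastic orders are stated with outer measure, and exceptional sets are carried along as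
  explicit sets whose outer measure vanishes. Moreover the training sets are random, so moments of
  fold-dependent sums are not computed directly: each such sum is written as a function of a frozen
  assignment \<open>c\<close> and of the data, its second moment is bounded uniformly in
  \<open>c\<close>, and the independence of folds and sample transfers the bound. Assignments with
  too small a training set are set to 0 in these functions and discarded separately.

  Uniformity of the expansion in (r, x) is what allows it to be evaluated at the random point (R_i,
  X_i). The split of the weighted kernel is a Hoeffding decomposition; as the kernel already has
  mean zero in its training argument, only one projection appears, and it is identified with the
  given conditional expectations by Fubini. The uniform moments of the ranks need an argument of
  their own, because the conditional CDF is tied to the law only at each fixed threshold, up to a
  null set that may depend on the threshold.\<close>

definition o_p :: "'a measure \<Rightarrow> (nat \<Rightarrow> 'a \<Rightarrow> real) \<Rightarrow> bool" where
  "o_p M f \<longleftrightarrow> conv_prob_zero M (\<lambda>n \<omega>. ennreal \<bar>f n \<omega>\<bar>)"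

text \<open>The bound is asked only for large \<open>n\<close>, so finitely many sample sizes, in
  particular \<open>n = 0\<close> with its divisions by zero, never matter.\<close>

definition O_p :: "'a measure \<Rightarrow> (nat \<Rightarrow> 'a \<Rightarrow> real) \<Rightarrow> bool" where
  "O_p M f \<longleftrightarrow> (\<forall>\<eta>>0. \<exists>C>0. \<forall>\<^sub>F n in sequentially.
     outer_measure_of M {\<omega> \<in> space M. C < \<bar>f n \<omega>\<bar>} \<le> ennreal \<eta>)"

text \<open>Subadditivity for sets that need not be measurable: both sets on the right have
  measurable hulls of the same outer measure, and the measure is subadditive on the hulls.\<close>

lemma outer_measure_of_le_Un:
  assumes "A \<subseteq> B \<union> C" "B \<subseteq> space M" "C \<subseteq> space M"
  shows "outer_measure_of M A \<le> outer_measure_of M B + outer_measure_of M C"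
proof -
  obtain B' where B': "B' \<in> sets M" "B \<subseteq> B'" "outer_measure_of M B = emeasure M B'"
    using outer_measure_of_attain[OF assms(2)] by auto
  obtain C' where C': "C' \<in> sets M" "C \<subseteq> C'" "outer_measure_of M C = emeasure M C'"
    using outer_measure_of_attain[OF assms(3)] by auto
  have "outer_measure_of M A \<le> outer_measure_of M (B' \<union> C')"
    using assms(1) B' C' by (intro outer_measure_of_mono) auto
  also have "\<dots> \<le> emeasure M B' + emeasure M C'"
    using B' C' by (simp add: emeasure_subadditive)
  finally show ?thesis using B' C' by simp
qed

lemma outer_measure_of_null:
  assumes "AE \<omega> in M. \<not> Q \<omega>"
  shows "outer_measure_of M {\<omega> \<in> space M. Q \<omega>} = 0"
proof -
  obtain N where N: "{\<omega> \<in> space M. \<not> \<not> Q \<omega>} \<subseteq> N" "N \<in> null_sets M"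
    using assms by (auto simp: eventually_ae_filter)
  then have "outer_measure_of M {\<omega> \<in> space M. Q \<omega>} \<le> outer_measure_of M N"
    by (intro outer_measure_of_mono) auto
  also have "\<dots> = 0" using N by (auto simp: null_sets_def)
  finally show ?thesis by simp
qed

lemma tendsto_0_ennreal_iff:
  fixes f :: "nat \<Rightarrow> ennreal"
  shows "f \<longlonglongrightarrow> 0 \<longleftrightarrow> (\<forall>\<eta>>0. \<forall>\<^sub>F n in sequentially. f n \<le> ennreal \<eta>)"
proof safe
  fix \<eta> :: real assume "f \<longlonglongrightarrow> 0" "\<eta> > 0"
  then have "\<forall>\<^sub>F n in sequentially. f n < ennreal \<eta>"
    by (intro order_tendstoD) auto
  then show "\<forall>\<^sub>F n in sequentially. f n \<le> ennreal \<eta>" by eventually_elim auto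
next
  assume *: "\<forall>\<eta>>0. \<forall>\<^sub>F n in sequentially. f n \<le> ennreal \<eta>"
  show "f \<longlonglongrightarrow> 0"
  proof (rule order_tendstoI)
    fix a :: ennreal assume "0 < a"
    \<comment> \<open>Since \<open>a\<close> may be infinite, a smaller positive \<open>e\<close> is
      taken; it is finite and therefore comes from a real number.\<close>
    then obtain e where e: "0 < e" "e < a" using dense by blast
    from e(2) have "e < top" by (rule less_le_trans) simp
    with e(1) have "enn2real e > 0" "ennreal (enn2real e) = e"
      by (auto simp: enn2real_positive_iff)
    with *[rule_format, of "enn2real e"] e show "\<forall>\<^sub>F n in sequentially. f n < a"
      by (auto elim!: eventually_mono)
  qed auto
qed

lemma o_p_iff:
  "o_p M f \<longleftrightarrow> (\<forall>\<epsilon>>0. \<forall>\<eta>>0. \<forall>\<^sub>F n in sequentially.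
     outer_measure_of M {\<omega> \<in> space M. \<epsilon> < \<bar>f n \<omega>\<bar>} \<le> ennreal \<eta>)"
  unfolding o_p_def conv_prob_zero_def tendsto_0_ennreal_iff
  by (simp add: ennreal_less_iff cong: conj_cong)

lemma o_pD:
  assumes "o_p M f" "\<epsilon> > 0" "\<eta> > 0"
  shows "\<forall>\<^sub>F n in sequentially. outer_measure_of M {\<omega> \<in> space M. \<epsilon> < \<bar>f n \<omega>\<bar>} \<le> ennreal \<eta>"
  using assms unfolding o_p_iff by blast

lemma outer_measure_of_half:
  assumes "A \<subseteq> B \<union> C" "B \<subseteq> space M" "C \<subseteq> space M" "\<eta> > 0"
    "outer_measure_of M B \<le> ennreal (\<eta>/2)" "outer_measure_of M C \<le> ennreal (\<eta>/2)"
  shows "outer_measure_of M A \<le> ennreal \<eta>"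
proof -
  have "outer_measure_of M A \<le> ennreal (\<eta>/2) + ennreal (\<eta>/2)"
    using outer_measure_of_le_Un[OF assms(1-3)] add_mono[OF assms(5,6)] by (rule order_trans)
  also have "\<dots> = ennreal \<eta>" using assms(4) by (simp flip: ennreal_plus)
  finally show ?thesis .
qed

text \<open>The comparison may fail for small \<open>n\<close> and on sets \<open>negl n\<close> of
  vanishing outer measure. This is how null sets of bad data, unbalanced fold assignments and
  truncation events are discarded later.\<close>

lemma o_p_dominated:
  assumes "o_p M f" "\<And>n. negl n \<subseteq> space M" "(\<lambda>n. outer_measure_of M (negl n)) \<longlonglongrightarrow> 0"
    and "\<forall>\<^sub>F n in sequentially. \<forall>\<omega>\<in>space M - negl n. \<bar>g n \<omega>\<bar> \<le> \<bar>f n \<omega>\<bar>"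
  shows "o_p M g"
  unfolding o_p_iff
proof safe
  fix \<epsilon> \<eta> :: real assume pos: "\<epsilon> > 0" "\<eta> > 0"
  have "\<forall>\<^sub>F n in sequentially. outer_measure_of M {\<omega> \<in> space M. \<epsilon> < \<bar>f n \<omega>\<bar>} \<le> ennreal (\<eta>/2)"
    by (rule o_pD) (use assms(1) pos in auto)
  moreover have "\<forall>\<^sub>F n in sequentially. outer_measure_of M (negl n) \<le> ennreal (\<eta>/2)"
    using assms(3) pos unfolding tendsto_0_ennreal_iff by simp
  ultimately show "\<forall>\<^sub>F n in sequentially. outer_measure_of M {\<omega> \<in> space M. \<epsilon> < \<bar>g n \<omega>\<bar>} \<le> ennreal \<eta>"
    using assms(4)
  proof eventually_elim
    case (elim n)
    have "{\<omega> \<in> space M. \<epsilon> < \<bar>g n \<omega>\<bar>} \<subseteq> {\<omega> \<in> space M. \<epsilon> < \<bar>f n \<omega>\<bar>} \<union> negl n"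
      using elim(3) by force
    then show ?case
      by (rule outer_measure_of_half[OF _ _ assms(2) pos(2) elim(1,2)]) auto
  qed
qed

lemma O_p_dominated:
  assumes "O_p M f" "\<And>n. negl n \<subseteq> space M" "(\<lambda>n. outer_measure_of M (negl n)) \<longlonglongrightarrow> 0"
    and "\<forall>\<^sub>F n in sequentially. \<forall>\<omega>\<in>space M - negl n. \<bar>g n \<omega>\<bar> \<le> \<bar>f n \<omega>\<bar>"
  shows "O_p M g"
  unfolding O_p_def
proof safe
  fix \<eta> :: real assume pos: "\<eta> > 0"
  then obtain C where C: "C > 0"
    "\<forall>\<^sub>F n in sequentially. outer_measure_of M {\<omega> \<in> space M. C < \<bar>f n \<omega>\<bar>} \<le> ennreal (\<eta>/2)"
    using assms(1) unfolding O_p_def by (meson half_gt_zero)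
  have "\<forall>\<^sub>F n in sequentially. outer_measure_of M (negl n) \<le> ennreal (\<eta>/2)"
    using assms(3) pos unfolding tendsto_0_ennreal_iff by simp
  with C(2) assms(4)
  have "\<forall>\<^sub>F n in sequentially. outer_measure_of M {\<omega> \<in> space M. C < \<bar>g n \<omega>\<bar>} \<le> ennreal \<eta>"
  proof eventually_elim
    case (elim n)
    have "{\<omega> \<in> space M. C < \<bar>g n \<omega>\<bar>} \<subseteq> {\<omega> \<in> space M. C < \<bar>f n \<omega>\<bar>} \<union> negl n"
      using elim(2) by force
    then show ?case
      by (rule outer_measure_of_half[OF _ _ assms(2) pos elim(1,3)]) auto
  qed
  with C(1) show "\<exists>C>0. \<forall>\<^sub>F n in sequentially.
      outer_measure_of M {\<omega> \<in> space M. C < \<bar>g n \<omega>\<bar>} \<le> ennreal \<eta>" by blast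
qed

lemma outer_measure_of_empty_tendsto: "(\<lambda>n. outer_measure_of M {}) \<longlonglongrightarrow> 0"
  by simp

lemmas o_p_mono = o_p_dominated[where negl = "\<lambda>_. {}", OF _ _ outer_measure_of_empty_tendsto, simplified]
lemmas O_p_mono = O_p_dominated[where negl = "\<lambda>_. {}", OF _ _ outer_measure_of_empty_tendsto, simplified]

section \<open>Arithmetic of the stochastic order symbols\<close>

lemma o_p_0: "o_p M (\<lambda>n \<omega>. 0)"
  unfolding o_p_iff by (auto simp: less_le_not_le)

lemma o_p_imp_O_p: "o_p M f \<Longrightarrow> O_p M f"
  unfolding o_p_iff O_p_def by (meson zero_less_one)

lemma o_p_add:
  assumes "o_p M f" "o_p M g"
  shows "o_p M (\<lambda>n \<omega>. f n \<omega> + g n \<omega>)"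
  unfolding o_p_iff
proof safe
  fix \<epsilon> \<eta> :: real assume pos: "\<epsilon> > 0" "\<eta> > 0"
  have "\<forall>\<^sub>F n in sequentially. outer_measure_of M {\<omega> \<in> space M. \<epsilon>/2 < \<bar>f n \<omega>\<bar>} \<le> ennreal (\<eta>/2)"
    "\<forall>\<^sub>F n in sequentially. outer_measure_of M {\<omega> \<in> space M. \<epsilon>/2 < \<bar>g n \<omega>\<bar>} \<le> ennreal (\<eta>/2)"
    by (rule o_pD; use assms pos in simp)+
  then show "\<forall>\<^sub>F n in sequentially.
      outer_measure_of M {\<omega> \<in> space M. \<epsilon> < \<bar>f n \<omega> + g n \<omega>\<bar>} \<le> ennreal \<eta>"
  proof eventually_elim
    case (elim n)
    have "{\<omega> \<in> space M. \<epsilon> < \<bar>f n \<omega> + g n \<omega>\<bar>} \<subseteq>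
        {\<omega> \<in> space M. \<epsilon>/2 < \<bar>f n \<omega>\<bar>} \<union> {\<omega> \<in> space M. \<epsilon>/2 < \<bar>g n \<omega>\<bar>}"
      by (auto simp del: less_divide_eq_numeral1)
    then show ?case by (rule outer_measure_of_half[OF _ _ _ pos(2) elim]) auto
  qed
qed

lemma O_p_add:
  assumes "O_p M f" "O_p M g"
  shows "O_p M (\<lambda>n \<omega>. f n \<omega> + g n \<omega>)"
  unfolding O_p_def
proof safe
  fix \<eta> :: real assume pos: "\<eta> > 0"
  obtain C D where CD: "C > 0" "D > 0"
    "\<forall>\<^sub>F n in sequentially. outer_measure_of M {\<omega> \<in> space M. C < \<bar>f n \<omega>\<bar>} \<le> ennreal (\<eta>/2)"
    "\<forall>\<^sub>F n in sequentially. outer_measure_of M {\<omega> \<in> space M. D < \<bar>g n \<omega>\<bar>} \<le> ennreal (\<eta>/2)"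
    using assms pos unfolding O_p_def by (meson half_gt_zero)
  from CD(3,4) have "\<forall>\<^sub>F n in sequentially.
      outer_measure_of M {\<omega> \<in> space M. C + D < \<bar>f n \<omega> + g n \<omega>\<bar>} \<le> ennreal \<eta>"
  proof eventually_elim
    case (elim n)
    have "{\<omega> \<in> space M. C + D < \<bar>f n \<omega> + g n \<omega>\<bar>} \<subseteq>
        {\<omega> \<in> space M. C < \<bar>f n \<omega>\<bar>} \<union> {\<omega> \<in> space M. D < \<bar>g n \<omega>\<bar>}"
      by auto
    then show ?case by (rule outer_measure_of_half[OF _ _ _ pos elim]) auto
  qed
  with CD(1,2) show "\<exists>C>0. \<forall>\<^sub>F n in sequentially.
      outer_measure_of M {\<omega> \<in> space M. C < \<bar>f n \<omega> + g n \<omega>\<bar>} \<le> ennreal \<eta>"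
    by (intro exI[of _ "C + D"]) auto
qed

lemma abs_mult_gt_subset:
  fixes f g :: "'a \<Rightarrow> real"
  assumes "0 \<le> C"
  shows "{\<omega> \<in> S. C * D < \<bar>f \<omega> * g \<omega>\<bar>} \<subseteq> {\<omega> \<in> S. C < \<bar>f \<omega>\<bar>} \<union> {\<omega> \<in> S. D < \<bar>g \<omega>\<bar>}"
proof (safe, rule ccontr)
  fix \<omega> assume *: "C * D < \<bar>f \<omega> * g \<omega>\<bar>" "\<not> D < \<bar>g \<omega>\<bar>" "\<not> C < \<bar>f \<omega>\<bar>"
  then have "\<bar>f \<omega>\<bar> * \<bar>g \<omega>\<bar> \<le> C * D"
    using assms by (intro mult_mono) auto
  with * show False by (simp add: abs_mult)
qed

lemma o_p_mult_O_p:
  assumes "o_p M f" "O_p M g"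
  shows "o_p M (\<lambda>n \<omega>. f n \<omega> * g n \<omega>)"
  unfolding o_p_iff
proof safe
  fix \<epsilon> \<eta> :: real assume pos: "\<epsilon> > 0" "\<eta> > 0"
  obtain C where C: "C > 0"
    "\<forall>\<^sub>F n in sequentially. outer_measure_of M {\<omega> \<in> space M. C < \<bar>g n \<omega>\<bar>} \<le> ennreal (\<eta>/2)"
    using assms(2) pos unfolding O_p_def by (meson half_gt_zero)
  have sub: "{\<omega> \<in> space M. \<epsilon> < \<bar>f n \<omega> * g n \<omega>\<bar>} \<subseteq>
      {\<omega> \<in> space M. \<epsilon> / C < \<bar>f n \<omega>\<bar>} \<union> {\<omega> \<in> space M. C < \<bar>g n \<omega>\<bar>}" for n
    using abs_mult_gt_subset[of "\<epsilon> / C" "space M" C "f n" "g n"] pos C(1) by simp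
  have "\<forall>\<^sub>F n in sequentially. outer_measure_of M {\<omega> \<in> space M. \<epsilon>/C < \<bar>f n \<omega>\<bar>} \<le> ennreal (\<eta>/2)"
    by (rule o_pD) (use assms(1) pos C(1) in auto)
  with C(2) show "\<forall>\<^sub>F n in sequentially.
      outer_measure_of M {\<omega> \<in> space M. \<epsilon> < \<bar>f n \<omega> * g n \<omega>\<bar>} \<le> ennreal \<eta>"
    by eventually_elim (rule outer_measure_of_half[OF sub _ _ pos(2)], auto)
qed

lemma O_p_mult:
  assumes "O_p M f" "O_p M g"
  shows "O_p M (\<lambda>n \<omega>. f n \<omega> * g n \<omega>)"
  unfolding O_p_def
proof safe
  fix \<eta> :: real assume pos: "\<eta> > 0"
  obtain C D where CD: "C > 0" "D > 0"
    "\<forall>\<^sub>F n in sequentially. outer_measure_of M {\<omega> \<in> space M. C < \<bar>f n \<omega>\<bar>} \<le> ennreal (\<eta>/2)"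
    "\<forall>\<^sub>F n in sequentially. outer_measure_of M {\<omega> \<in> space M. D < \<bar>g n \<omega>\<bar>} \<le> ennreal (\<eta>/2)"
    using assms pos unfolding O_p_def by (meson half_gt_zero)
  from CD(3,4) have "\<forall>\<^sub>F n in sequentially.
      outer_measure_of M {\<omega> \<in> space M. C * D < \<bar>f n \<omega> * g n \<omega>\<bar>} \<le> ennreal \<eta>"
    by eventually_elim (rule outer_measure_of_half[OF abs_mult_gt_subset _ _ pos], use CD(1) in auto)
  with CD(1,2) show "\<exists>C>0. \<forall>\<^sub>F n in sequentially.
      outer_measure_of M {\<omega> \<in> space M. C < \<bar>f n \<omega> * g n \<omega>\<bar>} \<le> ennreal \<eta>"
    by (intro exI[of _ "C * D"]) auto
qed

lemma O_p_bounded_sequence: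
  assumes "\<forall>\<^sub>F n in sequentially. \<bar>c n\<bar> \<le> C"
  shows "O_p M (\<lambda>n \<omega>. c n)"
  unfolding O_p_def
proof (intro allI impI exI conjI)
  show "\<bar>C\<bar> + 1 > 0" by simp
  fix \<eta> :: real assume "\<eta> > 0"
  show "\<forall>\<^sub>F n in sequentially. outer_measure_of M {\<omega> \<in> space M. \<bar>C\<bar> + 1 < \<bar>c n\<bar>} \<le> ennreal \<eta>"
    using assms
  proof eventually_elim
    case (elim n)
    then have e: "{\<omega> \<in> space M. \<bar>C\<bar> + 1 < \<bar>c n\<bar>} = {}" by auto
    show ?case unfolding e by simp
  qed
qed

lemma O_p_const: "O_p M (\<lambda>n \<omega>. c)"
  by (rule O_p_bounded_sequence[of _ "\<bar>c\<bar>"]) simp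

lemma o_p_sequence:
  assumes "c \<longlonglongrightarrow> 0"
  shows "o_p M (\<lambda>n \<omega>. c n)"
  unfolding o_p_iff
proof (intro allI impI)
  fix \<epsilon> \<eta> :: real assume pos: "\<epsilon> > 0" "\<eta> > 0"
  have "\<forall>\<^sub>F n in sequentially. \<bar>c n\<bar> < \<epsilon>"
    using tendsto_rabs[OF assms] pos(1) by (intro order_tendstoD(2)[where y = 0]) auto
  then show "\<forall>\<^sub>F n in sequentially. outer_measure_of M {\<omega> \<in> space M. \<epsilon> < \<bar>c n\<bar>} \<le> ennreal \<eta>"
  proof eventually_elim
    case (elim n)
    then have e: "{\<omega> \<in> space M. \<epsilon> < \<bar>c n\<bar>} = {}" by auto
    show ?case unfolding e by simp
  qed
qed

lemma o_p_cmult: "o_p M f \<Longrightarrow> o_p M (\<lambda>n \<omega>. c * f n \<omega>)"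
  using o_p_mult_O_p[of M f "\<lambda>_ _. c", OF _ O_p_const] by (simp add: mult.commute)

lemma O_p_cmult: "O_p M f \<Longrightarrow> O_p M (\<lambda>n \<omega>. c * f n \<omega>)"
  using O_p_mult[of M "\<lambda>_ _. c" f, OF O_p_const] by simp

lemma o_p_diff: "o_p M f \<Longrightarrow> o_p M g \<Longrightarrow> o_p M (\<lambda>n \<omega>. f n \<omega> - g n \<omega>)"
  using o_p_add[of M f "\<lambda>n \<omega>. (-1) * g n \<omega>"] o_p_cmult[of M g "-1"] by simp

lemma o_p_sum:
  assumes "finite I" "\<And>i. i \<in> I \<Longrightarrow> o_p M (f i)"
  shows "o_p M (\<lambda>n \<omega>. \<Sum>i\<in>I. f i n \<omega>)"
  using assms by (induction I rule: finite_induct) (auto intro: o_p_0 o_p_add)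

text \<open>Continuous mapping at a constant limit; it is applied to the slope function in the delta
  method.\<close>

lemma o_p_isCont:
  assumes "o_p M (\<lambda>n \<omega>. x n \<omega> - a)" "isCont g a"
  shows "o_p M (\<lambda>n \<omega>. g (x n \<omega>) - g a)"
  unfolding o_p_iff
proof safe
  fix \<epsilon> \<eta> :: real assume pos: "\<epsilon> > 0" "\<eta> > 0"
  obtain d where d: "d > 0" "\<And>y. \<bar>y - a\<bar> < d \<Longrightarrow> \<bar>g y - g a\<bar> < \<epsilon>"
    using assms(2) pos(1) unfolding continuous_at_eps_delta dist_real_def by metis
  have "\<forall>\<^sub>F n in sequentially. outer_measure_of M {\<omega> \<in> space M. d/2 < \<bar>x n \<omega> - a\<bar>} \<le> ennreal \<eta>"
    by (rule o_pD) (use assms(1) pos d(1) in auto)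
  then show "\<forall>\<^sub>F n in sequentially. outer_measure_of M {\<omega> \<in> space M. \<epsilon> < \<bar>g (x n \<omega>) - g a\<bar>} \<le> ennreal \<eta>"
  proof eventually_elim
    case (elim n)
    have "{\<omega> \<in> space M. \<epsilon> < \<bar>g (x n \<omega>) - g a\<bar>} \<subseteq> {\<omega> \<in> space M. d/2 < \<bar>x n \<omega> - a\<bar>}"
      using d(2)[of "x n _"] d(1) by (auto simp: not_less) (smt (verit) field_sum_of_halves)
    from outer_measure_of_mono[OF this] elim show ?case by (rule order_trans)
  qed
qed

text \<open>\<open>\<alpha>\<close> is the whole normalized influence sum, not the influence
  function. Its boundedness in probability is part of the notion because it makes products of two
  centred deviations negligible.\<close>

definition asymp_linear ::
  "'a measure \<Rightarrow> (nat \<Rightarrow> 'a \<Rightarrow> real) \<Rightarrow> real \<Rightarrow> (nat \<Rightarrow> 'a \<Rightarrow> real) \<Rightarrow> bool" where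
  "asymp_linear M x a \<alpha> \<longleftrightarrow> o_p M (\<lambda>n \<omega>. sqrt n * (x n \<omega> - a) - \<alpha> n \<omega>) \<and> O_p M \<alpha>"

lemma asymp_linear_O_p:
  assumes "asymp_linear M x a \<alpha>"
  shows "O_p M (\<lambda>n \<omega>. sqrt n * (x n \<omega> - a))"
proof -
  have "O_p M (\<lambda>n \<omega>. (sqrt n * (x n \<omega> - a) - \<alpha> n \<omega>) + \<alpha> n \<omega>)"
    by (rule O_p_add[OF o_p_imp_O_p]) (use assms in \<open>auto simp: asymp_linear_def\<close>)
  then show ?thesis by simp
qed

lemma o_p_of_sqrt_O_p:
  fixes y :: "nat \<Rightarrow> 'a \<Rightarrow> real"
  assumes "O_p M (\<lambda>n \<omega>. sqrt n * y n \<omega>)"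
  shows "o_p M y"
proof -
  have "(\<lambda>n. 1 / sqrt (real n)) \<longlonglongrightarrow> 0"
    by (intro tendsto_divide_0[OF tendsto_const] filterlim_at_top_imp_at_infinity
      filterlim_compose[OF sqrt_at_top] filterlim_real_sequentially)
  then have "o_p M (\<lambda>n \<omega>. (1 / sqrt n) * (sqrt n * y n \<omega>))"
    by (intro o_p_mult_O_p assms o_p_sequence)
  then show ?thesis
    by (rule o_p_mono) (rule eventually_sequentiallyI[of 1], auto)
qed

lemma asymp_linear_o_p:
  assumes "asymp_linear M x a \<alpha>"
  shows "o_p M (\<lambda>n \<omega>. x n \<omega> - a)"
  by (rule o_p_of_sqrt_O_p) (rule asymp_linear_O_p[OF assms])

text \<open>Write x y - a b = (x - a)(y - b) + a (y - b) + b (x - a). After scaling by sqrt n, the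
  first product is an \<open>o_p\<close> factor times an \<open>O_p\<close> factor.\<close>

lemma asymp_linear_mult:
  assumes "asymp_linear M x a \<alpha>" "asymp_linear M y b \<beta>"
  shows "asymp_linear M (\<lambda>n \<omega>. x n \<omega> * y n \<omega>) (a * b) (\<lambda>n \<omega>. a * \<beta> n \<omega> + b * \<alpha> n \<omega>)"
proof -
  have "o_p M (\<lambda>n \<omega>. (x n \<omega> - a) * (sqrt n * (y n \<omega> - b))
      + a * (sqrt n * (y n \<omega> - b) - \<beta> n \<omega>) + b * (sqrt n * (x n \<omega> - a) - \<alpha> n \<omega>))"
    by (intro o_p_add o_p_cmult o_p_mult_O_p[OF asymp_linear_o_p[OF assms(1)] asymp_linear_O_p[OF assms(2)]])
      (use assms in \<open>auto simp: asymp_linear_def\<close>)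
  moreover have "O_p M (\<lambda>n \<omega>. a * \<beta> n \<omega> + b * \<alpha> n \<omega>)"
    using assms by (intro O_p_add O_p_cmult) (auto simp: asymp_linear_def)
  ultimately show ?thesis
    unfolding asymp_linear_def by (simp add: algebra_simps)
qed

text \<open>The delta method with the Caratheodory slope \<open>r\<close>: the identity g z - g a =
  r z (z - a) holds for every real \<open>z\<close>, so no Taylor remainder has to be localized, and
  values such as a vanishing sample variance need no separate treatment.\<close>

lemma asymp_linear_deriv:
  assumes "asymp_linear M x a \<alpha>" "DERIV g a :> d"
  shows "asymp_linear M (\<lambda>n \<omega>. g (x n \<omega>)) (g a) (\<lambda>n \<omega>. d * \<alpha> n \<omega>)"
proof -
  obtain r where r: "\<And>z. g z - g a = r z * (z - a)" "isCont r a" "r a = d"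
    using assms(2) unfolding CARAT_DERIV by auto
  have "o_p M (\<lambda>n \<omega>. (r (x n \<omega>) - r a) * (sqrt n * (x n \<omega> - a))
      + d * (sqrt n * (x n \<omega> - a) - \<alpha> n \<omega>))"
    by (intro o_p_add o_p_cmult
          o_p_mult_O_p[OF o_p_isCont[OF asymp_linear_o_p[OF assms(1)] r(2)] asymp_linear_O_p[OF assms(1)]])
      (use assms(1) in \<open>auto simp: asymp_linear_def\<close>)
  moreover have "O_p M (\<lambda>n \<omega>. d * \<alpha> n \<omega>)"
    using assms by (intro O_p_cmult) (auto simp: asymp_linear_def)
  ultimately show ?thesis
    unfolding asymp_linear_def by (simp add: r(1,3) algebra_simps)
qed

section \<open>Weak convergence\<close>

text \<open>Slutsky's lemma. Piecewise linear steps suffice as test functions. They are uniformly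
  continuous with values in [0,1], so a close pair changes the test value by at most e/3, and a
  distant pair changes it by at most 1 on an event of probability at most e/3.\<close>

lemma (in prob_space) weak_conv_m_o_p_diff:
  fixes X Y :: "nat \<Rightarrow> 'a \<Rightarrow> real"
  assumes [measurable]: "\<And>n. X n \<in> borel_measurable M" "\<And>n. Y n \<in> borel_measurable M"
    and L: "real_distribution L"
    and conv: "weak_conv_m (\<lambda>n. distr M borel (X n)) L"
    and diff: "o_p M (\<lambda>n \<omega>. Y n \<omega> - X n \<omega>)"
  shows "weak_conv_m (\<lambda>n. distr M borel (Y n)) L"
proof (rule integral_cts_step_conv_imp_weak_conv)
  fix x y :: real assume xy: "x < y"
  define f where "f = cts_step x y"
  have f01: "0 \<le> f z" "f z \<le> 1" for z
    using xy by (auto simp: f_def cts_step_def field_simps)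
  have uc: "uniformly_continuous_on UNIV f"
    unfolding f_def by (rule cts_step_uniformly_continuous[OF xy])
  then have cont: "isCont f z" for z
    using uniformly_continuous_imp_continuous continuous_on_eq_continuous_at open_UNIV by blast
  then have [measurable]: "f \<in> borel_measurable borel"
    by (intro borel_measurable_continuous_onI) (simp add: continuous_at_imp_continuous_on)
  have "(\<lambda>n. \<integral>z. f z \<partial>distr M borel (X n)) \<longlonglongrightarrow> (\<integral>z. f z \<partial>L)"
    by (rule weak_conv_imp_integral_bdd_continuous_conv[OF _ L conv cont, of 1])
      (auto simp: f01)
  then have convX: "(\<lambda>n. \<integral>\<omega>. f (X n \<omega>) \<partial>M) \<longlonglongrightarrow> (\<integral>z. f z \<partial>L)"
    by (simp add: integral_distr)
  have int: "integrable M (\<lambda>\<omega>. f (g \<omega>))" if "g \<in> borel_measurable M" for g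
    by (rule integrable_const_bound[of _ 1]) (use f01 that in auto)
  have "(\<lambda>n. (\<integral>\<omega>. f (Y n \<omega>) \<partial>M) - (\<integral>\<omega>. f (X n \<omega>) \<partial>M)) \<longlonglongrightarrow> 0"
  proof (rule LIMSEQ_I)
    fix e :: real assume e: "e > 0"
    obtain d where d: "d > 0" "\<And>u v. \<bar>u - v\<bar> < d \<Longrightarrow> \<bar>f u - f v\<bar> < e / 3"
      using uc e unfolding uniformly_continuous_on_def dist_real_def
      by (metis UNIV_I divide_pos_pos zero_less_numeral)
    have "\<forall>\<^sub>F n in sequentially.
        outer_measure_of M {\<omega> \<in> space M. d/2 < \<bar>Y n \<omega> - X n \<omega>\<bar>} \<le> ennreal (e/3)"
      by (rule o_pD[OF diff]) (use d e in auto)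
    then obtain n0 where n0: "\<And>n. n \<ge> n0 \<Longrightarrow>
        outer_measure_of M {\<omega> \<in> space M. d/2 < \<bar>Y n \<omega> - X n \<omega>\<bar>} \<le> ennreal (e/3)"
      unfolding eventually_sequentially by blast
    show "\<exists>no. \<forall>n\<ge>no. norm ((\<integral>\<omega>. f (Y n \<omega>) \<partial>M) - (\<integral>\<omega>. f (X n \<omega>) \<partial>M) - 0) < e"
    proof (intro exI[of _ n0] allI impI)
      fix n assume n: "n \<ge> n0"
      define B where "B = {\<omega> \<in> space M. d/2 < \<bar>Y n \<omega> - X n \<omega>\<bar>}"
      have [measurable]: "B \<in> sets M" unfolding B_def by measurable
      have indI: "integrable M (indicator B :: 'a \<Rightarrow> real)"
        by (rule integrable_real_indicator) (simp_all add: emeasure_eq_measure)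
      have intI: "integrable M (\<lambda>\<omega>. e / 3 + indicator B \<omega> :: real)"
        by (rule Bochner_Integration.integrable_add[OF _ indI]) simp
      have PB: "measure M B \<le> e / 3"
        using n0[OF n] e unfolding B_def[symmetric] by (simp add: emeasure_eq_measure)
      have "\<bar>(\<integral>\<omega>. f (Y n \<omega>) \<partial>M) - (\<integral>\<omega>. f (X n \<omega>) \<partial>M)\<bar> = \<bar>\<integral>\<omega>. f (Y n \<omega>) - f (X n \<omega>) \<partial>M\<bar>"
        by (subst Bochner_Integration.integral_diff) (auto intro!: int)
      also have "\<dots> \<le> (\<integral>\<omega>. \<bar>f (Y n \<omega>) - f (X n \<omega>)\<bar> \<partial>M)"
        by (rule integral_abs_bound)
      also have "\<dots> \<le> (\<integral>\<omega>. e / 3 + indicator B \<omega> \<partial>M)"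
      proof (rule integral_mono)
        show "integrable M (\<lambda>\<omega>. \<bar>f (Y n \<omega>) - f (X n \<omega>)\<bar>)"
          by (intro integrable_abs Bochner_Integration.integrable_diff int) auto
        fix \<omega> assume "\<omega> \<in> space M"
        moreover have "\<bar>f (Y n \<omega>) - f (X n \<omega>)\<bar> \<le> 1"
          using f01[of "Y n \<omega>"] f01[of "X n \<omega>"] by (simp add: abs_le_iff)
        moreover have "\<bar>f (Y n \<omega>) - f (X n \<omega>)\<bar> < e / 3" if "\<bar>Y n \<omega> - X n \<omega>\<bar> \<le> d / 2"
          using that d(1) by (intro d(2)) auto
        ultimately show "\<bar>f (Y n \<omega>) - f (X n \<omega>)\<bar> \<le> e / 3 + indicator B \<omega>"
          using e by (auto simp: B_def indicator_def not_less simp del: le_divide_eq_numeral1) 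
      qed (rule intI)
      also have "\<dots> = e / 3 + measure M B"
        by (subst Bochner_Integration.integral_add[OF _ indI]) (simp_all add: prob_space)
      also have "\<dots> < e" using PB e by simp
      finally show "norm ((\<integral>\<omega>. f (Y n \<omega>) \<partial>M) - (\<integral>\<omega>. f (X n \<omega>) \<partial>M) - 0) < e" by simp
    qed
  qed
  from tendsto_add[OF this convX]
  have "(\<lambda>n. \<integral>\<omega>. f (Y n \<omega>) \<partial>M) \<longlonglongrightarrow> (\<integral>z. f z \<partial>L)" by simp
  then show "(\<lambda>n. integral\<^sup>L (distr M borel (Y n)) (cts_step x y)) \<longlonglongrightarrow> integral\<^sup>L L (cts_step x y)"
    by (simp add: integral_distr f_def[symmetric])
qed (use L in \<open>auto intro!: prob_space.real_distribution_distr\<close>)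

text \<open>For \<open>s > 0\<close> the CDF of the scaled law at \<open>y\<close> is the original
  CDF at \<open>y / s\<close>, so continuity points of the two limits correspond.\<close>

lemma weak_conv_m_scale:
  assumes "s > 0" and conv: "weak_conv_m \<mu> L"
    and sets: "\<And>n. sets (\<mu> n) = sets borel" "sets L = sets borel"
  shows "weak_conv_m (\<lambda>n. distr (\<mu> n) borel (\<lambda>x. s * x)) (distr L borel (\<lambda>x. s * x))"
proof -
  have c: "cdf (distr N borel (\<lambda>x. s * x)) y = cdf N (y / s)" if "sets N = sets borel" for N y
  proof -
    have [measurable]: "(\<lambda>x. s * x) \<in> borel_measurable N"
      using that by (simp cong: measurable_cong_sets)
    have "(\<lambda>x. s * x) -` {..y} \<inter> space N = {..y/s}"
      using \<open>s > 0\<close> sets_eq_imp_space_eq[OF that] by (auto simp: field_simps)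
    then show ?thesis
      by (simp add: cdf_def measure_distr)
  qed
  show ?thesis
    unfolding weak_conv_m_def weak_conv_def
  proof safe
    fix y assume "isCont (cdf (distr L borel ((*) s))) y"
    moreover have "cdf (distr L borel ((*) s)) = (\<lambda>x. cdf L (x / s))"
      using c[OF sets(2)] by (rule ext)
    ultimately have "isCont (\<lambda>x. cdf L (x / s)) y" by (simp only:)
    moreover have "s * (y / s) = y" using \<open>s > 0\<close> by simp
    ultimately have "isCont (\<lambda>x. cdf L (x / s)) (s * (y / s))" by (simp only:)
    then have "isCont (\<lambda>z. cdf L (s * z / s)) (y / s)"
      by (rule isCont_o2[where f = "\<lambda>z. s * z", rotated]) (intro continuous_intros)
    moreover have "(\<lambda>z. cdf L (s * z / s)) = cdf L" using \<open>s > 0\<close> by (intro ext) simp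
    ultimately have "isCont (cdf L) (y / s)" by (simp only:)
    then show "(\<lambda>n. cdf (distr (\<mu> n) borel ((*) s)) y) \<longlonglongrightarrow> cdf (distr L borel ((*) s)) y"
      using conv unfolding weak_conv_m_def weak_conv_def c[OF sets(1)] c[OF sets(2)] by blast
  qed
qed

lemma distr_std_normal_scale:
  assumes "s > 0"
  shows "distr std_normal_distribution borel (\<lambda>x. s * x) = density lborel (normal_density 0 s)"
proof -
  interpret prob_space std_normal_distribution by (rule prob_space_normal_density) simp
  have "distributed std_normal_distribution lborel (\<lambda>x. x) std_normal_density"
    unfolding distributed_def by (auto simp: distr_id2)
  then have "distributed std_normal_distribution lborel (\<lambda>x. 0 + s * x) (normal_density (0 + s * 0) (\<bar>s\<bar> * 1))"
    using assms by (intro normal_density_affine) auto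
  then show ?thesis
    using assms by (simp add: distributed_def cong: distr_cong)
qed

lemma real_distribution_normal_law:
  assumes "v \<ge> 0"
  shows "real_distribution (normal_law v)"
proof (cases "v = 0")
  case True
  then show ?thesis
    by (auto simp: normal_law_def real_distribution_def real_distribution_axioms_def intro!: prob_space_return)
next
  case False
  with assms show ?thesis
    by (auto simp: normal_law_def real_distribution_def real_distribution_axioms_def
        intro!: prob_space_normal_density)
qed

lemma (in prob_space) clt_centered_iid:
  fixes Z :: "nat \<Rightarrow> 'a \<Rightarrow> 'z::topological_space" and \<psi> :: "'z \<Rightarrow> real"
  assumes law: "\<And>i. distr M borel (Z i) = P"
    and indep: "indep_vars (\<lambda>_. borel) Z UNIV"
    and \<psi>: "\<psi> \<in> borel_measurable P" "integrable P (\<lambda>z. (\<psi> z)\<^sup>2)" "(\<integral>z. \<psi> z \<partial>P) = 0"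
  shows "weak_conv_m (\<lambda>n. distr M borel (\<lambda>\<omega>. (1 / sqrt n) * (\<Sum>i<n. \<psi> (Z i \<omega>))))
    (normal_law (var P \<psi>))"
proof -
  have Z[measurable]: "Z i \<in> borel_measurable M" for i
    using indep by (auto simp: indep_vars_def)
  have setsP: "sets P = sets borel" using law[of 0] by auto
  have \<psi>b[measurable]: "\<psi> \<in> borel_measurable borel"
    using \<psi>(1) by (simp add: measurable_cong_sets[OF setsP refl])
  have var: "var P \<psi> = (\<integral>z. (\<psi> z)\<^sup>2 \<partial>P)"
    by (simp add: cov_def \<psi>(3) power2_eq_square)
  have L2: "(\<integral>\<omega>. g (\<psi> (Z i \<omega>)) \<partial>M) = (\<integral>z. g (\<psi> z) \<partial>P)" if [measurable]: "g \<in> borel_measurable borel"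
    for g :: "real \<Rightarrow> real" and i
    unfolding law[of i, symmetric] by (subst integral_distr) auto
  show ?thesis
  proof (cases "var P \<psi> = 0")
    case True
    \<comment> \<open>With variance zero the centred \<open>\<psi>\<close> vanishes almost
      everywhere, so every normalized sum has the law of the constant 0.\<close>
    then have "AE z in P. (\<psi> z)\<^sup>2 = 0"
      unfolding var using \<psi>(2) by (subst (asm) integral_nonneg_eq_0_iff_AE) auto
    then have "AE z in P. \<psi> z = 0" by simp
    then have "AE z in distr M borel (Z i). \<psi> z = 0" for i
      unfolding law .
    then have "AE \<omega> in M. \<psi> (Z i \<omega>) = 0" for i
      using AE_distrD[OF Z] by blast
    then have ae: "AE \<omega> in M. \<forall>i. \<psi> (Z i \<omega>) = 0"
      by (simp add: AE_all_countable)
    have "distr M borel (\<lambda>\<omega>. (1 / sqrt n) * (\<Sum>i<n. \<psi> (Z i \<omega>))) = distr M borel (\<lambda>\<omega>. 0)" for n :: nat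
      by (rule distr_cong_AE) (use ae in auto)
    also have "\<dots> = return borel 0"
      by (simp add: distr_const)
    finally show ?thesis
      by (simp add: True normal_law_def weak_conv_m_def weak_conv_def)
  next
    case False
    define s where "s = sqrt (var P \<psi>)"
    have v0: "var P \<psi> \<ge> 0" by (simp add: var)
    with False have s: "s > 0" "s\<^sup>2 = var P \<psi>" by (auto simp: s_def)
    have "weak_conv_m (\<lambda>n. distr M borel (\<lambda>\<omega>. (\<Sum>i<n. \<psi> (Z i \<omega>)) / sqrt (n * s\<^sup>2))) std_normal_distribution"
    proof (rule central_limit_theorem_zero_mean)
      show "indep_vars (\<lambda>i. borel) (\<lambda>i \<omega>. \<psi> (Z i \<omega>)) UNIV"
        by (rule indep_vars_compose2[OF indep]) simp
      show m0: "expectation (\<lambda>\<omega>. \<psi> (Z n \<omega>)) = 0" for n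
        using L2[of "\<lambda>x. x"] \<psi>(3) by simp
      show "s > 0" by fact
      show "integrable M (\<lambda>\<omega>. (\<psi> (Z n \<omega>))\<^sup>2)" for n
        using \<psi>(2) unfolding law[of n, symmetric] by (subst (asm) integrable_distr_eq) auto
      show "variance (\<lambda>\<omega>. \<psi> (Z n \<omega>)) = s\<^sup>2" for n
        using L2[of "\<lambda>x. x\<^sup>2"] by (simp add: m0 s var)
      show "distr M borel (\<lambda>\<omega>. \<psi> (Z n \<omega>)) = distr P borel \<psi>" for n
        unfolding law[of n, symmetric] by (subst distr_distr) (auto simp: comp_def)
    qed
    \<comment> \<open>The limit theorem normalizes to unit variance; multiplying by \<open>s\<close>
      restores the influence sum and turns the standard normal limit into
      \<open>normal_law\<close>.\<close>
    then have "weak_conv_m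
        (\<lambda>n. distr (distr M borel (\<lambda>\<omega>. (\<Sum>i<n. \<psi> (Z i \<omega>)) / sqrt (n * s\<^sup>2))) borel (\<lambda>x. s * x))
        (distr std_normal_distribution borel (\<lambda>x. s * x))"
      by (intro weak_conv_m_scale s) auto
    moreover have "distr (distr M borel (\<lambda>\<omega>. (\<Sum>i<n. \<psi> (Z i \<omega>)) / sqrt (n * s\<^sup>2))) borel (\<lambda>x. s * x)
        = distr M borel (\<lambda>\<omega>. (1 / sqrt n) * (\<Sum>i<n. \<psi> (Z i \<omega>)))" for n :: nat
      using s(1) by (subst distr_distr) (auto simp: comp_def real_sqrt_mult intro!: distr_cong)
    moreover have "distr std_normal_distribution borel (\<lambda>x. s * x) = normal_law (var P \<psi>)"
      unfolding distr_std_normal_scale[OF s(1)] using False by (simp add: normal_law_def s_def)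
    ultimately show ?thesis by (simp only:)
  qed
qed

lemma (in prob_space) asymp_normalI:
  fixes Z :: "nat \<Rightarrow> 'a \<Rightarrow> 'z::topological_space" and \<psi> :: "'z \<Rightarrow> real"
  assumes law: "\<And>i. distr M borel (Z i) = P"
    and indep: "indep_vars (\<lambda>_. borel) Z UNIV"
    and \<psi>: "\<psi> \<in> borel_measurable P" "integrable P (\<lambda>z. (\<psi> z)\<^sup>2)" "(\<integral>z. \<psi> z \<partial>P) = 0"
    and T[measurable]: "\<And>n. T n \<in> borel_measurable M"
    and lin: "asymp_linear M T \<rho> (\<lambda>n \<omega>. (1 / sqrt n) * (\<Sum>i<n. \<psi> (Z i \<omega>)))"
  shows "asymp_normal_with_influence M P Z T \<rho> \<psi>"
proof -
  have Z[measurable]: "Z i \<in> borel_measurable M" for i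
    using indep by (auto simp: indep_vars_def)
  have setsP: "sets P = sets borel" using law[of 0] by auto
  have [measurable]: "\<psi> \<in> borel_measurable borel"
    using \<psi>(1) by (simp add: measurable_cong_sets[OF setsP refl])
  have "var P \<psi> \<ge> 0"
    unfolding cov_def by (rule Bochner_Integration.integral_nonneg) simp
  moreover have "o_p M (\<lambda>n \<omega>. sqrt n * (T n \<omega> - \<rho>) - (1 / sqrt n) * (\<Sum>i<n. \<psi> (Z i \<omega>)))"
    using lin unfolding asymp_linear_def by blast
  ultimately have "weak_conv_m (\<lambda>n. distr M borel (\<lambda>\<omega>. sqrt n * (T n \<omega> - \<rho>))) (normal_law (var P \<psi>))"
    by (intro weak_conv_m_o_p_diff[OF _ _ real_distribution_normal_law clt_centered_iid[OF law indep \<psi>]])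
      measurable
  then show ?thesis
    unfolding asymp_normal_with_influence_def
    using \<psi>(1,2) lin[unfolded asymp_linear_def o_p_def] by (intro conjI) simp_all
qed

section \<open>Second moments of sums over an i.i.d. sample\<close>

text \<open>Independent centred terms are orthogonal, so only the diagonal of the squared sum
  survives. Nonnegative integrals admit an infinite second moment.\<close>

lemma nn_integral_square_sum_PiM:
  fixes f :: "'z \<Rightarrow> real"
  assumes P: "prob_space P" and J: "finite J" and f: "integrable P f" "(\<integral>z. f z \<partial>P) = 0"
  shows "(\<integral>\<^sup>+w. ennreal ((\<Sum>j\<in>J. f (w j))\<^sup>2) \<partial>PiM J (\<lambda>_. P)) \<le> of_nat (card J) * (\<integral>\<^sup>+z. ennreal ((f z)\<^sup>2) \<partial>P)"
proof (cases "(\<integral>\<^sup>+z. ennreal ((f z)\<^sup>2) \<partial>P) = \<infinity>")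
  case True
  \<comment> \<open>For nonempty \<open>J\<close> the right-hand side is infinite; for empty
    \<open>J\<close> the sum is 0.\<close>
  then show ?thesis
    by (cases "J = {}") (use J in \<open>simp_all add: PiM_empty ennreal_mult_top ennreal_top_mult\<close>)
next
  case False
  interpret P: prob_space P by fact
  interpret product_sigma_finite "\<lambda>_. P" by standard
  have [measurable]: "f \<in> borel_measurable P" using f by auto
  have f2: "integrable P (\<lambda>z. (f z)\<^sup>2)"
    using False by (intro integrableI_nonneg) (auto simp: less_top[symmetric])
  \<comment> \<open>One more independent term: the cross term \<open>2 * s * f y\<close> integrates
    to 0.\<close>
  have step: "(\<integral>\<^sup>+y. ennreal ((f y + s)\<^sup>2) \<partial>P) = (\<integral>\<^sup>+z. ennreal ((f z)\<^sup>2) \<partial>P) + ennreal (s\<^sup>2)" for s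
  proof -
    have int: "integrable P (\<lambda>y. (f y)\<^sup>2 + (2 * s) * f y + s\<^sup>2)"
      using f2 f(1) by (intro Bochner_Integration.integrable_add integrable_mult_right P.integrable_const) auto
    have "(\<integral>\<^sup>+y. ennreal ((f y + s)\<^sup>2) \<partial>P) = (\<integral>\<^sup>+y. ennreal ((f y)\<^sup>2 + (2 * s) * f y + s\<^sup>2) \<partial>P)"
      by (intro nn_integral_cong) (simp add: power2_sum algebra_simps)
    also have "\<dots> = ennreal (\<integral>y. (f y)\<^sup>2 + (2 * s) * f y + s\<^sup>2 \<partial>P)"
    proof (rule nn_integral_eq_integral[OF int])
      have "(f y)\<^sup>2 + (2 * s) * f y + s\<^sup>2 = (f y + s)\<^sup>2" for y by (simp add: power2_sum algebra_simps)
      then show "AE y in P. 0 \<le> (f y)\<^sup>2 + (2 * s) * f y + s\<^sup>2" by simp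
    qed
    also have "(\<integral>y. (f y)\<^sup>2 + (2 * s) * f y + s\<^sup>2 \<partial>P) = (\<integral>y. (f y)\<^sup>2 \<partial>P) + s\<^sup>2"
      using f2 f by (simp add: P.prob_space)
    also have "ennreal \<dots> = (\<integral>\<^sup>+z. ennreal ((f z)\<^sup>2) \<partial>P) + ennreal (s\<^sup>2)"
      using f2 by (simp add: nn_integral_eq_integral ennreal_plus)
    finally show ?thesis .
  qed
  from J show ?thesis
  proof (induction J rule: finite_induct)
    case empty
    then show ?case by (simp add: PiM_empty)
  next
    case (insert i J)
    interpret PJ: prob_space "PiM J (\<lambda>_. P)" by (intro prob_space_PiM P.prob_space_axioms)
    have "(\<integral>\<^sup>+w. ennreal ((\<Sum>j\<in>insert i J. f (w j))\<^sup>2) \<partial>PiM (insert i J) (\<lambda>_. P))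
        = (\<integral>\<^sup>+x. (\<integral>\<^sup>+y. ennreal ((\<Sum>j\<in>insert i J. f ((x(i := y)) j))\<^sup>2) \<partial>P) \<partial>PiM J (\<lambda>_. P))"
      using insert(1,2) by (intro product_nn_integral_insert) measurable
    also have "\<dots> = (\<integral>\<^sup>+x. (\<integral>\<^sup>+y. ennreal ((f y + (\<Sum>j\<in>J. f (x j)))\<^sup>2) \<partial>P) \<partial>PiM J (\<lambda>_. P))"
    proof (intro nn_integral_cong arg_cong[where f=ennreal] arg_cong[where f="\<lambda>x. x\<^sup>2"])
      fix x y
      have "(\<Sum>j\<in>J. f ((x(i := y)) j)) = (\<Sum>j\<in>J. f (x j))"
        using insert(2) by (intro sum.cong) auto
      then show "(\<Sum>j\<in>insert i J. f ((x(i := y)) j)) = f y + (\<Sum>j\<in>J. f (x j))"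
        using insert(1,2) by simp
    qed
    also have "\<dots> = (\<integral>\<^sup>+z. ennreal ((f z)\<^sup>2) \<partial>P)
        + (\<integral>\<^sup>+x. ennreal ((\<Sum>j\<in>J. f (x j))\<^sup>2) \<partial>PiM J (\<lambda>_. P))"
      unfolding step by (subst nn_integral_add) (auto simp: PJ.emeasure_space_1)
    also have "\<dots> \<le> (\<integral>\<^sup>+z. ennreal ((f z)\<^sup>2) \<partial>P) + of_nat (card J) * (\<integral>\<^sup>+z. ennreal ((f z)\<^sup>2) \<partial>P)"
      by (intro add_left_mono insert)
    also have "\<dots> = of_nat (card (insert i J)) * (\<integral>\<^sup>+z. ennreal ((f z)\<^sup>2) \<partial>P)"
      using insert(1,2) by (simp add: distrib_right)
    finally show ?case .
  qed
qed

locale iid_sample = prob_space M for M :: "'a measure" +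
  fixes P :: "'z::topological_space measure" and Z :: "nat \<Rightarrow> 'a \<Rightarrow> 'z"
  assumes law: "\<And>i. distr M borel (Z i) = P"
    and indep: "indep_vars (\<lambda>_. borel) Z UNIV"
begin

lemma measurable_Z[measurable]: "Z i \<in> measurable M borel"
  using indep by (auto simp: indep_vars_def)

lemma sets_P[measurable_cong]: "sets P = sets borel"
  using law[of 0] by auto

lemma prob_space_P: "prob_space P"
  using law[of 0] prob_space_distr[OF measurable_Z[of 0]] by simp

sublocale P: prob_space P by (rule prob_space_P)

lemma space_P: "space P = UNIV"
  using sets_eq_imp_space_eq[OF sets_P] by simp

lemma measurable_P_iff: "f \<in> measurable P N \<longleftrightarrow> f \<in> measurable borel N"
  by (simp add: measurable_cong_sets[OF sets_P refl])

lemma AE_Z: "AE z in P. Q z \<Longrightarrow> AE \<omega> in M. Q (Z i \<omega>)"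
  using AE_distrD[OF measurable_Z[of i], of Q] unfolding law[of i] by simp

lemma distr_restrict:
  assumes "finite J"
  shows "distr M (PiM J (\<lambda>_. borel)) (\<lambda>\<omega>. \<lambda>i\<in>J. Z i \<omega>) = PiM J (\<lambda>_. P)"
\<comment> \<open>The characterization of independence by a product law is used for a nonempty index
  set; the empty product is a point mass.\<close>
proof (cases "J = {}")
  case True
  have "distr M (PiM {} (\<lambda>_. borel :: 'z measure)) (\<lambda>\<omega>. \<lambda>i\<in>{}. Z i \<omega>) = distr M (PiM {} (\<lambda>_. P)) (\<lambda>\<omega>. (\<lambda>i. undefined))"
    by (intro distr_cong) (auto simp: PiM_empty restrict_def)
  also have "\<dots> = return (PiM {} (\<lambda>_. P)) (\<lambda>i. undefined)"
    by (rule distr_const) (simp add: space_PiM)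
  also have "\<dots> = PiM {} (\<lambda>_. P)"
    by (rule measure_eqI) (auto simp: PiM_empty subset_singleton_iff)
  finally show ?thesis using True by simp
next
  case False
  have "indep_vars (\<lambda>_. borel) Z J"
    by (rule indep_vars_subset[OF indep]) simp
  then show ?thesis
    using False by (subst (asm) indep_vars_iff_distr_eq_PiM'[OF False]) (auto simp: law)
qed

lemma nn_integral_restrict:
  assumes "finite J" and [measurable]: "g \<in> borel_measurable (PiM J (\<lambda>_. P))"
  shows "(\<integral>\<^sup>+\<omega>. g (\<lambda>j\<in>J. Z j \<omega>) \<partial>M) = (\<integral>\<^sup>+w. g w \<partial>PiM J (\<lambda>_. P))"
  unfolding distr_restrict[OF assms(1), symmetric]
  by (subst nn_integral_distr) (auto cong: measurable_cong_sets)

text \<open>Disjoint blocks of the sample are independent, so the joint law of two blocks is the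
  product of their laws and Tonelli applies.\<close>

lemma nn_integral_restrict2:
  assumes fin: "finite I" "finite J" "I \<inter> J = {}"
    and g[measurable]: "(\<lambda>(x, w). g x w) \<in> borel_measurable (PiM I (\<lambda>_. P) \<Otimes>\<^sub>M PiM J (\<lambda>_. P))"
  shows "(\<integral>\<^sup>+\<omega>. g (\<lambda>i\<in>I. Z i \<omega>) (\<lambda>j\<in>J. Z j \<omega>) \<partial>M)
    = (\<integral>\<^sup>+w. \<integral>\<^sup>+x. g x w \<partial>PiM I (\<lambda>_. P) \<partial>PiM J (\<lambda>_. P))"
proof -
  interpret PI: prob_space "PiM I (\<lambda>_. P)" by (intro prob_space_PiM prob_space_P)
  interpret PJ: prob_space "PiM J (\<lambda>_. P)" by (intro prob_space_PiM prob_space_P)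
  interpret pair_sigma_finite "PiM I (\<lambda>_. P)" "PiM J (\<lambda>_. P)" by standard
  have sI: "sets (PiM I (\<lambda>_. borel)) = sets (PiM I (\<lambda>_. P))" for I :: "nat set"
    by (intro sets_PiM_cong) (auto simp: sets_P)
  have iv: "indep_var (PiM I (\<lambda>_. borel)) (\<lambda>\<omega>. \<lambda>i\<in>I. Z i \<omega>) (PiM J (\<lambda>_. borel)) (\<lambda>\<omega>. \<lambda>i\<in>J. Z i \<omega>)"
    using fin by (intro indep_var_restrict[OF indep]) auto
  have d: "distr M (PiM I (\<lambda>_. borel) \<Otimes>\<^sub>M PiM J (\<lambda>_. borel)) (\<lambda>\<omega>. (\<lambda>i\<in>I. Z i \<omega>, \<lambda>i\<in>J. Z i \<omega>))
      = PiM I (\<lambda>_. P) \<Otimes>\<^sub>M PiM J (\<lambda>_. P)"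
    using iv unfolding indep_var_distribution_eq distr_restrict[OF fin(1)] distr_restrict[OF fin(2)] by simp
  have "(\<integral>\<^sup>+\<omega>. g (\<lambda>i\<in>I. Z i \<omega>) (\<lambda>j\<in>J. Z j \<omega>) \<partial>M)
      = (\<integral>\<^sup>+p. (\<lambda>(x, w). g x w) p \<partial>(PiM I (\<lambda>_. P) \<Otimes>\<^sub>M PiM J (\<lambda>_. P)))"
    unfolding d[symmetric]
    by (subst nn_integral_distr) (use g in \<open>auto simp: measurable_cong_sets[OF sets_pair_measure_cong[OF sI sI] refl]\<close>)
  also have "\<dots> = (\<integral>\<^sup>+w. \<integral>\<^sup>+x. g x w \<partial>PiM I (\<lambda>_. P) \<partial>PiM J (\<lambda>_. P))"
    by (subst nn_integral_snd[symmetric]) auto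
  finally show ?thesis .
qed

lemma square_sum_Z:
  assumes J: "finite J" and f: "integrable P f" "(\<integral>z. f z \<partial>P) = 0"
  shows "(\<integral>\<^sup>+\<omega>. ennreal ((\<Sum>j\<in>J. f (Z j \<omega>))\<^sup>2) \<partial>M) \<le> of_nat (card J) * (\<integral>\<^sup>+z. ennreal ((f z)\<^sup>2) \<partial>P)"
proof -
  have [measurable]: "f \<in> borel_measurable P" using f by auto
  have "(\<integral>\<^sup>+\<omega>. ennreal ((\<Sum>j\<in>J. f (Z j \<omega>))\<^sup>2) \<partial>M) = (\<integral>\<^sup>+\<omega>. ennreal ((\<Sum>j\<in>J. f ((\<lambda>j\<in>J. Z j \<omega>) j))\<^sup>2) \<partial>M)"
    by (intro nn_integral_cong) simp
  also have "\<dots> = (\<integral>\<^sup>+w. ennreal ((\<Sum>j\<in>J. f (w j))\<^sup>2) \<partial>PiM J (\<lambda>_. P))"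
    using J by (intro nn_integral_restrict) measurable
  also have "\<dots> \<le> of_nat (card J) * (\<integral>\<^sup>+z. ennreal ((f z)\<^sup>2) \<partial>P)"
    by (rule nn_integral_square_sum_PiM[OF prob_space_P J f])
  finally show ?thesis .
qed

lemma square_sum_PiM_pair:
  assumes J: "finite J" and [measurable]: "(\<lambda>(z, w). f z w) \<in> borel_measurable (P \<Otimes>\<^sub>M P)"
    and f1: "AE z in P. integrable P (f z) \<and> (\<integral>w. f z w \<partial>P) = 0"
  shows "(\<integral>\<^sup>+w. \<integral>\<^sup>+z. ennreal ((\<Sum>j\<in>J. f z (w j))\<^sup>2) \<partial>P \<partial>PiM J (\<lambda>_. P))
    \<le> of_nat (card J) * (\<integral>\<^sup>+z. \<integral>\<^sup>+w. ennreal ((f z w)\<^sup>2) \<partial>P \<partial>P)"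
proof -
  interpret PJ: prob_space "PiM J (\<lambda>_. P)" by (intro prob_space_PiM prob_space_P)
  interpret pair_sigma_finite P "PiM J (\<lambda>_. P)" by standard
  have "(\<integral>\<^sup>+w. \<integral>\<^sup>+z. ennreal ((\<Sum>j\<in>J. f z (w j))\<^sup>2) \<partial>P \<partial>PiM J (\<lambda>_. P))
      = (\<integral>\<^sup>+z. \<integral>\<^sup>+w. ennreal ((\<Sum>j\<in>J. f z (w j))\<^sup>2) \<partial>PiM J (\<lambda>_. P) \<partial>P)"
    using J by (intro Fubini') measurable
  also have "\<dots> \<le> (\<integral>\<^sup>+z. of_nat (card J) * (\<integral>\<^sup>+w. ennreal ((f z w)\<^sup>2) \<partial>P) \<partial>P)"
    using f1 by (intro nn_integral_mono_AE) (auto intro: nn_integral_square_sum_PiM[OF prob_space_P J])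
  also have "\<dots> = of_nat (card J) * (\<integral>\<^sup>+z. \<integral>\<^sup>+w. ennreal ((f z w)\<^sup>2) \<partial>P \<partial>P)"
    by (intro nn_integral_cmult) measurable
  finally show ?thesis .
qed

text \<open>Meant for one observation \<open>i\<close> and the training set \<open>J\<close> of its
  fold. Given \<open>Z i\<close>, the summands are independent and centred, which is where
  \<open>i \<notin> J\<close> enters.\<close>

lemma square_sum_pair:
  assumes J: "finite J" "i \<notin> J" and [measurable]: "(\<lambda>(z, w). f z w) \<in> borel_measurable (P \<Otimes>\<^sub>M P)"
    and f1: "AE z in P. integrable P (f z) \<and> (\<integral>w. f z w \<partial>P) = 0"
  shows "(\<integral>\<^sup>+\<omega>. ennreal ((\<Sum>j\<in>J. f (Z i \<omega>) (Z j \<omega>))\<^sup>2) \<partial>M)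
    \<le> of_nat (card J) * (\<integral>\<^sup>+z. \<integral>\<^sup>+w. ennreal ((f z w)\<^sup>2) \<partial>P \<partial>P)"
proof -
  interpret product_sigma_finite "\<lambda>_. P" by standard
  have "(\<integral>\<^sup>+\<omega>. ennreal ((\<Sum>j\<in>J. f (Z i \<omega>) (Z j \<omega>))\<^sup>2) \<partial>M)
      = (\<integral>\<^sup>+\<omega>. ennreal ((\<Sum>j\<in>J. f ((\<lambda>i\<in>{i}. Z i \<omega>) i) ((\<lambda>j\<in>J. Z j \<omega>) j))\<^sup>2) \<partial>M)"
    by (intro nn_integral_cong) simp
  also have "\<dots> = (\<integral>\<^sup>+w. \<integral>\<^sup>+x. ennreal ((\<Sum>j\<in>J. f (x i) (w j))\<^sup>2) \<partial>PiM {i} (\<lambda>_. P) \<partial>PiM J (\<lambda>_. P))"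
    using J by (intro nn_integral_restrict2) measurable
  also have "\<dots> = (\<integral>\<^sup>+w. \<integral>\<^sup>+z. ennreal ((\<Sum>j\<in>J. f z (w j))\<^sup>2) \<partial>P \<partial>PiM J (\<lambda>_. P))"
  proof (intro nn_integral_cong product_nn_integral_singleton)
    fix w :: "nat \<Rightarrow> 'z"
    have [simp]: "w j \<in> space P" for j by (simp add: space_P)
    show "(\<lambda>z. ennreal ((\<Sum>j\<in>J. f z (w j))\<^sup>2)) \<in> borel_measurable P" by measurable
  qed
  also have "\<dots> \<le> of_nat (card J) * (\<integral>\<^sup>+z. \<integral>\<^sup>+w. ennreal ((f z w)\<^sup>2) \<partial>P \<partial>P)"
    by (rule square_sum_PiM_pair[OF J(1) _ f1]) measurable
  finally show ?thesis .
qed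

text \<open>Orthogonality is used twice: for fixed data on \<open>J\<close>, \<open>f2\<close>
  centres the terms indexed by \<open>I\<close> and yields the factor \<open>card I\<close>; for
  fixed \<open>z\<close>, \<open>f1\<close> yields the factor \<open>card J\<close>. A kernel
  centred in one argument only would in general give a cubic order for blocks of comparable
  size.\<close>

lemma square_double_sum:
  assumes fin: "finite I" "finite J" "I \<inter> J = {}"
    and [measurable]: "(\<lambda>(z, w). f z w) \<in> borel_measurable (P \<Otimes>\<^sub>M P)"
    and f1: "AE z in P. integrable P (f z) \<and> (\<integral>w. f z w \<partial>P) = 0"
    and f2: "AE w in P. integrable P (\<lambda>z. f z w) \<and> (\<integral>z. f z w \<partial>P) = 0"
  shows "(\<integral>\<^sup>+\<omega>. ennreal ((\<Sum>i\<in>I. \<Sum>j\<in>J. f (Z i \<omega>) (Z j \<omega>))\<^sup>2) \<partial>M)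
    \<le> of_nat (card I) * of_nat (card J) * (\<integral>\<^sup>+z. \<integral>\<^sup>+w. ennreal ((f z w)\<^sup>2) \<partial>P \<partial>P)"
proof -
  interpret PJ: prob_space "PiM J (\<lambda>_. P)" by (intro prob_space_PiM prob_space_P)
  have "AE w in PiM J (\<lambda>_. P). \<forall>j\<in>J. integrable P (\<lambda>z. f z (w j)) \<and> (\<integral>z. f z (w j) \<partial>P) = 0"
    using fin(2) by (intro AE_finite_allI AE_PiM_component[where P = "\<lambda>w. integrable P (\<lambda>z. f z w) \<and> (\<integral>z. f z w \<partial>P) = 0"])
      (auto intro: prob_space_P f2 simp del: AE_conj_iff)
  then have ae: "AE w in PiM J (\<lambda>_. P). integrable P (\<lambda>z. \<Sum>j\<in>J. f z (w j)) \<and> (\<integral>z. (\<Sum>j\<in>J. f z (w j)) \<partial>P) = 0"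
    by eventually_elim auto
  have "(\<integral>\<^sup>+\<omega>. ennreal ((\<Sum>i\<in>I. \<Sum>j\<in>J. f (Z i \<omega>) (Z j \<omega>))\<^sup>2) \<partial>M)
      = (\<integral>\<^sup>+\<omega>. ennreal ((\<Sum>i\<in>I. \<Sum>j\<in>J. f ((\<lambda>i\<in>I. Z i \<omega>) i) ((\<lambda>j\<in>J. Z j \<omega>) j))\<^sup>2) \<partial>M)"
    by (intro nn_integral_cong) simp
  also have "\<dots> = (\<integral>\<^sup>+w. \<integral>\<^sup>+x. ennreal ((\<Sum>i\<in>I. \<Sum>j\<in>J. f (x i) (w j))\<^sup>2) \<partial>PiM I (\<lambda>_. P) \<partial>PiM J (\<lambda>_. P))"
    using fin by (intro nn_integral_restrict2) measurable
  also have "\<dots> \<le> (\<integral>\<^sup>+w. of_nat (card I) * (\<integral>\<^sup>+z. ennreal ((\<Sum>j\<in>J. f z (w j))\<^sup>2) \<partial>P) \<partial>PiM J (\<lambda>_. P))"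
    using ae by (intro nn_integral_mono_AE) (auto intro: nn_integral_square_sum_PiM[OF prob_space_P fin(1)])
  also have "\<dots> = of_nat (card I) * (\<integral>\<^sup>+w. \<integral>\<^sup>+z. ennreal ((\<Sum>j\<in>J. f z (w j))\<^sup>2) \<partial>P \<partial>PiM J (\<lambda>_. P))"
    by (intro nn_integral_cmult) measurable
  also have "\<dots> \<le> of_nat (card I) * (of_nat (card J) * (\<integral>\<^sup>+z. \<integral>\<^sup>+w. ennreal ((f z w)\<^sup>2) \<partial>P \<partial>P))"
    by (intro mult_left_mono square_sum_PiM_pair[OF fin(2) _ f1]) simp_all
  finally show ?thesis by (simp add: mult.assoc)
qed

end

section \<open>Random folds\<close>

text \<open>Here and in \<open>train_of\<close> the assignment \<open>c\<close> is an argument, so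
  that it can be frozen while the data stay random.\<close>

definition fold_of :: "nat \<Rightarrow> nat \<Rightarrow> (nat \<Rightarrow> nat) \<Rightarrow> nat set" where
  "fold_of n k c = {i. i < n \<and> c i = k}"

definition train_of :: "nat \<Rightarrow> nat \<Rightarrow> (nat \<Rightarrow> nat) \<Rightarrow> nat set" where
  "train_of n k c = {i. i < n \<and> c i \<noteq> k}"

lemma fold_set_eq: "fold_set \<kappa> n k \<omega> = fold_of n k (\<lambda>i. \<kappa> n i \<omega>)"
  by (simp add: fold_set_def fold_of_def)

lemma train_set_eq: "train_set \<kappa> n k \<omega> = train_of n k (\<lambda>i. \<kappa> n i \<omega>)"
  by (auto simp: train_set_def fold_set_def train_of_def)

lemma finite_fold_of [simp]: "finite (fold_of n k c)" and finite_train_of [simp]: "finite (train_of n k c)"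
  by (simp_all add: fold_of_def train_of_def)

lemma fold_of_restrict [simp]: "fold_of n k (restrict c {..<n}) = fold_of n k c"
  and train_of_restrict [simp]: "train_of n k (restrict c {..<n}) = train_of n k c"
  by (auto simp: fold_of_def train_of_def)

lemma fold_of_Int_train_of: "fold_of n k c \<inter> train_of n k c = {}"
  by (auto simp: fold_of_def train_of_def)

lemma fold_of_subset: "fold_of n k c \<subseteq> {..<n}"
  by (auto simp: fold_of_def)

lemma card_fold_of_le: "card (fold_of n k c) \<le> n"
  using card_mono[OF _ fold_of_subset[of n k c]] by simp

lemma sum_fold_of:
  fixes h :: "nat \<Rightarrow> nat \<Rightarrow> real"
  assumes "\<And>i. i < n \<Longrightarrow> c i < K"
  shows "(\<Sum>i<n. h (c i) i) = (\<Sum>k<K. \<Sum>i\<in>fold_of n k c. h k i)"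
proof -
  have "(\<Sum>k<K. \<Sum>i\<in>fold_of n k c. h k i) = (\<Sum>k<K. \<Sum>i\<in>{i. i \<in> {..<n} \<and> c i = k}. h (c i) i)"
    by (intro sum.cong) (auto simp: fold_of_def)
  also have "\<dots> = (\<Sum>i<n. h (c i) i)"
    by (intro sum.group) (use assms in auto)
  finally show ?thesis by simp
qed

lemma sum_train_of:
  fixes h :: "nat \<Rightarrow> real"
  assumes "\<And>i. i < n \<Longrightarrow> c i < K" "K \<ge> 1"
  shows "(\<Sum>k<K. \<Sum>i\<in>train_of n k c. h i) = (real K - 1) * (\<Sum>i<n. h i)"
proof -
  have "(\<Sum>i\<in>train_of n k c. h i) = (\<Sum>i<n. h i) - (\<Sum>i\<in>fold_of n k c. h i)" for k
  proof -
    have "{..<n} = train_of n k c \<union> fold_of n k c" by (auto simp: train_of_def fold_of_def)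
    then have "(\<Sum>i<n. h i) = (\<Sum>i\<in>train_of n k c. h i) + (\<Sum>i\<in>fold_of n k c. h i)"
      using fold_of_Int_train_of[of n k c] by (simp add: sum.union_disjoint Int_commute)
    then show ?thesis by simp
  qed
  then have "(\<Sum>k<K. \<Sum>i\<in>train_of n k c. h i) = real K * (\<Sum>i<n. h i) - (\<Sum>k<K. \<Sum>i\<in>fold_of n k c. h i)"
    by (simp add: sum_subtractf)
  also have "(\<Sum>k<K. \<Sum>i\<in>fold_of n k c. h i) = (\<Sum>i<n. h i)"
    using sum_fold_of[of n c K "\<lambda>_. h"] assms(1) by simp
  finally show ?thesis by (simp add: algebra_simps)
qed

text \<open>Along almost every path the indicator of a large deviation is eventually 0; dominated
  convergence turns this into vanishing probability.\<close>

lemma (in prob_space) o_p_of_AE_tendsto: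
  fixes X :: "nat \<Rightarrow> 'a \<Rightarrow> real"
  assumes [measurable]: "\<And>n. X n \<in> borel_measurable M"
    and lim: "AE \<omega> in M. (\<lambda>n. X n \<omega>) \<longlonglongrightarrow> a"
  shows "o_p M (\<lambda>n \<omega>. X n \<omega> - a)"
  unfolding o_p_def conv_prob_zero_def
proof (intro allI impI)
  fix \<epsilon> :: real assume e: "\<epsilon> > 0"
  define B where "B n = {\<omega> \<in> space M. \<epsilon> < \<bar>X n \<omega> - a\<bar>}" for n
  have [measurable]: "B n \<in> sets M" for n unfolding B_def by measurable
  have "(\<lambda>n. \<integral>\<omega>. indicator (B n) \<omega> \<partial>M) \<longlonglongrightarrow> (\<integral>\<omega>. (0::real) \<partial>M)"
  proof (rule integral_dominated_convergence[where w = "\<lambda>_. 1"])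
    show "AE \<omega> in M. (\<lambda>n. indicator (B n) \<omega> :: real) \<longlonglongrightarrow> 0"
      using lim
    proof eventually_elim
      case (elim \<omega>)
      then have "(\<lambda>n. \<bar>X n \<omega> - a\<bar>) \<longlonglongrightarrow> \<bar>a - a\<bar>" by (intro tendsto_intros)
      then have "\<forall>\<^sub>F n in sequentially. \<bar>X n \<omega> - a\<bar> < \<epsilon>"
        using e by (intro order_tendstoD(2)) auto
      then have "\<forall>\<^sub>F n in sequentially. indicator (B n) \<omega> = (0::real)"
        by eventually_elim (auto simp: B_def)
      then show ?case by (rule tendsto_eventually)
    qed
  qed (auto simp: indicator_def)
  then have "(\<lambda>n. measure M (B n)) \<longlonglongrightarrow> 0" by simp
  then have "(\<lambda>n. ennreal (measure M (B n))) \<longlonglongrightarrow> ennreal 0" by (rule tendsto_ennrealI)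
  then have "(\<lambda>n. outer_measure_of M (B n)) \<longlonglongrightarrow> 0" by (simp add: emeasure_eq_measure)
  moreover have "{\<omega> \<in> space M. ennreal \<epsilon> < ennreal \<bar>X n \<omega> - a\<bar>} = B n" for n
    using e by (auto simp: B_def ennreal_less_iff)
  ultimately show "(\<lambda>n. outer_measure_of M {\<omega> \<in> space M. ennreal \<epsilon> < ennreal \<bar>X n \<omega> - a\<bar>}) \<longlonglongrightarrow> 0"
    by simp
qed

section \<open>Fold assignments independent of the sample\<close>

locale cross_fitting = iid_sample M P Z
  for M :: "'a measure" and P :: "'p::finite obs measure" and Z +
  fixes K :: nat and \<kappa> :: "nat \<Rightarrow> nat \<Rightarrow> 'a \<Rightarrow> nat"
  assumes K2: "2 \<le> K" and folds: "random_folds M Z K \<kappa>"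
begin

abbreviation folds_of :: "nat \<Rightarrow> 'a \<Rightarrow> nat \<Rightarrow> nat" where
  "folds_of n \<omega> \<equiv> \<lambda>i. \<kappa> n i \<omega>"

abbreviation sample :: "'a \<Rightarrow> nat \<Rightarrow> 'p obs" where
  "sample \<omega> \<equiv> \<lambda>i. Z i \<omega>"

lemma \<kappa>_less: "i < n \<Longrightarrow> \<omega> \<in> space M \<Longrightarrow> \<kappa> n i \<omega> < K"
  using folds by (auto simp: random_folds_def)

lemma indep_folds:
  "indep_set
    (sets (vimage_algebra (space M) (\<lambda>\<omega>. \<lambda>i\<in>{..<n}. \<kappa> n i \<omega>) (PiM {..<n} (\<lambda>_. count_space UNIV))))
    (sets (vimage_algebra (space M) (\<lambda>\<omega>. \<lambda>i\<in>{..<n}. Z i \<omega>) (PiM {..<n} (\<lambda>_. borel))))"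
  using folds by (auto simp: random_folds_def)

text \<open>\<open>random_folds\<close> has no separate measurability clause; measurability is
  contained in \<open>indep_set\<close>, both of whose families consist of events.\<close>

lemma measurable_folds:
  "(\<lambda>\<omega>. \<lambda>i\<in>{..<n}. \<kappa> n i \<omega>) \<in> measurable M (PiM {..<n} (\<lambda>_. count_space UNIV))"
proof (rule measurableI)
  fix A assume "A \<in> sets (PiM {..<n} (\<lambda>_. count_space (UNIV :: nat set)))"
  from in_vimage_algebra[OF this, of "\<lambda>\<omega>. \<lambda>i\<in>{..<n}. \<kappa> n i \<omega>" "space M"]
  show "(\<lambda>\<omega>. \<lambda>i\<in>{..<n}. \<kappa> n i \<omega>) -` A \<inter> space M \<in> sets M"
    using indep_setD_ev1[OF indep_folds] by blast
qed (auto simp: space_PiM)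

lemma measurable_\<kappa>: "i < n \<Longrightarrow> \<kappa> n i \<in> measurable M (count_space UNIV)"
  using measurable_compose[OF measurable_folds[of n] measurable_component_singleton[of i "{..<n}"]] by simp

lemma borel_measurable_card_fold_of [measurable]:
    "(\<lambda>\<omega>. real (card (fold_of n k (folds_of n \<omega>)))) \<in> borel_measurable M"
  and borel_measurable_card_train_of [measurable]:
    "(\<lambda>\<omega>. real (card (train_of n k (folds_of n \<omega>)))) \<in> borel_measurable M"
proof -
  have [measurable]: "(\<lambda>\<omega>. \<kappa> n i \<omega>) \<in> measurable M (count_space UNIV)" if "i \<in> {..<n}" for i
    using that measurable_\<kappa> by auto
  have "real (card (fold_of n k c)) = (\<Sum>i<n. if c i = k then 1 else 0)" for c
    by (simp add: sum.If_cases fold_of_def Int_def)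
  then show "(\<lambda>\<omega>. real (card (fold_of n k (folds_of n \<omega>)))) \<in> borel_measurable M" by simp
  have "real (card (train_of n k c)) = (\<Sum>i<n. if c i = k then 0 else 1)" for c
    by (simp add: sum.If_cases train_of_def Int_def)
  then show "(\<lambda>\<omega>. real (card (train_of n k (folds_of n \<omega>)))) \<in> borel_measurable M" by simp
qed

text \<open>Conditioning on the fold assignment, which takes finitely many values and is independent of
  the data, reduces probability bounds to those for a deterministic assignment.\<close>

lemma decouple:
  assumes Q: "\<And>c. c \<in> {..<n} \<rightarrow>\<^sub>E {..<K} \<Longrightarrow>
      {w \<in> space (PiM {..<n} (\<lambda>_. borel)). Q c w} \<in> sets (PiM {..<n} (\<lambda>_. borel))"
    and bound: "\<And>c. c \<in> {..<n} \<rightarrow>\<^sub>E {..<K} \<Longrightarrow>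
      measure M {\<omega> \<in> space M. Q c (\<lambda>i\<in>{..<n}. Z i \<omega>)} \<le> b"
    and b: "0 \<le> b"
  shows "outer_measure_of M {\<omega> \<in> space M. Q (\<lambda>i\<in>{..<n}. \<kappa> n i \<omega>) (\<lambda>i\<in>{..<n}. Z i \<omega>)} \<le> ennreal b"
proof -
  define C where "C = {..<n} \<rightarrow>\<^sub>E {..<K}"
  have finC: "finite C" unfolding C_def by (intro finite_PiE) auto
  define A where "A c = {\<omega> \<in> space M. (\<lambda>i\<in>{..<n}. \<kappa> n i \<omega>) = c}" for c
  define B where "B c = {\<omega> \<in> space M. Q c (\<lambda>i\<in>{..<n}. Z i \<omega>)}" for c
  have A: "A c \<in> sets (vimage_algebra (space M) (\<lambda>\<omega>. \<lambda>i\<in>{..<n}. \<kappa> n i \<omega>) (PiM {..<n} (\<lambda>_. count_space UNIV)))"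
    if "c \<in> C" for c
  proof -
    have "PiE {..<n} (\<lambda>i. {c i}) = {c}"
      using that by (intro PiE_singleton) (auto simp: C_def PiE_def)
    then have "{c} \<in> sets (PiM {..<n} (\<lambda>_. count_space UNIV))"
      using sets_PiM_I_finite[of "{..<n}" "\<lambda>i. {c i}" "\<lambda>_. count_space UNIV"] by simp
    from in_vimage_algebra[OF this, of "\<lambda>\<omega>. \<lambda>i\<in>{..<n}. \<kappa> n i \<omega>" "space M"]
    show ?thesis by (simp add: A_def vimage_def Int_def conj_commute)
  qed
  have B: "B c \<in> sets (vimage_algebra (space M) (\<lambda>\<omega>. \<lambda>i\<in>{..<n}. Z i \<omega>) (PiM {..<n} (\<lambda>_. borel)))"
    if "c \<in> C" for c
  proof -
    from in_vimage_algebra[OF Q[OF that[unfolded C_def]], of "\<lambda>\<omega>. \<lambda>i\<in>{..<n}. Z i \<omega>" "space M"]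
    show ?thesis by (simp add: B_def vimage_def Int_def conj_commute space_PiM)
  qed
  have AM: "A c \<in> sets M" and BM: "B c \<in> sets M" if "c \<in> C" for c
    using A[OF that] B[OF that] indep_setD_ev1[OF indep_folds[of n]] indep_setD_ev2[OF indep_folds[of n]] by auto
  have eq: "{\<omega> \<in> space M. Q (\<lambda>i\<in>{..<n}. \<kappa> n i \<omega>) (\<lambda>i\<in>{..<n}. Z i \<omega>)} = (\<Union>c\<in>C. A c \<inter> B c)"
    using \<kappa>_less by (auto simp: A_def B_def C_def PiE_def Pi_def)
  have "measure M (\<Union>c\<in>C. A c \<inter> B c) \<le> (\<Sum>c\<in>C. measure M (A c \<inter> B c))"
    using AM BM finC by (intro finite_measure_subadditive_finite) auto
  also have "\<dots> = (\<Sum>c\<in>C. measure M (A c) * measure M (B c))"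
    by (intro sum.cong refl indep_setD[OF indep_folds[of n]] A B)
  also have "\<dots> \<le> (\<Sum>c\<in>C. measure M (A c) * b)"
    using bound by (intro sum_mono mult_left_mono) (auto simp: B_def C_def)
  \<comment> \<open>The events \<open>A c\<close> are disjoint, so their probabilities add up to at
    most 1 and the number of assignments does not enter the bound.\<close>
  also have "\<dots> = measure M (\<Union>c\<in>C. A c) * b"
    using AM finC
    by (subst finite_measure_finite_Union) (auto simp: sum_distrib_right disjoint_family_on_def A_def)
  also have "\<dots> \<le> 1 * b"
    using b by (intro mult_right_mono prob_le_1) auto
  finally have "measure M (\<Union>c\<in>C. A c \<inter> B c) \<le> b" by simp
  moreover have "(\<Union>c\<in>C. A c \<inter> B c) \<in> sets M"
    using AM BM finC by (intro sets.finite_UN) auto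
  ultimately show ?thesis
    unfolding eq by (simp add: emeasure_eq_measure ennreal_leI)
qed

text \<open>Chebyshev's inequality for each frozen assignment, then decoupling. By
  \<open>loc\<close> the statistic sees only the first \<open>n\<close> entries, so it may be
  evaluated at restrictions, which are the points of the finite product spaces.\<close>

lemma decouple_Markov:
  fixes S :: "(nat \<Rightarrow> nat) \<Rightarrow> (nat \<Rightarrow> 'p obs) \<Rightarrow> real"
  assumes loc: "\<And>c w. S (restrict c {..<n}) (restrict w {..<n}) = S c w"
    and meas: "\<And>c. S c \<in> borel_measurable (PiM {..<n} (\<lambda>_. borel))"
    and bound: "\<And>c. (\<And>i. i < n \<Longrightarrow> c i < K) \<Longrightarrow> (\<integral>\<^sup>+\<omega>. ennreal ((S c (sample \<omega>))\<^sup>2) \<partial>M) \<le> ennreal b"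
    and b: "0 \<le> b" and t: "0 < t"
  shows "outer_measure_of M {\<omega> \<in> space M. t < \<bar>S (folds_of n \<omega>) (sample \<omega>)\<bar>} \<le> ennreal (b / t\<^sup>2)"
proof -
  have locZ: "S c (\<lambda>i. w i) = S c (restrict w {..<n})" for c w
    using loc[of c w] loc[of c "restrict w {..<n}"] by simp
  have "outer_measure_of M {\<omega> \<in> space M. t < \<bar>S (\<lambda>i\<in>{..<n}. \<kappa> n i \<omega>) (\<lambda>i\<in>{..<n}. Z i \<omega>)\<bar>} \<le> ennreal (b / t\<^sup>2)"
  proof (rule decouple)
    fix c assume c: "c \<in> {..<n} \<rightarrow>\<^sub>E {..<K}"
    note [measurable] = meas[of c]
    show "{w \<in> space (PiM {..<n} (\<lambda>_. borel)). t < \<bar>S c w\<bar>} \<in> sets (PiM {..<n} (\<lambda>_. borel))"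
      by measurable
    have [measurable]: "(\<lambda>\<omega>. S c (\<lambda>i\<in>{..<n}. Z i \<omega>)) \<in> borel_measurable M"
      by (rule measurable_compose[OF _ meas]) measurable
    have "ennreal (t\<^sup>2) * emeasure M {\<omega> \<in> space M. t < \<bar>S c (\<lambda>i\<in>{..<n}. Z i \<omega>)\<bar>}
        = (\<integral>\<^sup>+\<omega>. ennreal (t\<^sup>2) * indicator {\<omega> \<in> space M. t < \<bar>S c (\<lambda>i\<in>{..<n}. Z i \<omega>)\<bar>} \<omega> \<partial>M)"
      by (subst nn_integral_cmult_indicator) auto
    also have "\<dots> \<le> (\<integral>\<^sup>+\<omega>. ennreal ((S c (sample \<omega>))\<^sup>2) \<partial>M)"
    proof (intro nn_integral_mono)
      fix \<omega>
      have "t\<^sup>2 \<le> (S c (sample \<omega>))\<^sup>2" if "t < \<bar>S c (\<lambda>i\<in>{..<n}. Z i \<omega>)\<bar>"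
        using that t locZ[of c "\<lambda>i. Z i \<omega>"] by (simp add: abs_le_square_iff[symmetric])
      then show "ennreal (t\<^sup>2) * indicator {\<omega> \<in> space M. t < \<bar>S c (\<lambda>i\<in>{..<n}. Z i \<omega>)\<bar>} \<omega>
          \<le> ennreal ((S c (sample \<omega>))\<^sup>2)"
        by (auto simp: indicator_def intro!: ennreal_leI)
    qed
    also have "\<dots> \<le> ennreal b"
      using c by (intro bound) auto
    finally have "t\<^sup>2 * measure M {\<omega> \<in> space M. t < \<bar>S c (\<lambda>i\<in>{..<n}. Z i \<omega>)\<bar>} \<le> b"
      using b by (simp add: emeasure_eq_measure ennreal_mult[symmetric])
    then show "measure M {\<omega> \<in> space M. t < \<bar>S c (\<lambda>i\<in>{..<n}. Z i \<omega>)\<bar>} \<le> b / t\<^sup>2"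
      using t by (simp add: field_simps)
  qed (use b in simp)
  then show ?thesis by (simp add: loc)
qed

lemma o_p_decouple:
  fixes S :: "nat \<Rightarrow> (nat \<Rightarrow> nat) \<Rightarrow> (nat \<Rightarrow> 'p obs) \<Rightarrow> real"
  assumes loc: "\<And>n c w. S n (restrict c {..<n}) (restrict w {..<n}) = S n c w"
    and meas: "\<And>n c. S n c \<in> borel_measurable (PiM {..<n} (\<lambda>_. borel))"
    and bound: "\<And>n c. n > 0 \<Longrightarrow> (\<And>i. i < n \<Longrightarrow> c i < K) \<Longrightarrow>
      (\<integral>\<^sup>+\<omega>. ennreal ((S n c (sample \<omega>))\<^sup>2) \<partial>M) \<le> ennreal (b n)"
    and b: "\<And>n. 0 \<le> b n" "b \<longlonglongrightarrow> 0"
  shows "o_p M (\<lambda>n \<omega>. S n (folds_of n \<omega>) (sample \<omega>))"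
  unfolding o_p_iff
proof (intro allI impI)
  fix \<epsilon> \<eta> :: real assume pos: "\<epsilon> > 0" "\<eta> > 0"
  have "(\<lambda>n. b n / \<epsilon>\<^sup>2) \<longlonglongrightarrow> 0 / \<epsilon>\<^sup>2" using b(2) pos by (intro tendsto_intros) auto
  then have "\<forall>\<^sub>F n in sequentially. b n / \<epsilon>\<^sup>2 < \<eta>" using pos by (intro order_tendstoD(2)) auto
  then show "\<forall>\<^sub>F n in sequentially. outer_measure_of M
      {\<omega> \<in> space M. \<epsilon> < \<bar>S n (folds_of n \<omega>) (sample \<omega>)\<bar>} \<le> ennreal \<eta>"
    using eventually_gt_at_top[of 0]
  proof eventually_elim
    case (elim n)
    have "outer_measure_of M {\<omega> \<in> space M. \<epsilon> < \<bar>S n (folds_of n \<omega>) (sample \<omega>)\<bar>} \<le> ennreal (b n / \<epsilon>\<^sup>2)"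
      by (rule decouple_Markov[where S = "S n"]) (use loc meas bound[OF elim(2)] b(1) pos(1) in auto)
    also have "\<dots> \<le> ennreal \<eta>" using elim(1) by (intro ennreal_leI) simp
    finally show ?case .
  qed
qed

lemma O_p_decouple:
  fixes S :: "nat \<Rightarrow> (nat \<Rightarrow> nat) \<Rightarrow> (nat \<Rightarrow> 'p obs) \<Rightarrow> real"
  assumes loc: "\<And>n c w. S n (restrict c {..<n}) (restrict w {..<n}) = S n c w"
    and meas: "\<And>n c. S n c \<in> borel_measurable (PiM {..<n} (\<lambda>_. borel))"
    and bound: "\<And>n c. n > 0 \<Longrightarrow> (\<And>i. i < n \<Longrightarrow> c i < K) \<Longrightarrow>
      (\<integral>\<^sup>+\<omega>. ennreal ((S n c (sample \<omega>))\<^sup>2) \<partial>M) \<le> ennreal b"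
    and b: "0 \<le> b"
  shows "O_p M (\<lambda>n \<omega>. S n (folds_of n \<omega>) (sample \<omega>))"
  unfolding O_p_def
proof (intro allI impI)
  fix \<eta> :: real assume pos: "\<eta> > 0"
  \<comment> \<open>Chosen so that b / C^2 is at most \<open>\<eta>\<close>; the summand 1 keeps
    \<open>C\<close> positive when \<open>b = 0\<close>.\<close>
  define C where "C = sqrt (b / \<eta>) + 1"
  have C: "C > 0" using b pos by (simp add: C_def add_nonneg_pos)
  have "b / \<eta> = (sqrt (b / \<eta>))\<^sup>2" using b pos by simp
  also have "\<dots> \<le> C\<^sup>2" using b pos by (intro power_mono) (auto simp: C_def)
  finally have "b / C\<^sup>2 \<le> \<eta>" using pos C by (simp add: field_simps)
  have "\<forall>\<^sub>F n in sequentially. outer_measure_of M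
      {\<omega> \<in> space M. C < \<bar>S n (folds_of n \<omega>) (sample \<omega>)\<bar>} \<le> ennreal \<eta>"
    using eventually_gt_at_top[of 0]
  proof eventually_elim
    case (elim n)
    have "outer_measure_of M {\<omega> \<in> space M. C < \<bar>S n (folds_of n \<omega>) (sample \<omega>)\<bar>} \<le> ennreal (b / C\<^sup>2)"
      by (rule decouple_Markov[where S = "S n"]) (use loc meas bound[OF elim] b C in auto)
    also have "\<dots> \<le> ennreal \<eta>" using \<open>b / C\<^sup>2 \<le> \<eta>\<close> by (rule ennreal_leI)
    finally show ?case .
  qed
  with C show "\<exists>C>0. \<forall>\<^sub>F n in sequentially. outer_measure_of M
      {\<omega> \<in> space M. C < \<bar>S n (folds_of n \<omega>) (sample \<omega>)\<bar>} \<le> ennreal \<eta>" by blast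
qed

text \<open>Every training set holds at least a quarter of the sample. As \<open>K\<close> is at
  least 2, the limiting fraction 1 - 1/K is at least 1/2, which leaves room for the constant 1/4.
  The condition converts bounds in 1/card(training set) into bounds in 4/n.\<close>

definition balanced :: "nat \<Rightarrow> (nat \<Rightarrow> nat) \<Rightarrow> bool" where
  "balanced n c \<longleftrightarrow> (\<forall>k<K. n \<le> 4 * card (train_of n k c))"

lemma balanced_restrict [simp]: "balanced n (restrict c {..<n}) = balanced n c"
  by (simp add: balanced_def)

definition unbalanced_event :: "nat \<Rightarrow> 'a set" where
  "unbalanced_event n = {\<omega> \<in> space M. \<not> balanced n (folds_of n \<omega>)}"

lemma unbalanced_event_subset: "unbalanced_event n \<subseteq> space M"
  by (auto simp: unbalanced_event_def)

lemma unbalanced_event_tendsto: "(\<lambda>n. outer_measure_of M (unbalanced_event n)) \<longlonglongrightarrow> 0"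
proof -
  let ?X = "\<lambda>k n \<omega>. real (card (train_of n k (folds_of n \<omega>))) / real n"
  have "o_p M (\<lambda>n \<omega>. ?X k n \<omega> - (1 - 1 / K))" if "k \<in> {..<K}" for k
    using folds that
    by (intro o_p_of_AE_tendsto) (auto simp: random_folds_def train_set_eq elim!: eventually_mono)
  then have "o_p M (\<lambda>n \<omega>. \<Sum>k<K. \<bar>?X k n \<omega> - (1 - 1 / K)\<bar>)"
    by (intro o_p_sum) (auto simp: o_p_def)
  \<comment> \<open>A fraction below 1/4 differs by more than 1/4 from a limit of at least 1/2, so
    the threshold 1/8 is safely exceeded. Summing over \<open>k\<close> treats all folds at
    once.\<close>
  from o_pD[OF this, of "1/8"]
  have *: "\<forall>\<^sub>F n in sequentially. outer_measure_of M
      {\<omega> \<in> space M. 1/8 < \<bar>\<Sum>k<K. \<bar>?X k n \<omega> - (1 - 1 / K)\<bar>\<bar>} \<le> ennreal \<eta>" if "\<eta> > 0" for \<eta>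
    using that by simp
  show ?thesis
    unfolding tendsto_0_ennreal_iff
  proof (intro allI impI)
    fix \<eta> :: real assume "\<eta> > 0"
    from *[OF this] eventually_gt_at_top[of 0]
    show "\<forall>\<^sub>F n in sequentially. outer_measure_of M (unbalanced_event n) \<le> ennreal \<eta>"
    proof eventually_elim
      case (elim n)
      have "unbalanced_event n \<subseteq> {\<omega> \<in> space M. 1/8 < \<bar>\<Sum>k<K. \<bar>?X k n \<omega> - (1 - 1 / K)\<bar>\<bar>}"
      proof
        fix \<omega> assume "\<omega> \<in> unbalanced_event n"
        then obtain k where k: "k < K" "4 * card (train_of n k (folds_of n \<omega>)) < n" and w: "\<omega> \<in> space M"
          by (auto simp: unbalanced_event_def balanced_def not_le)
        then have "4 * real (card (train_of n k (folds_of n \<omega>))) < real n" by linarith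
        then have "?X k n \<omega> < 1/4" using elim(2) by (simp add: field_simps)
        moreover have "1 - 1 / K \<ge> 1/2" using K2 by (simp add: field_simps)
        ultimately have "1/8 < \<bar>?X k n \<omega> - (1 - 1 / K)\<bar>" by linarith
        also have "\<dots> \<le> (\<Sum>k<K. \<bar>?X k n \<omega> - (1 - 1 / K)\<bar>)"
          using k(1) by (intro member_le_sum) auto
        finally show "\<omega> \<in> {\<omega> \<in> space M. 1/8 < \<bar>\<Sum>k<K. \<bar>?X k n \<omega> - (1 - 1 / K)\<bar>\<bar>}"
          using w by (simp add: abs_of_nonneg sum_nonneg)
      qed
      from outer_measure_of_mono[OF this] elim(1) show ?case by (rule order_trans)
    qed
  qed
qed

lemma o_p_fold_ratio:
  assumes "k < K"
  shows "o_p M (\<lambda>n \<omega>. card (fold_of n k (folds_of n \<omega>)) / card (train_of n k (folds_of n \<omega>)) - 1 / (real K - 1))"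
proof (rule o_p_of_AE_tendsto)
  have "AE \<omega> in M. (\<lambda>n. real (card (fold_of n k (folds_of n \<omega>))) / real n) \<longlonglongrightarrow> 1 / real K \<and>
        (\<lambda>n. real (card (train_of n k (folds_of n \<omega>))) / real n) \<longlonglongrightarrow> 1 - 1 / real K"
    using folds assms by (simp add: random_folds_def train_set_eq fold_set_eq)
  then show "AE \<omega> in M. (\<lambda>n. card (fold_of n k (folds_of n \<omega>)) / card (train_of n k (folds_of n \<omega>)))
      \<longlonglongrightarrow> 1 / (real K - 1)"
  proof eventually_elim
    case (elim \<omega>)
    have lim: "(\<lambda>n. (card (fold_of n k (folds_of n \<omega>)) / real n) / (card (train_of n k (folds_of n \<omega>)) / real n))
        \<longlonglongrightarrow> (1 / real K) / (1 - 1 / real K)"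
      by (rule tendsto_divide[OF conjunct1[OF elim] conjunct2[OF elim]]) (use K2 in \<open>auto simp: field_simps\<close>)
    have eq: "(1 / real K) / (1 - 1 / real K) = 1 / (real K - 1)"
      using K2 by (simp add: field_simps)
    have ev: "\<forall>\<^sub>F n in sequentially.
        (card (fold_of n k (folds_of n \<omega>)) / real n) / (card (train_of n k (folds_of n \<omega>)) / real n)
        = card (fold_of n k (folds_of n \<omega>)) / card (train_of n k (folds_of n \<omega>))"
      using eventually_gt_at_top[of 0] by eventually_elim simp
    show ?case using lim unfolding eq tendsto_cong[OF ev] .
  qed
qed measurable

end

section \<open>Conditional ranks\<close>

text \<open>A Riemann-Stieltjes sum for the integral of u^k over [0,1] after the substitution u = G
  r. The increments of \<open>G ^ (k + 1)\<close> telescope to 1, and uniform continuity of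
  \<open>G\<close> controls the error made by using right endpoints.\<close>

lemma Riemann_sum_power_tendsto:
  fixes G :: "real \<Rightarrow> real"
  assumes cont: "continuous_on {0..1} G" and mono: "mono_on {0..1} G" and G01: "G 0 = 0" "G 1 = 1"
  shows "(\<lambda>m. \<Sum>j<m. G (Suc j / m) ^ k * (G (Suc j / m) - G (j / m))) \<longlonglongrightarrow> 1 / (real k + 1)"
proof (rule LIMSEQ_I)
  fix e :: real assume e: "e > 0"
  have "uniformly_continuous_on {0..1} G"
    by (rule compact_uniformly_continuous[OF cont]) simp
  then obtain d where d: "d > 0" "\<And>x y. x \<in> {0..1} \<Longrightarrow> y \<in> {0..1} \<Longrightarrow> \<bar>y - x\<bar> < d \<Longrightarrow> \<bar>G y - G x\<bar> < e"
    using e unfolding uniformly_continuous_on_def dist_real_def by metis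
  obtain n0 :: nat where n0: "n0 > 0" "1 / real n0 < d"
    using reals_Archimedean[OF d(1)] by (metis inverse_eq_divide zero_less_Suc)
  show "\<exists>n0. \<forall>m\<ge>n0. norm ((\<Sum>j<m. G (Suc j / m) ^ k * (G (Suc j / m) - G (j / m))) - 1 / (real k + 1)) < e"
  proof (intro exI[of _ n0] allI impI)
    fix m assume m: "m \<ge> n0"
    then have m0: "m > 0" using n0 by simp
    have "1 / real m \<le> 1 / real n0" using m n0(1) by (intro divide_left_mono) auto
    then have md: "1 / real m < d" using n0(2) by simp
    define g where "g j = G (real j / real m)" for j
    have in01: "real j / real m \<in> {0..1}" if "j \<le> m" for j using that m0 by simp
    have g01: "0 \<le> g j" "g j \<le> 1" if "j \<le> m" for j
      using mono_onD[OF mono, of 0 "j / m"] mono_onD[OF mono, of "j / m" 1] in01[OF that] G01 by (auto simp: g_def)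
    have gmono: "g j \<le> g (Suc j)" if "j < m" for j
      using that in01[of j] in01[of "Suc j"] by (auto simp: g_def intro!: mono_onD[OF mono] divide_right_mono)
    have gd: "g (Suc j) - g j < e" if "j < m" for j
    proof -
      have "\<bar>real (Suc j) / real m - real j / real m\<bar> = 1 / real m"
        by (simp add: field_simps flip: diff_divide_distrib)
      then have "\<bar>g (Suc j) - g j\<bar> < e"
        unfolding g_def using that in01[of j] in01[of "Suc j"] md by (intro d(2)) auto
      then show ?thesis by simp
    qed
    have gm: "g m = 1" "g 0 = 0" using m0 G01 by (simp_all add: g_def)
    \<comment> \<open>Factor b^(k+1) - a^(k+1) as (b - a) times k + 1 monomials of degree k; for 0
      \<le> a \<le> b each of them lies between a^k and b^k.\<close>
    have pw: "(real k + 1) * (g j ^ k * (g (Suc j) - g j)) \<le> g (Suc j) ^ (k + 1) - g j ^ (k + 1)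
        \<and> g (Suc j) ^ (k + 1) - g j ^ (k + 1) \<le> (real k + 1) * (g (Suc j) ^ k * (g (Suc j) - g j))" if j: "j < m" for j
    proof -
      define a b where "a = g j" and "b = g (Suc j)"
      have ab: "0 \<le> a" "a \<le> b" using g01[of j] gmono[of j] j by (auto simp: a_def b_def)
      have "a ^ k = a ^ (k - i) * a ^ i" "b ^ k = b ^ (k - i) * b ^ i" if "i \<le> k" for i
        using that by (simp_all flip: power_add)
      then have "a ^ k \<le> a ^ (k - i) * b ^ i" "a ^ (k - i) * b ^ i \<le> b ^ k" if "i \<le> k" for i
        using that ab by (auto intro!: mult_mono power_mono)
      then have "(\<Sum>i<k+1. a ^ k) \<le> (\<Sum>i<k+1. a ^ (k + 1 - Suc i) * b ^ i)"
        "(\<Sum>i<k+1. a ^ (k + 1 - Suc i) * b ^ i) \<le> (\<Sum>i<k+1. b ^ k)"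
        by (intro sum_mono; simp)+
      moreover have "(\<Sum>i<k+1. c ^ k) = (real k + 1) * c ^ k" for c :: real by simp
      ultimately have "(real k + 1) * a ^ k \<le> (\<Sum>i<k+1. a ^ (k + 1 - Suc i) * b ^ i)"
        "(\<Sum>i<k+1. a ^ (k + 1 - Suc i) * b ^ i) \<le> (real k + 1) * b ^ k" by (simp_all only:)
      then have "(b - a) * ((real k + 1) * a ^ k) \<le> b ^ (k + 1) - a ^ (k + 1)"
        "b ^ (k + 1) - a ^ (k + 1) \<le> (b - a) * ((real k + 1) * b ^ k)"
        using ab unfolding power_diff_sumr2[of b "k + 1" a] by (intro mult_left_mono; linarith)+
      then show ?thesis by (simp add: a_def b_def algebra_simps)
    qed
    define s where "s = (\<Sum>j<m. g (Suc j) ^ k * (g (Suc j) - g j))"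
    have tel: "(\<Sum>j<m. g (Suc j) ^ i - g j ^ i) = 1" if "i > 0" for i
      using that by (simp add: sum_lessThan_telescope[of "\<lambda>j. g j ^ i"] gm)
    have "1 \<le> (real k + 1) * s"
      using sum_mono[OF conjunct2[OF pw], of "{..<m}" "\<lambda>j. j"] tel[of "k + 1"] by (simp add: s_def sum_distrib_left)
    moreover have "(real k + 1) * s \<le> 1 + (real k + 1) * (\<Sum>j<m. (g (Suc j) ^ k - g j ^ k) * (g (Suc j) - g j))"
      using sum_mono[OF conjunct1[OF pw], of "{..<m}" "\<lambda>j. j"] tel[of "k + 1"]
      by (simp add: s_def sum_distrib_left[symmetric] left_diff_distrib sum_subtractf right_diff_distrib)
    moreover have "(real k + 1) * (\<Sum>j<m. (g (Suc j) ^ k - g j ^ k) * (g (Suc j) - g j)) < (real k + 1) * e"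
    proof (rule mult_strict_left_mono)
      show "(\<Sum>j<m. (g (Suc j) ^ k - g j ^ k) * (g (Suc j) - g j)) < e"
      proof (cases "k = 0")
        case False
        \<comment> \<open>The largest increment of \<open>g\<close> comes out as a factor, and the
          increments of \<open>g ^ k\<close> telescope to 1. This needs k > 0; for k = 0 the sum is
          0.\<close>
        have "(\<Sum>j<m. (g (Suc j) ^ k - g j ^ k) * (g (Suc j) - g j)) \<le> (\<Sum>j<m. (g (Suc j) ^ k - g j ^ k) * Max ((\<lambda>j. g (Suc j) - g j) ` {..<m}))"
          using gmono g01 by (intro sum_mono mult_left_mono) (auto intro: power_mono)
        also have "\<dots> = Max ((\<lambda>j. g (Suc j) - g j) ` {..<m})"
          using tel[of k] False by (simp flip: sum_distrib_right)
        also have "\<dots> < e" using gd m0 by (subst Max_less_iff) auto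
        finally show ?thesis .
      qed (use e in simp)
    qed simp
    ultimately have "1 \<le> (real k + 1) * s" "(real k + 1) * s < 1 + (real k + 1) * e" by linarith+
    then have "1 / (real k + 1) \<le> s" "s < 1 / (real k + 1) + e" by (simp_all add: field_simps)
    then show "norm ((\<Sum>j<m. G (Suc j / m) ^ k * (G (Suc j / m) - G (j / m))) - 1 / (real k + 1)) < e"
      unfolding g_def[symmetric] s_def[symmetric] by simp
  qed
qed

lemma measurable_covar [measurable]: "covar \<in> borel_measurable borel"
  and measurable_out_Y [measurable]: "out_Y \<in> borel_measurable borel"
  and measurable_out_W [measurable]: "out_W \<in> borel_measurable borel"
  unfolding covar_def[abs_def] out_Y_def[abs_def] out_W_def[abs_def]
  by (intro borel_measurable_continuous_onI continuous_intros)+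

section \<open>Conditional ranks have the moments of the uniform law\<close>

locale conditional_rank = prob_space P for P :: "'p::finite obs measure" +
  fixes R :: "'p obs \<Rightarrow> real" and F f :: "real \<Rightarrow> real ^ 'p \<Rightarrow> real"
  assumes sets_P [measurable_cong]: "sets P = sets borel"
    and measurable_R [measurable]: "R \<in> borel_measurable borel"
    and range_R: "AE z in P. R z \<in> {0..1}"
    and cond_cdf: "cond_cdf P R F"
    and cond_regular: "cond_regular P F f"
begin

lemma space_P: "space P = UNIV"
  using sets_eq_imp_space_eq[OF sets_P] by simp

lemma measurable_F [measurable]:
  assumes "g \<in> borel_measurable N" "h \<in> borel_measurable N"
  shows "(\<lambda>z. F (g z) (h z)) \<in> borel_measurable N"
proof -
  have "(\<lambda>z. (g z, h z)) \<in> measurable N borel"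
    using measurable_Pair[OF assms] unfolding borel_prod .
  from measurable_compose[OF this, of "\<lambda>(r, x). F r x" borel] cond_cdf show ?thesis
    unfolding cond_cdf_def by simp
qed

abbreviation "U \<equiv> cond_rank R F"

lemma measurable_U [measurable]: "U \<in> borel_measurable borel"
  unfolding cond_rank_def by measurable

abbreviation "covar_algebra \<equiv> vimage_algebra (space P) covar borel"

lemma covar_algebra: "finite_measure_subalgebra P covar_algebra"
proof
  show "subalgebra P covar_algebra"
    unfolding subalgebra_def
    by (auto simp: space_P sets_vimage_algebra2 space_borel intro: measurable_sets_borel[OF measurable_covar, simplified] simp: sets_P)
qed

text \<open>The tower property with a bounded weight that depends on the covariate only. It is
  available for one fixed threshold \<open>q\<close> at a time; the outcome itself cannot be
  inserted for \<open>q\<close>, which is why the moments below go through a grid.\<close>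

lemma cond_exp_cdf:
  assumes [measurable]: "h \<in> borel_measurable borel" and h: "AE z in P. \<bar>h (covar z)\<bar> \<le> B"
  shows "integrable P (\<lambda>z. h (covar z) * F q (covar z))"
    "(\<integral>z. h (covar z) * indicator {z. R z \<le> q} z \<partial>P) = (\<integral>z. h (covar z) * F q (covar z) \<partial>P)"
proof -
  interpret S: finite_measure_subalgebra P covar_algebra by (rule covar_algebra)
  have e: "{z \<in> space P. R z \<le> q} = {z. R z \<le> q}" by (simp add: space_P)
  have [measurable]: "{z. R z \<le> q} \<in> sets P" unfolding e[symmetric] by measurable
  have i: "integrable P (\<lambda>z. h (covar z) * indicator {z. R z \<le> q} z)"
  proof (rule integrable_const_bound[of _ "\<bar>B\<bar>"])
    show "AE z in P. norm (h (covar z) * indicator {z. R z \<le> q} z) \<le> \<bar>B\<bar>"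
      using h by eventually_elim (auto simp: indicator_def)
  qed measurable
  have hm: "(\<lambda>z. h (covar z)) \<in> borel_measurable covar_algebra"
    by (rule measurable_compose[OF measurable_vimage_algebra1]) auto
  have F: "AE z in P. h (covar z) * F q (covar z) = h (covar z) * real_cond_exp P covar_algebra (indicator {z. R z \<le> q}) z"
    using cond_cdf[unfolded cond_cdf_def, THEN conjunct2, THEN spec, of q, unfolded e]
    by eventually_elim simp
  note S.real_cond_exp_intg[OF i hm]
  moreover have [measurable]: "real_cond_exp P covar_algebra (indicator {z. R z \<le> q}) \<in> borel_measurable P" by simp
  ultimately show "integrable P (\<lambda>z. h (covar z) * F q (covar z))"
    "(\<integral>z. h (covar z) * indicator {z. R z \<le> q} z \<partial>P) = (\<integral>z. h (covar z) * F q (covar z) \<partial>P)"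
    using integrable_cong_AE[OF _ _ F] integral_cong_AE[OF _ _ F] by simp_all
qed

lemma AE_F_eq:
  assumes "AE z in P. indicator {z. R z \<le> q} z = (c::real)"
  shows "AE z in P. F q (covar z) = c"
proof -
  interpret S: finite_measure_subalgebra P covar_algebra by (rule covar_algebra)
  have e: "{z \<in> space P. R z \<le> q} = {z. R z \<le> q}" by (simp add: space_P)
  have [measurable]: "{z. R z \<le> q} \<in> sets P" unfolding e[symmetric] by measurable
  have "AE z in P. real_cond_exp P covar_algebra (indicator {z. R z \<le> q}) z = real_cond_exp P covar_algebra (\<lambda>_. c) z"
    by (intro S.real_cond_exp_cong assms) auto
  moreover have "AE z in P. real_cond_exp P covar_algebra (\<lambda>_. c) z = c"
    by (intro S.real_cond_exp_F_meas) auto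
  moreover have "AE z in P. F q (covar z) = real_cond_exp P covar_algebra (indicator {z. R z \<le> q}) z"
    using cond_cdf[unfolded cond_cdf_def, THEN conjunct2, THEN spec, of q, unfolded e] .
  ultimately show ?thesis by eventually_elim simp
qed

text \<open>The value at 1 comes from R \<le> 1. The value at 0 cannot be read off the event R \<le>
  0 directly, which the range of \<open>R\<close> does not exclude; instead F vanishes at the
  countably many points -1/(m+1), and continuity carries this to 0.\<close>

lemma AE_regular:
  "AE z in P. continuous_on UNIV (\<lambda>r. F r (covar z)) \<and> mono_on {0..1} (\<lambda>r. F r (covar z)) \<and>
     F 0 (covar z) = 0 \<and> F 1 (covar z) = 1"
proof -
  have "AE z in P. continuous_on UNIV (\<lambda>r. F r (covar z)) \<and> strict_mono_on {0..1} (\<lambda>r. F r (covar z))"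
    using cond_regular unfolding cond_regular_def
    by (intro AE_distrD[of covar P borel]) (auto elim!: eventually_mono)
  moreover have "AE z in P. F 1 (covar z) = 1"
  proof (rule AE_F_eq)
    show "AE z in P. indicator {z. R z \<le> 1} z = (1::real)"
      using range_R by eventually_elim auto
  qed
  moreover have "AE z in P. \<forall>m::nat. F (- inverse (Suc m)) (covar z) = 0"
    unfolding AE_all_countable
  proof
    fix m :: nat
    have neg: "- inverse (real (Suc m)) < 0" by simp
    have "AE z in P. indicator {z. R z \<le> - inverse (real (Suc m))} z = (0::real)"
      using range_R
    proof eventually_elim
      case (elim z)
      then have "\<not> R z \<le> - inverse (real (Suc m))"
        using neg unfolding atLeastAtMost_iff by linarith
      then show ?case by (simp add: indicator_def)
    qed
    then show "AE z in P. F (- inverse (real (Suc m))) (covar z) = 0"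
      by (rule AE_F_eq)
  qed
  ultimately show ?thesis
  proof eventually_elim
    case (elim z)
    have "(\<lambda>m. - inverse (real (Suc m))) \<longlonglongrightarrow> - 0"
      by (intro tendsto_minus LIMSEQ_inverse_real_of_nat)
    moreover have "isCont (\<lambda>r. F r (covar z)) (- 0)"
      using elim(1) by (simp add: continuous_on_eq_continuous_at)
    ultimately have "(\<lambda>m. F (- inverse (real (Suc m))) (covar z)) \<longlonglongrightarrow> F (- 0) (covar z)"
      by (rule isCont_tendsto_compose[rotated])
    then have "F 0 (covar z) = 0" using elim(3) by (simp add: LIMSEQ_const_iff)
    then show ?case using elim by (auto simp: strict_mono_on_imp_mono_on)
  qed
qed

lemma AE_F_range: "AE z in P. \<forall>r\<in>{0..1}. F r (covar z) \<in> {0..1}"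
  using AE_regular
proof eventually_elim
  case (elim z)
  show ?case
  proof
    fix r :: real assume r: "r \<in> {0..1}"
    from elim have "mono_on {0..1} (\<lambda>r. F r (covar z))" by blast
    from mono_onD[OF this, of 0 r] mono_onD[OF this, of r 1] r elim
    show "F r (covar z) \<in> {0..1}" by simp
  qed
qed

lemma AE_U_range: "AE z in P. U z \<in> {0..1}"
  using AE_F_range range_R by eventually_elim (auto simp: cond_rank_def)

lemma integrable_U_power: "integrable P (\<lambda>z. U z ^ k)"
proof (rule integrable_const_bound[of _ 1])
  show "AE z in P. norm (U z ^ k) \<le> 1"
    using AE_U_range by eventually_elim (auto simp: power_abs intro!: power_le_one)
qed measurable

text \<open>The moments of the conditional rank are limits of Riemann sums: rounding \<open>R\<close> up to the grid
  \<open>{1/m, \<dots>, 1}\<close> makes the conditioning on the covariate elementary.\<close>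

lemma moment_U: "(\<integral>z. U z ^ k \<partial>P) = 1 / (real k + 1)"
proof -
  \<comment> \<open>For 0 < R z \<le> 1 and m > 0 exactly one bracket is 1, that of the left-open
    cell (j/m, (j+1)/m] containing \<open>R z\<close>, so \<open>S m z\<close> is the power of the
    rank at \<open>R z\<close> rounded up. \<open>T\<close> replaces the indicators by conditional
    probabilities.\<close>
  define S where "S m z = (\<Sum>j<m. F (Suc j / m) (covar z) ^ k *
    (indicator {z. R z \<le> Suc j / m} z - indicator {z. R z \<le> j / m} z))" for m z
  define T where "T m z = (\<Sum>j<m. F (Suc j / m) (covar z) ^ k *
    (F (Suc j / m) (covar z) - F (j / m) (covar z)))" for m z
  have Fk: "AE z in P. \<bar>F (Suc j / m) (covar z) ^ k\<bar> \<le> 1" if "j < m" for j m :: nat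
    using AE_F_range
  proof eventually_elim
    case (elim z)
    then have "F (Suc j / m) (covar z) \<in> {0..1}" using that by (intro elim[rule_format]) simp
    then show ?case by (auto simp: power_abs intro!: power_le_one)
  qed
  have ind: "integrable P (\<lambda>z. F (Suc j / m) (covar z) ^ k * indicator {z. R z \<le> q} z)" if "j < m" for j m :: nat and q
  proof (rule integrable_const_bound[of _ 1])
    show "AE z in P. norm (F (Suc j / m) (covar z) ^ k * indicator {z. R z \<le> q} z) \<le> 1"
      using Fk[OF that] by eventually_elim (auto simp: indicator_def)
  qed measurable
  \<comment> \<open>Each weight is a function of the covariate, so the tower property applies term
    by term.\<close>
  have ST: "(\<integral>z. S m z \<partial>P) = (\<integral>z. T m z \<partial>P)" for m
  proof -
    have h: "(\<lambda>x. F (Suc j / m) x ^ k) \<in> borel_measurable borel" for j by measurable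
    let ?F = "\<lambda>j z. F (real j / real m) (covar z)" and ?I = "\<lambda>j z. indicator {z. R z \<le> real j / real m} z :: real"
    have i1: "integrable P (\<lambda>z. ?F (Suc j) z ^ k * ?I l z)" if "j \<in> {..<m}" for j l
      using that by (intro ind) simp
    have i2: "integrable P (\<lambda>z. ?F (Suc j) z ^ k * ?F l z)"
      and e: "(\<integral>z. ?F (Suc j) z ^ k * ?I l z \<partial>P) = (\<integral>z. ?F (Suc j) z ^ k * ?F l z \<partial>P)" if "j \<in> {..<m}" for j l
      using that by (intro cond_exp_cdf[OF h Fk]; simp)+
    have "(\<integral>z. S m z \<partial>P) = (\<Sum>j<m. (\<integral>z. ?F (Suc j) z ^ k * ?I (Suc j) z \<partial>P) - (\<integral>z. ?F (Suc j) z ^ k * ?I j z \<partial>P))"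
      unfolding S_def right_diff_distrib
      by (subst Bochner_Integration.integral_sum[OF Bochner_Integration.integrable_diff[OF i1 i1]], assumption+)
        (rule sum.cong[OF refl Bochner_Integration.integral_diff[OF i1 i1]], assumption+)
    also have "\<dots> = (\<Sum>j<m. (\<integral>z. ?F (Suc j) z ^ k * ?F (Suc j) z \<partial>P) - (\<integral>z. ?F (Suc j) z ^ k * ?F j z \<partial>P))"
      by (intro sum.cong refl arg_cong2[where f = "(-)"] e)
    also have "\<dots> = (\<integral>z. T m z \<partial>P)"
      unfolding T_def right_diff_distrib
      by (subst Bochner_Integration.integral_sum[OF Bochner_Integration.integrable_diff[OF i2 i2]], assumption+)
        (rule sum.cong[OF refl Bochner_Integration.integral_diff[OF i2 i2, symmetric]], assumption+)
    finally show ?thesis .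
  qed
  \<comment> \<open>The value 0 lies in no left-open cell; it has probability 0 because F 0 = 0
    almost surely.\<close>
  have R_pos: "AE z in P. 0 < R z"
  proof -
    have "(\<integral>z. 1 * indicator {z. R z \<le> 0} z \<partial>P) = (\<integral>z. 1 * F 0 (covar z) \<partial>P)"
      by (rule cond_exp_cdf(2)[of "\<lambda>_. 1" 1]) auto
    also have "\<dots> = (\<integral>z. 0 \<partial>P)"
      using AE_regular by (intro integral_cong_AE) (auto elim!: eventually_mono)
    finally have "measure P {z. R z \<le> 0} = 0" by simp
    moreover have "{z. R z \<le> 0} \<in> sets P" by (simp add: sets_P)
    ultimately have "AE z in P. z \<notin> {z. R z \<le> 0}"
      by (simp add: prob_eq_0)
    then show ?thesis by (simp add: not_le)
  qed
  have Seq: "S m z = F (\<lceil>m * R z\<rceil> / m) (covar z) ^ k" if "0 < R z" "R z \<le> 1" "m > 0" for m z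
  proof -
    \<comment> \<open>The ceiling is the number of the right endpoint of the cell, one more than the
      index of the cell.\<close>
    define i where "i = nat \<lceil>m * R z\<rceil> - 1"
    have pos: "0 < m * R z" using that by simp
    then have c1: "1 \<le> \<lceil>m * R z\<rceil>" by (simp add: one_le_ceiling)
    have c2: "\<lceil>m * R z\<rceil> \<le> m" using that by (simp add: ceiling_le_iff)
    have i: "\<lceil>m * R z\<rceil> = int (Suc i)" "i < m" unfolding i_def using c1 c2 by linarith+
    have ind: "indicator {z. R z \<le> Suc j / m} z - indicator {z. R z \<le> j / m} z = (if j = i then 1 else (0::real))" for j
    proof -
      have le: "R z \<le> real l / m \<longleftrightarrow> Suc i \<le> l" for l
      proof -
        have "R z \<le> real l / m \<longleftrightarrow> m * R z \<le> of_int (int l)" using that(3) by (simp add: field_simps)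
        also have "\<dots> \<longleftrightarrow> \<lceil>m * R z\<rceil> \<le> int l" by (simp only: ceiling_le_iff)
        finally show ?thesis unfolding i(1) by (simp only: of_nat_le_iff)
      qed
      show ?thesis unfolding indicator_def mem_Collect_eq le by auto
    qed
    show ?thesis unfolding S_def ind using i by (simp add: if_distrib[of "(*) _"] cong: if_cong)
  qed
  have limS: "AE z in P. (\<lambda>m. S m z) \<longlonglongrightarrow> U z ^ k"
    using AE_regular R_pos range_R
  proof eventually_elim
    case (elim z)
    then have pos01: "0 < R z" "R z \<le> 1" by auto
    have "(\<lambda>m. \<lceil>real m * R z\<rceil> / real m) \<longlonglongrightarrow> R z"
    proof (rule tendsto_sandwich)
      show "\<forall>\<^sub>F m in sequentially. R z \<le> \<lceil>real m * R z\<rceil> / real m"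
        using eventually_gt_at_top[of 0] by eventually_elim (simp add: field_simps le_of_int_ceiling)
      show "\<forall>\<^sub>F m in sequentially. \<lceil>real m * R z\<rceil> / real m \<le> R z + 1 / real m"
        using eventually_gt_at_top[of 0]
      proof eventually_elim
        case (elim m)
        have "\<lceil>real m * R z\<rceil> \<le> real m * R z + 1" by (rule of_int_ceiling_le_add_one)
        then show ?case using elim by (simp add: field_simps)
      qed
      show "(\<lambda>m. R z + 1 / real m) \<longlonglongrightarrow> R z"
        using tendsto_add[OF tendsto_const lim_1_over_n, of "R z"] by simp
    qed simp
    moreover have "isCont (\<lambda>r. F r (covar z)) (R z)"
      using elim(1) by (simp add: continuous_on_eq_continuous_at)
    ultimately have "(\<lambda>m. F (\<lceil>real m * R z\<rceil> / real m) (covar z)) \<longlonglongrightarrow> F (R z) (covar z)"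
      by (rule isCont_tendsto_compose[rotated])
    then have "(\<lambda>m. F (\<lceil>real m * R z\<rceil> / real m) (covar z) ^ k) \<longlonglongrightarrow> U z ^ k"
      unfolding cond_rank_def by (rule tendsto_power)
    moreover have "\<forall>\<^sub>F m in sequentially. F (\<lceil>real m * R z\<rceil> / real m) (covar z) ^ k = S m z"
      using eventually_gt_at_top[of 0]
    proof eventually_elim
      case (elim m)
      show ?case by (rule Seq[symmetric]) (use elim pos01 in auto)
    qed
    ultimately show ?case
      by (rule Lim_transform_eventually)
  qed
  have [measurable]: "S m \<in> borel_measurable P" "T m \<in> borel_measurable P" for m
    unfolding S_def T_def by measurable
  have "(\<lambda>m. \<integral>z. S m z \<partial>P) \<longlonglongrightarrow> (\<integral>z. U z ^ k \<partial>P)"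
  proof (rule integral_dominated_convergence[where w = "\<lambda>_. 1"])
    fix m
    show "AE z in P. norm (S m z) \<le> 1"
      using AE_F_range R_pos range_R
    proof eventually_elim
      case (elim z)
      show ?case
      proof (cases "m = 0")
        case False
        then have "0 < \<lceil>real m * R z\<rceil>" "\<lceil>real m * R z\<rceil> \<le> m" using elim by (simp_all add: ceiling_le_iff)
        then have "\<lceil>real m * R z\<rceil> / real m \<in> {0..1}" using False by simp
        then have "F (\<lceil>real m * R z\<rceil> / real m) (covar z) \<in> {0..1}" using elim(1) by blast
        moreover have "S m z = F (\<lceil>real m * R z\<rceil> / real m) (covar z) ^ k"
          using elim False by (intro Seq) auto
        ultimately show ?thesis by (simp add: power_abs power_le_one)
      qed (simp add: S_def)
    qed
  qed (use limS in auto)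
  moreover have "(\<lambda>m. \<integral>z. T m z \<partial>P) \<longlonglongrightarrow> (\<integral>z. 1 / (real k + 1) \<partial>P)"
  proof (rule integral_dominated_convergence[where w = "\<lambda>_. 1"])
    show "AE z in P. (\<lambda>m. T m z) \<longlonglongrightarrow> 1 / (real k + 1)"
      using AE_regular
    proof eventually_elim
      case (elim z)
      show ?case
        unfolding T_def
        by (rule Riemann_sum_power_tendsto[where G = "\<lambda>r. F r (covar z)"])
          (use elim in \<open>auto intro: continuous_on_subset\<close>)
    qed
    fix m
    show "AE z in P. norm (T m z) \<le> 1"
      using AE_regular AE_F_range
    proof eventually_elim
      case (elim z)
      define g where "g j = F (real j / real m) (covar z)" for j :: nat
      have g: "g j \<le> g (Suc j)" "0 \<le> g (Suc j)" "g (Suc j) \<le> 1" if "j < m" for j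
        using elim that mono_onD[of "{0..1}" "\<lambda>r. F r (covar z)" "j / m" "Suc j / m"]
        by (auto simp: g_def divide_right_mono)
      have "T m z = (\<Sum>j<m. g (Suc j) ^ k * (g (Suc j) - g j))" by (simp add: T_def g_def)
      moreover have "0 \<le> (\<Sum>j<m. g (Suc j) ^ k * (g (Suc j) - g j))"
        using g by (intro sum_nonneg mult_nonneg_nonneg) auto
      moreover have "(\<Sum>j<m. g (Suc j) ^ k * (g (Suc j) - g j)) \<le> (\<Sum>j<m. 1 * (g (Suc j) - g j))"
        using g by (intro sum_mono mult_right_mono) (auto intro: power_le_one)
      moreover have "(\<Sum>j<m. 1 * (g (Suc j) - g j)) = g m - g 0"
        by (simp add: sum_lessThan_telescope)
      moreover have "g m - g 0 \<le> 1" using elim(1) by (cases "m = 0") (simp_all add: g_def)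
      ultimately show ?case by simp
    qed
  qed auto
  then have "(\<lambda>m. \<integral>z. S m z \<partial>P) \<longlonglongrightarrow> 1 / (real k + 1)"
    by (simp add: ST prob_space)
  ultimately show ?thesis
    by (rule LIMSEQ_unique)
qed

lemma mean_U: "(\<integral>z. U z \<partial>P) = 1/2"
  using moment_U[of 1] by simp

lemma variance_U: "(\<integral>z. (U z - 1/2)\<^sup>2 \<partial>P) = 1/12"
proof -
  have "(\<integral>z. (U z - 1/2)\<^sup>2 \<partial>P) = (\<integral>z. U z ^ 2 - U z + 1/4 \<partial>P)"
    by (intro Bochner_Integration.integral_cong) (auto simp: power2_eq_square algebra_simps)
  also have "\<dots> = (\<integral>z. U z ^ 2 \<partial>P) - (\<integral>z. U z \<partial>P) + 1/4"
    using integrable_U_power[of 2] integrable_U_power[of 1] by (simp add: prob_space)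
  also have "\<dots> = 1/12"
    using moment_U[of 2] mean_U by simp
  finally show ?thesis .
qed

end

section \<open>Kernels with conditional mean zero\<close>

text \<open>Jensen's inequality for the square, read off from the nonnegativity of the variance; it
  is trivial when the second moment is infinite.\<close>

lemma (in prob_space) square_integral_le_nn_integral:
  fixes g :: "'a \<Rightarrow> real"
  assumes g: "integrable M g"
  shows "ennreal ((\<integral>x. g x \<partial>M)\<^sup>2) \<le> (\<integral>\<^sup>+x. ennreal ((g x)\<^sup>2) \<partial>M)"
proof (cases "(\<integral>\<^sup>+x. ennreal ((g x)\<^sup>2) \<partial>M) = \<infinity>")
  case False
  have [measurable]: "g \<in> borel_measurable M" using g by auto
  have g2: "integrable M (\<lambda>x. (g x)\<^sup>2)"
    using False by (intro integrableI_nonneg) (auto simp: less_top[symmetric])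
  have "0 \<le> variance g" by (rule variance_positive)
  then have "(\<integral>x. g x \<partial>M)\<^sup>2 \<le> (\<integral>x. (g x)\<^sup>2 \<partial>M)"
    using variance_eq[OF g g2] by simp
  then show ?thesis
    using g2 by (subst nn_integral_eq_integral) (auto intro!: ennreal_leI)
qed simp

lemma (in prob_space) integrable_of_square:
  fixes g :: "'a \<Rightarrow> real"
  assumes [measurable]: "g \<in> borel_measurable M" and fin: "(\<integral>\<^sup>+x. ennreal ((g x)\<^sup>2) \<partial>M) < \<infinity>"
  shows "integrable M g" "integrable M (\<lambda>x. (g x)\<^sup>2)"
proof -
  show g2: "integrable M (\<lambda>x. (g x)\<^sup>2)"
    using fin by (intro integrableI_nonneg) auto
  show "integrable M g"
    by (rule square_integrable_imp_integrable[OF _ g2]) measurable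
qed

text \<open>The first argument of \<open>f\<close> is the observation whose rank is evaluated, the
  second a training observation. Centring is required in the training argument only, and the bound
  \<open>C\<close> on the conditional second moment is uniform in the first argument.\<close>

locale centered_kernel = prob_space P for P :: "'z measure" +
  fixes f :: "'z \<Rightarrow> 'z \<Rightarrow> real" and C :: real
  assumes measurable_f [measurable]: "(\<lambda>(z, w). f z w) \<in> borel_measurable (P \<Otimes>\<^sub>M P)"
    and second_moment: "AE z in P. (\<integral>\<^sup>+w. ennreal ((f z w)\<^sup>2) \<partial>P) \<le> ennreal C"
    and centered: "AE z in P. (\<integral>w. f z w \<partial>P) = 0"
begin

sublocale PP: pair_prob_space P P ..

lemma AE_second_moment: "AE z in P. integrable P (f z) \<and> (\<integral>w. f z w \<partial>P) = 0"
  using second_moment centered AE_space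
proof eventually_elim
  case (elim z)
  have [measurable]: "z \<in> space P" by fact
  have "(\<integral>\<^sup>+w. ennreal ((f z w)\<^sup>2) \<partial>P) < \<infinity>"
    using elim(1) by (rule le_less_trans) simp
  then have "integrable P (f z)" by (intro integrable_of_square) measurable
  then show ?case using elim by simp
qed

lemma second_moment_pair: "(\<integral>\<^sup>+z. \<integral>\<^sup>+w. ennreal ((f z w)\<^sup>2) \<partial>P \<partial>P) \<le> ennreal C"
proof -
  have "(\<integral>\<^sup>+z. \<integral>\<^sup>+w. ennreal ((f z w)\<^sup>2) \<partial>P \<partial>P) \<le> (\<integral>\<^sup>+z. ennreal C \<partial>P)"
    by (rule nn_integral_mono_AE[OF second_moment])
  then show ?thesis by (simp add: emeasure_space_1)
qed

lemma integrable_pair: "integrable (P \<Otimes>\<^sub>M P) (\<lambda>(z, w). f z w)"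
proof -
  have "(\<integral>\<^sup>+p. ennreal ((case p of (z, w) \<Rightarrow> f z w)\<^sup>2) \<partial>(P \<Otimes>\<^sub>M P)) = (\<integral>\<^sup>+z. \<integral>\<^sup>+w. ennreal ((f z w)\<^sup>2) \<partial>P \<partial>P)"
    by (subst nn_integral_fst[symmetric]) auto
  also have "\<dots> < \<infinity>" using second_moment_pair by (rule le_less_trans) simp
  finally show ?thesis by (intro PP.integrable_of_square) measurable
qed

text \<open>The Hoeffding projection on the training argument; the projection on the other argument
  is 0 by \<open>centered\<close>.\<close>

definition proj :: "'z \<Rightarrow> real" where
  "proj w = (\<integral>z. f z w \<partial>P)"

lemma measurable_proj [measurable]: "proj \<in> borel_measurable P"
  unfolding proj_def[abs_def] by measurable

lemma AE_integrable_fst: "AE w in P. integrable P (\<lambda>z. f z w)"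
  using PP.AE_integrable_snd[OF integrable_pair] .

lemma integrable_proj: "integrable P proj"
  unfolding proj_def[abs_def] using PP.integrable_snd[OF integrable_pair] .

lemma integral_proj: "(\<integral>w. proj w \<partial>P) = 0"
proof -
  have "(\<integral>w. proj w \<partial>P) = (\<integral>z. \<integral>w. f z w \<partial>P \<partial>P)"
    unfolding proj_def using PP.Fubini_integral[OF integrable_pair] .
  also have "\<dots> = (\<integral>z. 0 \<partial>P)"
    using centered by (intro integral_cong_AE) auto
  finally show ?thesis by simp
qed

lemma second_moment_proj: "(\<integral>\<^sup>+w. ennreal ((proj w)\<^sup>2) \<partial>P) \<le> ennreal C"
proof -
  have "(\<integral>\<^sup>+w. ennreal ((proj w)\<^sup>2) \<partial>P) \<le> (\<integral>\<^sup>+w. \<integral>\<^sup>+z. ennreal ((f z w)\<^sup>2) \<partial>P \<partial>P)"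
    using AE_integrable_fst
    by (intro nn_integral_mono_AE) (auto simp: proj_def intro: square_integral_le_nn_integral)
  also have "\<dots> = (\<integral>\<^sup>+z. \<integral>\<^sup>+w. ennreal ((f z w)\<^sup>2) \<partial>P \<partial>P)"
    by (intro PP.Fubini') measurable
  also have "\<dots> \<le> ennreal C" by (rule second_moment_pair)
  finally show ?thesis .
qed

lemma integrable_proj_square: "integrable P (\<lambda>w. (proj w)\<^sup>2)"
  using second_moment_proj by (intro integrable_of_square) (auto intro: le_less_trans)

text \<open>The doubly degenerate part of the Hoeffding decomposition: subtracting
  \<open>proj\<close> centres the first argument, and centring in the second survives because
  \<open>proj\<close> itself has mean zero.\<close>

definition rest :: "'z \<Rightarrow> 'z \<Rightarrow> real" where
  "rest z w = f z w - proj w"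

lemma measurable_rest [measurable]: "(\<lambda>(z, w). rest z w) \<in> borel_measurable (P \<Otimes>\<^sub>M P)"
  unfolding rest_def by measurable

lemma AE_rest: "AE z in P. integrable P (rest z) \<and> (\<integral>w. rest z w \<partial>P) = 0"
  using AE_second_moment
  by eventually_elim (auto simp: rest_def[abs_def] integrable_proj integral_proj)

lemma AE_rest_fst: "AE w in P. integrable P (\<lambda>z. rest z w) \<and> (\<integral>z. rest z w \<partial>P) = 0"
  using AE_integrable_fst
proof eventually_elim
  case (elim w)
  then have "(\<integral>z. rest z w \<partial>P) = (\<integral>z. f z w \<partial>P) - proj w"
    unfolding rest_def by (subst Bochner_Integration.integral_diff) (auto simp: prob_space)
  then show ?case using elim by (simp add: rest_def proj_def)
qed

lemma second_moment_rest:
  assumes "0 \<le> C"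
  shows "(\<integral>\<^sup>+z. \<integral>\<^sup>+w. ennreal ((rest z w)\<^sup>2) \<partial>P \<partial>P) \<le> ennreal (4 * C)"
proof -
  have [measurable]: "(\<lambda>w. f z w) \<in> borel_measurable P" if "z \<in> space P" for z
    using that by measurable
  have "(\<integral>\<^sup>+z. \<integral>\<^sup>+w. ennreal ((rest z w)\<^sup>2) \<partial>P \<partial>P)
      \<le> (\<integral>\<^sup>+z. \<integral>\<^sup>+w. 2 * ennreal ((f z w)\<^sup>2) + 2 * ennreal ((proj w)\<^sup>2) \<partial>P \<partial>P)"
  proof (intro nn_integral_mono)
    fix z w
    have "(rest z w)\<^sup>2 \<le> 2 * (f z w)\<^sup>2 + 2 * (proj w)\<^sup>2"
      using sum_squares_bound[of "f z w" "- proj w"] by (simp add: rest_def power2_diff)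
    then have "ennreal ((rest z w)\<^sup>2) \<le> ennreal (2 * (f z w)\<^sup>2 + 2 * (proj w)\<^sup>2)" by (rule ennreal_leI)
    then show "ennreal ((rest z w)\<^sup>2) \<le> 2 * ennreal ((f z w)\<^sup>2) + 2 * ennreal ((proj w)\<^sup>2)"
      by (simp add: ennreal_plus ennreal_mult)
  qed
  also have "\<dots> = (\<integral>\<^sup>+z. 2 * (\<integral>\<^sup>+w. ennreal ((f z w)\<^sup>2) \<partial>P) + 2 * (\<integral>\<^sup>+w. ennreal ((proj w)\<^sup>2) \<partial>P) \<partial>P)"
    by (intro nn_integral_cong) (simp add: nn_integral_add nn_integral_cmult)
  also have "\<dots> = 2 * (\<integral>\<^sup>+z. \<integral>\<^sup>+w. ennreal ((f z w)\<^sup>2) \<partial>P \<partial>P) + 2 * (\<integral>\<^sup>+w. ennreal ((proj w)\<^sup>2) \<partial>P)"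
    by (simp add: nn_integral_add nn_integral_cmult emeasure_space_1)
  also have "\<dots> \<le> 2 * ennreal C + 2 * ennreal C"
    by (intro add_mono mult_left_mono second_moment_pair second_moment_proj) auto
  also have "\<dots> = ennreal (4 * C)"
    using assms by (simp add: ennreal_mult flip: distrib_right)
  finally show ?thesis .
qed

text \<open>In \<open>copy_cond_exp\<close> the pair is (Z, Z') and the kernel is evaluated as f Z'
  Z, so conditioning on the first coordinate freezes the second argument of \<open>f\<close>. The
  events of the conditioning algebra are cylinders over sets \<open>B\<close>, and on these Fubini
  gives the defining property of a conditional expectation.\<close>

lemma copy_cond_exp_eq_proj:
  assumes "copy_cond_exp P f \<gamma>"
  shows "AE w in P. \<gamma> w = proj w"
proof -
  define G where "G = vimage_algebra (space (P \<Otimes>\<^sub>M P)) fst P"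
  have sub: "finite_measure_subalgebra (P \<Otimes>\<^sub>M P) G"
  proof
    show "subalgebra (P \<Otimes>\<^sub>M P) G"
    proof -
      have "fst \<in> space (P \<Otimes>\<^sub>M P) \<rightarrow> space P" by (auto simp: space_pair_measure)
      from sets_vimage_algebra2[OF this] have "sets G \<subseteq> sets (P \<Otimes>\<^sub>M P)"
        unfolding G_def by (auto intro: measurable_sets[OF measurable_fst])
      then show ?thesis by (simp add: subalgebra_def G_def)
    qed
  qed
  interpret S: finite_measure_subalgebra "P \<Otimes>\<^sub>M P" G by (rule sub)
  have swap: "integrable (P \<Otimes>\<^sub>M P) (\<lambda>(w, z). f z w)"
    using PP.integrable_product_swap[OF integrable_pair] by (simp add: split_def)
  have fstG: "fst \<in> measurable G P"
    unfolding G_def by (rule measurable_vimage_algebra1) (auto simp: space_pair_measure)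
  have intp: "integrable (P \<Otimes>\<^sub>M P) (\<lambda>p. proj (fst p))"
    by (rule integrable_distr[OF measurable_fst]) (simp only: distr_pair_fst integrable_proj)
  have "AE p in P \<Otimes>\<^sub>M P. real_cond_exp (P \<Otimes>\<^sub>M P) G (\<lambda>(w, z). f z w) p = proj (fst p)"
  proof (rule S.real_cond_exp_charact)
    fix A assume "A \<in> sets G"
    then obtain B where B: "B \<in> sets P" "A = fst -` B \<inter> space (P \<Otimes>\<^sub>M P)"
      unfolding G_def by (subst (asm) sets_vimage_algebra2) (auto simp: space_pair_measure)
    have ind: "indicator A p = (indicator B (fst p) :: real)" if "p \<in> space (P \<Otimes>\<^sub>M P)" for p
      using that B(2) by (auto simp: indicator_def)
    have [measurable]: "B \<in> sets P" by fact
    have i1: "integrable (P \<Otimes>\<^sub>M P) (\<lambda>(w, z). indicator B w * f z w)"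
      by (rule Bochner_Integration.integrable_bound[OF swap]) (auto simp: indicator_def)
    have i2: "integrable (P \<Otimes>\<^sub>M P) (\<lambda>(w, z). indicator B w * proj w)"
      by (rule Bochner_Integration.integrable_bound[OF intp]) (auto simp: indicator_def)
    have "(\<integral>p\<in>A. (case p of (w, z) \<Rightarrow> f z w) \<partial>(P \<Otimes>\<^sub>M P)) = (\<integral>p. (case p of (w, z) \<Rightarrow> indicator B w * f z w) \<partial>(P \<Otimes>\<^sub>M P))"
      unfolding set_lebesgue_integral_def by (intro Bochner_Integration.integral_cong) (auto simp: ind)
    also have "\<dots> = (\<integral>w. \<integral>z. indicator B w * f z w \<partial>P \<partial>P)"
      using PP.integral_fst[OF i1] by simp
    also have "\<dots> = (\<integral>w. \<integral>z. indicator B w * proj w \<partial>P \<partial>P)"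
      by (simp add: proj_def prob_space)
    also have "\<dots> = (\<integral>p. (case p of (w, z) \<Rightarrow> indicator B w * proj w) \<partial>(P \<Otimes>\<^sub>M P))"
      using PP.integral_fst[OF i2] by simp
    also have "\<dots> = (\<integral>p\<in>A. proj (fst p) \<partial>(P \<Otimes>\<^sub>M P))"
      unfolding set_lebesgue_integral_def by (intro Bochner_Integration.integral_cong) (auto simp: ind)
    finally show "(\<integral>p\<in>A. (case p of (w, z) \<Rightarrow> f z w) \<partial>(P \<Otimes>\<^sub>M P)) = (\<integral>p\<in>A. proj (fst p) \<partial>(P \<Otimes>\<^sub>M P))" .
  next
    show "integrable (P \<Otimes>\<^sub>M P) (\<lambda>p. proj (fst p))" by (rule intp)
    show "(\<lambda>p. proj (fst p)) \<in> borel_measurable G"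
      by (rule measurable_compose[OF fstG]) measurable
  qed (rule swap)
  moreover have "AE p in P \<Otimes>\<^sub>M P. \<gamma> (fst p) = real_cond_exp (P \<Otimes>\<^sub>M P) G (\<lambda>(w, z). f z w) p"
    using assms unfolding copy_cond_exp_def G_def by auto
  ultimately have "AE p in P \<Otimes>\<^sub>M P. \<gamma> (fst p) = proj (fst p)"
    by eventually_elim simp
  then have "AE w in P. AE z in P. \<gamma> w = proj w"
    using PP.AE_pair[of "\<lambda>p. \<gamma> (fst p) = proj (fst p)"] by simp
  then show ?thesis by simp
qed

end

section \<open>Out-of-fold ranks\<close>

locale cross_fitted_rank = cross_fitting M P Z K \<kappa> + rank: conditional_rank P R F f
  for M :: "'a measure" and P :: "'p::finite obs measure" and Z K \<kappa> R F f +
  fixes \<X> :: "(real ^ 'p) set" and est :: "'p est_rule" and \<phi> :: "real \<Rightarrow> real ^ 'p \<Rightarrow> 'p obs \<Rightarrow> real"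
  assumes range_covar: "AE z in P. covar z \<in> \<X>"
    and kernel: "expansion_kernel P \<X> \<phi>"
    and expansion: "linear_expansion M \<X> est F \<phi> Z K \<kappa>"
begin

section \<open>Errors of the out-of-fold ranks and their linear part\<close>

definition err :: "nat \<Rightarrow> 'a \<Rightarrow> nat \<Rightarrow> real" where
  "err n \<omega> i = oof_rank R est Z \<kappa> n \<omega> i - rank.U (Z i \<omega>)"

definition infl :: "'p obs \<Rightarrow> 'p obs \<Rightarrow> real" where
  "infl z w = \<phi> (R z) (covar z) w"

text \<open>The leading term of \<open>err\<close>: the hypothesized expansion divided by the root
  of the training size. Assignment and data are plain arguments, as decoupling demands.\<close>

definition lin_err :: "nat \<Rightarrow> (nat \<Rightarrow> nat) \<Rightarrow> (nat \<Rightarrow> 'p obs) \<Rightarrow> nat \<Rightarrow> real" where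
  "lin_err n c w i = (1 / card (train_of n (c i) c)) * (\<Sum>j\<in>train_of n (c i) c. infl (w i) (w j))"

abbreviation "lin_err_at n \<omega> \<equiv> lin_err n (folds_of n \<omega>) (sample \<omega>)"

lemma measurable_infl [measurable]: "(\<lambda>(z, w). infl z w) \<in> borel_measurable (P \<Otimes>\<^sub>M P)"
proof -
  have 1: "(\<lambda>p. (R (fst p), covar (fst p), snd p)) \<in> measurable (P \<Otimes>\<^sub>M P) (borel \<Otimes>\<^sub>M (borel \<Otimes>\<^sub>M borel))"
    by measurable
  have 2: "(\<lambda>(r, x, z). \<phi> r x z) \<in> borel_measurable (borel \<Otimes>\<^sub>M (borel \<Otimes>\<^sub>M borel))"
    using kernel unfolding expansion_kernel_def borel_prod by simp
  from measurable_compose[OF 1 2] show ?thesis by (simp add: infl_def split_def)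
qed

definition moment_bound :: "real \<Rightarrow> bool" where
  "moment_bound C \<longleftrightarrow> 0 \<le> C \<and>
     (\<forall>r\<in>{0..1}. \<forall>x\<in>\<X>. (\<integral>\<^sup>+z. ennreal ((\<phi> r x z)\<^sup>2) \<partial>P) \<le> ennreal C)"

lemma moment_bound_nonneg: "moment_bound C \<Longrightarrow> 0 \<le> C"
  by (simp add: moment_bound_def)

text \<open>By t^2 \<le> 1 + |t|^(2 + \<delta>), the constant 1 + E sup |\<phi>|^(2 + \<delta>)
  bounds all pointwise second moments at once.\<close>

lemma moment_bound_exists:
  obtains C where "moment_bound C"
proof -
  obtain \<delta> where \<delta>: "\<delta> > 0"
    "(\<integral>\<^sup>+z. (SUP (r, x) \<in> {0..1} \<times> \<X>. ennreal (\<bar>\<phi> r x z\<bar> powr (2 + \<delta>))) \<partial>P) < \<infinity>"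
    using kernel unfolding expansion_kernel_def by blast
  define S where "S = (\<integral>\<^sup>+z. (SUP (r, x) \<in> {0..1} \<times> \<X>. ennreal (\<bar>\<phi> r x z\<bar> powr (2 + \<delta>))) \<partial>P)"
  have S: "S < \<infinity>" using \<delta>(2) by (simp add: S_def)
  show thesis
  proof (rule that, unfold moment_bound_def, intro conjI ballI)
    show "0 \<le> 1 + enn2real S" by simp
    fix r :: real and x :: "real ^ 'p" assume rx: "r \<in> {0..1}" "x \<in> \<X>"
    have sq: "t\<^sup>2 \<le> 1 + \<bar>t\<bar> powr (2 + \<delta>)" for t :: real
    proof (cases "\<bar>t\<bar> \<le> 1")
      case True
      then have "t\<^sup>2 \<le> 1" by (simp add: abs_square_le_1)
      then show ?thesis using powr_ge_zero[of "\<bar>t\<bar>" "2 + \<delta>"] by linarith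
    next
      case False
      then have "\<bar>t\<bar> powr 2 \<le> \<bar>t\<bar> powr (2 + \<delta>)" using \<delta>(1) by (intro powr_mono) auto
      then show ?thesis using False by (simp add: powr_numeral)
    qed
    have "(\<lambda>(r, x, z). \<phi> r x z) \<in> borel_measurable (borel \<Otimes>\<^sub>M (borel \<Otimes>\<^sub>M borel))"
      using kernel unfolding expansion_kernel_def borel_prod by simp
    from measurable_compose[OF _ this, of "\<lambda>z. (r, x, z)" P]
    have [measurable]: "\<phi> r x \<in> borel_measurable P" by simp
    have "(\<integral>\<^sup>+z. ennreal ((\<phi> r x z)\<^sup>2) \<partial>P) \<le> (\<integral>\<^sup>+z. 1 + ennreal (\<bar>\<phi> r x z\<bar> powr (2 + \<delta>)) \<partial>P)"
    proof (rule nn_integral_mono)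
      fix z
      have "ennreal ((\<phi> r x z)\<^sup>2) \<le> ennreal (1 + \<bar>\<phi> r x z\<bar> powr (2 + \<delta>))" by (rule ennreal_leI[OF sq])
      then show "ennreal ((\<phi> r x z)\<^sup>2) \<le> 1 + ennreal (\<bar>\<phi> r x z\<bar> powr (2 + \<delta>))" by (simp add: ennreal_plus)
    qed
    also have "\<dots> = 1 + (\<integral>\<^sup>+z. ennreal (\<bar>\<phi> r x z\<bar> powr (2 + \<delta>)) \<partial>P)"
      by (subst nn_integral_add) (auto simp: P.emeasure_space_1)
    \<comment> \<open>The supremum may fail to be measurable; only monotonicity of the nonnegative
      integral is used here.\<close>
    also have "(\<integral>\<^sup>+z. ennreal (\<bar>\<phi> r x z\<bar> powr (2 + \<delta>)) \<partial>P) \<le> S"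
      unfolding S_def using rx by (intro nn_integral_mono SUP_upper2[of "(r, x)"]) auto
    also have "1 + S = ennreal (1 + enn2real S)"
      using S by (simp add: ennreal_plus)
    finally show "(\<integral>\<^sup>+z. ennreal ((\<phi> r x z)\<^sup>2) \<partial>P) \<le> ennreal (1 + enn2real S)" by simp
  qed
qed

lemma AE_range: "AE z in P. R z \<in> {0..1} \<and> covar z \<in> \<X>"
  using rank.range_R range_covar by eventually_elim simp

text \<open>The weight \<open>g\<close> will be 1 for the plain error and a centred rank for the
  weighted sums. Being bounded by 1, it preserves the constant \<open>C\<close>.\<close>

lemma centered_kernelI:
  assumes [measurable]: "g \<in> borel_measurable P" and g: "AE z in P. \<bar>g z\<bar> \<le> 1"
    and C: "moment_bound C"
  shows "centered_kernel P (\<lambda>z w. g z * infl z w) C"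
proof
  show "(\<lambda>(z, w). g z * infl z w) \<in> borel_measurable (P \<Otimes>\<^sub>M P)" by measurable
  show "AE z in P. (\<integral>\<^sup>+w. ennreal ((g z * infl z w)\<^sup>2) \<partial>P) \<le> ennreal C"
    using AE_range g
  proof eventually_elim
    case (elim z)
    have "(\<integral>\<^sup>+w. ennreal ((g z * infl z w)\<^sup>2) \<partial>P) \<le> (\<integral>\<^sup>+w. ennreal ((infl z w)\<^sup>2) \<partial>P)"
    proof (intro nn_integral_mono ennreal_leI)
      fix w
      have "(g z)\<^sup>2 \<le> 1" using elim(2) by (simp add: abs_square_le_1)
      then have "(g z)\<^sup>2 * (infl z w)\<^sup>2 \<le> 1 * (infl z w)\<^sup>2" by (intro mult_right_mono) auto
      then show "(g z * infl z w)\<^sup>2 \<le> (infl z w)\<^sup>2" by (simp add: power_mult_distrib)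
    qed
    also have "\<dots> \<le> ennreal C" using elim(1) C by (auto simp: moment_bound_def infl_def)
    finally show ?case .
  qed
  show "AE z in P. (\<integral>w. g z * infl z w \<partial>P) = 0"
    using AE_range
  proof eventually_elim
    case (elim z)
    then have "(\<integral>w. infl z w \<partial>P) = 0"
      using kernel unfolding expansion_kernel_def infl_def by blast
    then show ?case by simp
  qed
qed

lemma measurable_pair_component:
  assumes h: "(\<lambda>(z, w). h z w) \<in> borel_measurable (P \<Otimes>\<^sub>M P)" and "i < n" "j < n"
  shows "(\<lambda>w. h (w i) (w j)) \<in> borel_measurable (PiM {..<n} (\<lambda>_. borel))"
proof -
  have "(\<lambda>w. (w i, w j)) \<in> measurable (PiM {..<n} (\<lambda>_. borel)) (P \<Otimes>\<^sub>M P)"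
    using assms(2,3) by (intro measurable_Pair) (simp_all add: measurable_cong_sets[OF refl sets_P])
  from measurable_compose[OF this h] show ?thesis by simp
qed

lemma train_of_D: "j \<in> train_of n k c \<Longrightarrow> j < n" and fold_of_D: "j \<in> fold_of n k c \<Longrightarrow> j < n"
  by (auto simp: train_of_def fold_of_def)

lemma lin_err_restrict:
  "i < n \<Longrightarrow> lin_err n (restrict c {..<n}) (restrict w {..<n}) i = lin_err n c w i"
  unfolding lin_err_def by (auto intro!: arg_cong2[where f="(*)"] sum.cong dest: train_of_D)

text \<open>One sequence \<open>rem\<close> controls the linearization error of all observations at
  once, since the uniform expansion is evaluated at each (R_i, X_i). The set \<open>negl n\<close>
  collects data outside [0,1] x \<open>\<X>\<close>, unbalanced assignments, and the event that a
  truncation below might be active.\<close>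

lemma remainder:
  obtains rem negl where "o_p M rem" "\<And>n. negl n \<subseteq> space M" "(\<lambda>n. outer_measure_of M (negl n)) \<longlonglongrightarrow> 0"
    "\<And>n \<omega>. \<omega> \<in> space M - negl n \<Longrightarrow> balanced n (folds_of n \<omega>)"
    "\<And>n \<omega> i. \<omega> \<in> space M - negl n \<Longrightarrow> i < n \<Longrightarrow> n > 0 \<Longrightarrow>
       \<bar>err n \<omega> i - lin_err_at n \<omega> i\<bar> \<le> 2 * \<bar>rem n \<omega>\<bar> / sqrt n"
proof -
  define D where "D k n \<omega> = (let S = train_set \<kappa> n k \<omega> in
        SUP (r, x) \<in> {0..1} \<times> \<X>. ennreal
          \<bar>sqrt (card S) * (oof_cdf est Z \<kappa> n k \<omega> r x - F r x)
             - (1 / sqrt (card S)) * (\<Sum>j\<in>S. \<phi> r x (Z j \<omega>))\<bar>)" for k n \<omega>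
  \<comment> \<open>The supremum \<open>D\<close> may be infinite, so it is cut at 1 before it is
    turned into a real number.\<close>
  define q where "q k n \<omega> = enn2real (min 1 (D k n \<omega>))" for k n \<omega>
  have q0: "0 \<le> q k n \<omega>" for k n \<omega> by (simp add: q_def)
  have fin: "min 1 (D k n \<omega>) < \<infinity>" for k n \<omega>
    by (rule le_less_trans[of _ 1]) auto
  have qD: "ennreal (q k n \<omega>) = min 1 (D k n \<omega>)" for k n \<omega>
    unfolding q_def using fin by (intro ennreal_enn2real) simp
  have conv_D: "conv_prob_zero M (\<lambda>n \<omega>. D k n \<omega>)" if "k < K" for k
    using expansion[unfolded linear_expansion_def, rule_format, OF that] unfolding D_def .
  have o_p_q: "o_p M (q k)" if "k < K" for k
    unfolding o_p_def conv_prob_zero_def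
  proof (intro allI impI)
    fix \<epsilon> :: real assume e: "\<epsilon> > 0"
    have conv: "(\<lambda>n. outer_measure_of M {\<omega> \<in> space M. ennreal \<epsilon> < D k n \<omega>}) \<longlonglongrightarrow> 0"
      using conv_D[OF that, unfolded conv_prob_zero_def, rule_format, OF e] .
    show "(\<lambda>n. outer_measure_of M {\<omega> \<in> space M. ennreal \<epsilon> < ennreal \<bar>q k n \<omega>\<bar>}) \<longlonglongrightarrow> 0"
    proof (rule tendsto_sandwich[OF _ _ tendsto_const conv])
      have "ennreal \<bar>q k n \<omega>\<bar> \<le> D k n \<omega>" for n \<omega>
        unfolding abs_of_nonneg[OF q0] qD by (rule min.cobounded2)
      then have "{\<omega> \<in> space M. ennreal \<epsilon> < ennreal \<bar>q k n \<omega>\<bar>} \<subseteq> {\<omega> \<in> space M. ennreal \<epsilon> < D k n \<omega>}" for n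
        by (blast intro: less_le_trans)
      then show "\<forall>\<^sub>F n in sequentially. outer_measure_of M {\<omega> \<in> space M. ennreal \<epsilon> < ennreal \<bar>q k n \<omega>\<bar>}
          \<le> outer_measure_of M {\<omega> \<in> space M. ennreal \<epsilon> < D k n \<omega>}"
        by (intro always_eventually allI outer_measure_of_mono)
    qed simp
  qed
  define rem where "rem n \<omega> = (\<Sum>k<K. q k n \<omega>)" for n \<omega>
  have o_p_rem: "o_p M rem" unfolding rem_def using o_p_q by (intro o_p_sum) auto
  have rem0: "0 \<le> rem n \<omega>" for n \<omega> unfolding rem_def using q0 by (intro sum_nonneg) auto
  define good where "good \<omega> \<longleftrightarrow> (\<forall>i. R (Z i \<omega>) \<in> {0..1} \<and> covar (Z i \<omega>) \<in> \<X>)" for \<omega>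
  have good: "AE \<omega> in M. \<not> \<not> good \<omega>"
    using AE_Z[OF AE_range] by (simp add: good_def AE_all_countable)
  \<comment> \<open>Any threshold below 1 serves: where \<open>rem\<close> is at most 1/2, no
    truncation is active and \<open>q\<close> equals \<open>D\<close>.\<close>
  define negl1 where "negl1 n = {\<omega> \<in> space M. 1/2 < \<bar>rem n \<omega>\<bar>}" for n
  define negl2 where "negl2 n = {\<omega> \<in> space M. \<not> good \<omega>} \<union> unbalanced_event n" for n
  define negl where "negl n = negl1 n \<union> negl2 n" for n
  have sub: "negl1 n \<subseteq> space M" "negl2 n \<subseteq> space M" for n
    using unbalanced_event_subset by (auto simp: negl1_def negl2_def)
  have "{\<omega> \<in> space M. ennreal (1/2) < ennreal \<bar>rem n \<omega>\<bar>} = negl1 n" for n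
    unfolding negl1_def by (subst ennreal_less_iff) simp_all
  then have lim1: "(\<lambda>n. outer_measure_of M (negl1 n)) \<longlonglongrightarrow> 0"
    using o_p_rem[unfolded o_p_def conv_prob_zero_def, rule_format, of "1/2"] by (simp only: half_gt_zero_iff zero_less_one)
  have lim2: "(\<lambda>n. outer_measure_of M (negl2 n)) \<longlonglongrightarrow> 0"
  proof (rule tendsto_sandwich[OF _ _ tendsto_const unbalanced_event_tendsto])
    have "outer_measure_of M (negl2 n) \<le> 0 + outer_measure_of M (unbalanced_event n)" for n
      unfolding outer_measure_of_null[OF good, symmetric] negl2_def
      using unbalanced_event_subset by (intro outer_measure_of_le_Un) auto
    then show "\<forall>\<^sub>F n in sequentially. outer_measure_of M (negl2 n) \<le> outer_measure_of M (unbalanced_event n)" by simp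
  qed simp
  show thesis
  proof (rule that[OF o_p_rem])
    show "negl n \<subseteq> space M" for n using sub by (auto simp: negl_def)
    have "(\<lambda>n. outer_measure_of M (negl1 n) + outer_measure_of M (negl2 n)) \<longlonglongrightarrow> 0 + 0"
      by (intro tendsto_add lim1 lim2)
    then have lim12: "(\<lambda>n. outer_measure_of M (negl1 n) + outer_measure_of M (negl2 n)) \<longlonglongrightarrow> 0" by simp
    show "(\<lambda>n. outer_measure_of M (negl n)) \<longlonglongrightarrow> 0"
    proof (rule tendsto_sandwich[OF _ _ tendsto_const lim12])
      show "\<forall>\<^sub>F n in sequentially. outer_measure_of M (negl n)
          \<le> outer_measure_of M (negl1 n) + outer_measure_of M (negl2 n)"
        unfolding negl_def by (intro always_eventually allI outer_measure_of_le_Un sub order_refl)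
    qed simp
    fix n \<omega> assume \<omega>: "\<omega> \<in> space M - negl n"
    then show bal: "balanced n (folds_of n \<omega>)"
      by (auto simp: negl_def negl2_def unbalanced_event_def)
    fix i assume i: "i < n" and n: "n > 0"
    define k where "k = \<kappa> n i \<omega>"
    have k: "k < K" using \<kappa>_less[OF i] \<omega> by (simp add: k_def)
    define S where "S = train_set \<kappa> n k \<omega>"
    define m where "m = card S"
    have S: "S = train_of n k (folds_of n \<omega>)" unfolding S_def train_set_eq ..
    have m4: "n \<le> 4 * m" using bal k by (simp add: balanced_def m_def S)
    then have m0: "m > 0" using n by simp
    have range: "R (Z i \<omega>) \<in> {0..1}" "covar (Z i \<omega>) \<in> \<X>"
      using \<omega> by (auto simp: negl_def negl2_def good_def)
    let ?d = "err n \<omega> i" and ?l = "lin_err_at n \<omega> i"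
    have "sqrt m * (?d - ?l) = sqrt (card S) * (oof_cdf est Z \<kappa> n k \<omega> (R (Z i \<omega>)) (covar (Z i \<omega>)) - F (R (Z i \<omega>)) (covar (Z i \<omega>)))
             - (1 / sqrt (card S)) * (\<Sum>j\<in>S. \<phi> (R (Z i \<omega>)) (covar (Z i \<omega>)) (Z j \<omega>))"
      using m0 by (simp add: err_def lin_err_def oof_rank_def cond_rank_def infl_def k_def[symmetric] S[symmetric]
          m_def[symmetric] right_diff_distrib real_div_sqrt field_simps)
    then have "ennreal \<bar>sqrt m * (?d - ?l)\<bar> \<le> D k n \<omega>"
      unfolding D_def Let_def S_def[symmetric]
      using range by (intro SUP_upper2[of "(R (Z i \<omega>), covar (Z i \<omega>))"]) auto
    moreover have qk: "q k n \<omega> \<le> rem n \<omega>"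
      unfolding rem_def using k q0 by (intro member_le_sum) auto
    have "rem n \<omega> \<le> 1/2" using \<omega> rem0[of n \<omega>] by (auto simp: negl_def negl1_def)
    with qk have "ennreal (q k n \<omega>) < 1"
      using q0[of k n \<omega>] by (simp add: ennreal_less_one_iff)
    then have "D k n \<omega> = ennreal (q k n \<omega>)" unfolding qD by (auto simp: min_def split: if_splits)
    ultimately have "\<bar>sqrt m * (?d - ?l)\<bar> \<le> rem n \<omega>"
      using qk q0[of k n \<omega>] by simp
    then have 1: "sqrt m * \<bar>?d - ?l\<bar> \<le> rem n \<omega>" by (simp add: abs_mult)
    \<comment> \<open>The factor 2 is the root of the balance constant: n \<le> 4 m gives sqrt n
      \<le> 2 sqrt m.\<close>
    have "sqrt n \<le> sqrt (4 * m)" using m4 by simp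
    then have "sqrt n \<le> 2 * sqrt m" by (simp add: real_sqrt_mult)
    then have "sqrt n * \<bar>?d - ?l\<bar> \<le> 2 * sqrt m * \<bar>?d - ?l\<bar>" by (rule mult_right_mono) simp
    with 1 have "sqrt n * \<bar>?d - ?l\<bar> \<le> 2 * rem n \<omega>" by simp
    then show "\<bar>?d - ?l\<bar> \<le> 2 * \<bar>rem n \<omega>\<bar> / sqrt n"
      using n rem0[of n \<omega>] by (simp add: field_simps)
  qed
qed

text \<open>With m training observations, none of them \<open>i\<close>, the average of
  conditionally independent centred terms has second moment at most C/m, and balance gives C/m \<le>
  4 C/n.\<close>

lemma lin_err_second_moment:
  assumes C: "moment_bound C"
    and c: "balanced n c" "c i < K" "n > 0"
  shows "(\<integral>\<^sup>+\<omega>. ennreal ((lin_err n c (sample \<omega>) i)\<^sup>2) \<partial>M) \<le> ennreal (4 * C / n)"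
proof -
  interpret ck: centered_kernel P "\<lambda>z w. 1 * infl z w" C
    by (rule centered_kernelI[OF _ _ C]) auto
  define T where "T = train_of n (c i) c"
  define m where "m = card T"
  have m4: "n \<le> 4 * m" using c by (simp add: balanced_def m_def T_def)
  then have m0: "m > 0" using c(3) by simp
  have "real n \<le> 4 * real m" using m4 by linarith
  then have Cm: "C / m \<le> 4 * C / n"
    using m0 c(3) moment_bound_nonneg[OF C] by (simp add: field_simps) (metis mult.assoc mult.commute mult_left_mono)
  have m1: "(\<lambda>(z, w). infl z w) \<in> borel_measurable (P \<Otimes>\<^sub>M P)" by measurable
  have "(\<integral>\<^sup>+\<omega>. ennreal ((lin_err n c (sample \<omega>) i)\<^sup>2) \<partial>M)
      = (\<integral>\<^sup>+\<omega>. ennreal (1 / (real m)\<^sup>2) * ennreal ((\<Sum>j\<in>T. infl (Z i \<omega>) (Z j \<omega>))\<^sup>2) \<partial>M)"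
    unfolding lin_err_def T_def[symmetric] m_def[symmetric]
    by (intro nn_integral_cong) (simp add: power_mult_distrib power_divide flip: ennreal_mult)
  also have "\<dots> = ennreal (1 / (real m)\<^sup>2) * (\<integral>\<^sup>+\<omega>. ennreal ((\<Sum>j\<in>T. infl (Z i \<omega>) (Z j \<omega>))\<^sup>2) \<partial>M)"
    by (rule nn_integral_cmult) measurable
  also have "\<dots> \<le> ennreal (1 / (real m)\<^sup>2) * (of_nat m * ennreal C)"
  proof (rule mult_left_mono)
    have "(\<integral>\<^sup>+\<omega>. ennreal ((\<Sum>j\<in>T. infl (Z i \<omega>) (Z j \<omega>))\<^sup>2) \<partial>M)
        \<le> of_nat (card T) * (\<integral>\<^sup>+z. \<integral>\<^sup>+w. ennreal ((infl z w)\<^sup>2) \<partial>P \<partial>P)"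
      by (rule square_sum_pair[OF _ _ m1]) (use ck.AE_second_moment in \<open>auto simp: T_def train_of_def\<close>)
    also have "\<dots> \<le> of_nat m * ennreal C"
      using ck.second_moment_pair by (intro mult_mono) (auto simp: m_def)
    finally show "(\<integral>\<^sup>+\<omega>. ennreal ((\<Sum>j\<in>T. infl (Z i \<omega>) (Z j \<omega>))\<^sup>2) \<partial>M) \<le> of_nat m * ennreal C" .
  qed simp
  also have "\<dots> = ennreal (C / m)"
    using m0 moment_bound_nonneg[OF C] by (simp add: ennreal_of_nat_eq_real_of_nat power2_eq_square flip: ennreal_mult)
  also have "\<dots> \<le> ennreal (4 * C / n)" using Cm by (rule ennreal_leI)
  finally show ?thesis .
qed

text \<open>There are \<open>n\<close> linear errors of second moment at most 4 C/n each, so the sum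
  of their squares has bounded mean. It makes the product of two errors negligible after
  multiplication by n^(-1/2).\<close>

lemma O_p_sum_square_err: "O_p M (\<lambda>n \<omega>. \<Sum>i<n. (err n \<omega> i)\<^sup>2)"
proof -
  obtain C where C: "moment_bound C"
    by (rule moment_bound_exists)
  obtain rem negl where rem: "o_p M rem" "\<And>n. negl n \<subseteq> space M" "(\<lambda>n. outer_measure_of M (negl n)) \<longlonglongrightarrow> 0"
    "\<And>n \<omega>. \<omega> \<in> space M - negl n \<Longrightarrow> balanced n (folds_of n \<omega>)"
    "\<And>n \<omega> i. \<omega> \<in> space M - negl n \<Longrightarrow> i < n \<Longrightarrow> n > 0 \<Longrightarrow>
       \<bar>err n \<omega> i - lin_err_at n \<omega> i\<bar> \<le> 2 * \<bar>rem n \<omega>\<bar> / sqrt n"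
    by (rule remainder) blast
  \<comment> \<open>The square root matches the decoupling lemma, which bounds the mean of the
    square of \<open>S\<close>; the value 0 on unbalanced assignments makes the bound uniform in
    \<open>c\<close>.\<close>
  define S where "S n c w = (if balanced n c then sqrt (\<Sum>i<n. (lin_err n c w i)\<^sup>2) else 0)" for n c w
  have S2: "(S n c w)\<^sup>2 = (if balanced n c then \<Sum>i<n. (lin_err n c w i)\<^sup>2 else 0)" for n c w
    by (simp add: S_def sum_nonneg)
  have meas: "(\<lambda>w. lin_err n c w i) \<in> borel_measurable (PiM {..<n} (\<lambda>_. borel))" if "i < n" for n c i
    unfolding lin_err_def
    by (intro borel_measurable_times borel_measurable_sum borel_measurable_const
          measurable_pair_component[OF measurable_infl that] train_of_D)
  have measZ: "(\<lambda>\<omega>. lin_err n c (sample \<omega>) i) \<in> borel_measurable M" for n c i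
    unfolding lin_err_def by measurable
  have "O_p M (\<lambda>n \<omega>. S n (folds_of n \<omega>) (sample \<omega>))"
  proof (rule O_p_decouple[of S "4 * C"])
    show "S n (restrict c {..<n}) (restrict w {..<n}) = S n c w" for n :: nat and c w
      unfolding S_def using lin_err_restrict[of _ n c w] by simp
    show "S n c \<in> borel_measurable (PiM {..<n} (\<lambda>_. borel))" for n :: nat and c
      unfolding S_def using meas by (cases "balanced n c") (auto intro!: borel_measurable_sqrt borel_measurable_sum borel_measurable_power)
    fix n :: nat and c assume n: "n > 0" and c: "\<And>i. i < n \<Longrightarrow> c i < K"
    show "(\<integral>\<^sup>+\<omega>. ennreal ((S n c (sample \<omega>))\<^sup>2) \<partial>M) \<le> ennreal (4 * C)"
    proof (cases "balanced n c")
      case True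
      have "(\<integral>\<^sup>+\<omega>. ennreal ((S n c (sample \<omega>))\<^sup>2) \<partial>M)
          = (\<integral>\<^sup>+\<omega>. (\<Sum>i<n. ennreal ((lin_err n c (sample \<omega>) i)\<^sup>2)) \<partial>M)"
        by (intro nn_integral_cong) (simp add: S2 True)
      also have "\<dots> = (\<Sum>i<n. \<integral>\<^sup>+\<omega>. ennreal ((lin_err n c (sample \<omega>) i)\<^sup>2) \<partial>M)"
        using measZ by (intro nn_integral_sum) measurable
      also have "\<dots> \<le> (\<Sum>i<n. ennreal (4 * C / n))"
        using True c n by (intro sum_mono lin_err_second_moment[OF C]) auto
      also have "\<dots> = ennreal (4 * C)"
        using n moment_bound_nonneg[OF C] by (simp add: ennreal_of_nat_eq_real_of_nat flip: ennreal_mult)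
      finally show ?thesis .
    qed (simp add: S2)
  qed (use moment_bound_nonneg[OF C] in simp)
  then have "O_p M (\<lambda>n \<omega>. 2 * (S n (folds_of n \<omega>) (sample \<omega>) * S n (folds_of n \<omega>) (sample \<omega>)) + 8 * (rem n \<omega> * rem n \<omega>))"
    by (intro O_p_add O_p_cmult O_p_mult o_p_imp_O_p[OF rem(1)])
  then show ?thesis
  proof (rule O_p_dominated[OF _ rem(2,3)])
    show "\<forall>\<^sub>F n in sequentially. \<forall>\<omega>\<in>space M - negl n. \<bar>\<Sum>i<n. (err n \<omega> i)\<^sup>2\<bar>
        \<le> \<bar>2 * (S n (folds_of n \<omega>) (sample \<omega>) * S n (folds_of n \<omega>) (sample \<omega>)) + 8 * (rem n \<omega> * rem n \<omega>)\<bar>"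
      using eventually_gt_at_top[of 0]
    proof (eventually_elim, intro ballI)
      fix n :: nat and \<omega> assume n: "n > 0" and \<omega>: "\<omega> \<in> space M - negl n"
      let ?l = "lin_err_at n \<omega>"
      \<comment> \<open>From e^2 \<le> 2 l^2 + 2 (e - l)^2; the constant 8 is 2 times the square of
        the 2 in the remainder bound.\<close>
      have "(err n \<omega> i)\<^sup>2 \<le> 2 * (?l i)\<^sup>2 + 8 * (rem n \<omega>)\<^sup>2 / n" if "i < n" for i
      proof -
        have "\<bar>err n \<omega> i - ?l i\<bar>\<^sup>2 \<le> (2 * \<bar>rem n \<omega>\<bar> / sqrt n)\<^sup>2"
          by (rule power_mono[OF rem(5)[OF \<omega> that n]]) simp
        then have "(err n \<omega> i - ?l i)\<^sup>2 \<le> 4 * (rem n \<omega>)\<^sup>2 / n"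
          by (simp add: power_divide power_mult_distrib)
        moreover have "(err n \<omega> i)\<^sup>2 \<le> 2 * (?l i)\<^sup>2 + 2 * (err n \<omega> i - ?l i)\<^sup>2"
          using zero_le_power2[of "err n \<omega> i - 2 * ?l i"] by (simp add: power2_eq_square algebra_simps)
        ultimately show ?thesis by simp
      qed
      then have "(\<Sum>i<n. (err n \<omega> i)\<^sup>2) \<le> (\<Sum>i<n. 2 * (?l i)\<^sup>2 + 8 * (rem n \<omega>)\<^sup>2 / n)"
        by (intro sum_mono) auto
      also have "\<dots> = 2 * (\<Sum>i<n. (?l i)\<^sup>2) + 8 * (rem n \<omega>)\<^sup>2"
        using n by (simp add: sum.distrib sum_distrib_left)
      also have "\<dots> = 2 * (S n (folds_of n \<omega>) (sample \<omega>))\<^sup>2 + 8 * (rem n \<omega>)\<^sup>2"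
        using rem(4)[OF \<omega>] by (simp add: S2)
      finally show "\<bar>\<Sum>i<n. (err n \<omega> i)\<^sup>2\<bar> \<le> \<bar>2 * (S n (folds_of n \<omega>) (sample \<omega>) * S n (folds_of n \<omega>) (sample \<omega>)) + 8 * (rem n \<omega> * rem n \<omega>)\<bar>"
        by (simp add: power2_eq_square sum_nonneg)
    qed
  qed
qed

end

lemma o_p_cong_AE:
  assumes "o_p M f" and ae: "AE \<omega> in M. \<forall>n. g n \<omega> = f n \<omega>"
  shows "o_p M g"
proof (rule o_p_dominated[OF assms(1)])
  define B where "B = {\<omega> \<in> space M. \<not> (\<forall>n. g n \<omega> = f n \<omega>)}"
  show "B \<subseteq> space M" by (auto simp: B_def)
  have "outer_measure_of M B = 0"
    unfolding B_def by (rule outer_measure_of_null) (use ae in simp)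
  then show "(\<lambda>n::nat. outer_measure_of M B) \<longlonglongrightarrow> 0" by simp
  show "\<forall>\<^sub>F n in sequentially. \<forall>\<omega>\<in>space M - B. \<bar>g n \<omega>\<bar> \<le> \<bar>f n \<omega>\<bar>"
    by (auto simp: B_def)
qed

text \<open>The index set may depend on the assignment, so this serves both full-sample influence
  sums and sums of projections over one training set. Frozen, it is a sum of at most
  \<open>n\<close> orthogonal terms.\<close>

lemma (in cross_fitting) O_p_normalized_sum:
  assumes [measurable]: "h \<in> borel_measurable P" and h: "integrable P (\<lambda>z. (h z)\<^sup>2)" "(\<integral>z. h z \<partial>P) = 0"
    and T: "\<And>n c. T n (restrict c {..<n}) = T n c" "\<And>n c. T n c \<subseteq> {..<n}"
  shows "O_p M (\<lambda>n \<omega>. (1 / sqrt n) * (\<Sum>j\<in>T n (folds_of n \<omega>). h (Z j \<omega>)))"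
proof (rule O_p_decouple[where S = "\<lambda>n c w. (1 / sqrt n) * (\<Sum>j\<in>T n c. h (w j))" and b = "\<integral>z. (h z)\<^sup>2 \<partial>P"])
  fix n :: nat and c :: "nat \<Rightarrow> nat"
  show "(1 / sqrt n) * (\<Sum>j\<in>T n (restrict c {..<n}). h (restrict w {..<n} j)) = (1 / sqrt n) * (\<Sum>j\<in>T n c. h (w j))" for w
    using T(2)[of n c] by (auto simp: T(1) intro!: arg_cong2[where f="(*)"] sum.cong)
  have hb: "h \<in> borel_measurable borel" using assms(1) by (simp add: measurable_P_iff)
  have c: "(\<lambda>w. h (w j)) \<in> borel_measurable (PiM {..<n} (\<lambda>_. borel))" if "j \<in> T n c" for j
    using that T(2)[of n c] by (intro measurable_compose[OF measurable_component_singleton[of j "{..<n}" "\<lambda>_. borel"] hb]) auto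
  then show "(\<lambda>w. (1 / sqrt n) * (\<Sum>j\<in>T n c. h (w j))) \<in> borel_measurable (PiM {..<n} (\<lambda>_. borel))"
    by (intro borel_measurable_times borel_measurable_sum borel_measurable_const)
  assume n: "n > 0"
  have fin: "finite (T n c)" and card: "card (T n c) \<le> n"
    using finite_subset[OF T(2)[of n c]] card_mono[OF _ T(2)[of n c]] by auto
  have int: "integrable P h" by (rule P.square_integrable_imp_integrable[OF assms(1) h(1)])
  have "(\<integral>\<^sup>+\<omega>. ennreal (((1 / sqrt n) * (\<Sum>j\<in>T n c. h (Z j \<omega>)))\<^sup>2) \<partial>M)
      = (\<integral>\<^sup>+\<omega>. ennreal (1 / n) * ennreal ((\<Sum>j\<in>T n c. h (Z j \<omega>))\<^sup>2) \<partial>M)"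
    by (intro nn_integral_cong) (simp add: power_mult_distrib power_divide flip: ennreal_mult)
  also have "\<dots> = ennreal (1 / n) * (\<integral>\<^sup>+\<omega>. ennreal ((\<Sum>j\<in>T n c. h (Z j \<omega>))\<^sup>2) \<partial>M)"
    by (rule nn_integral_cmult) measurable
  also have "\<dots> \<le> ennreal (1 / n) * (of_nat (card (T n c)) * (\<integral>\<^sup>+z. ennreal ((h z)\<^sup>2) \<partial>P))"
    by (intro mult_left_mono square_sum_Z fin int h(2)) simp
  also have "(\<integral>\<^sup>+z. ennreal ((h z)\<^sup>2) \<partial>P) = ennreal (\<integral>z. (h z)\<^sup>2 \<partial>P)"
    by (rule nn_integral_eq_integral[OF h(1)]) simp
  also have "ennreal (1 / n) * (of_nat (card (T n c)) * ennreal (\<integral>z. (h z)\<^sup>2 \<partial>P))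
      = ennreal (card (T n c) / n * (\<integral>z. (h z)\<^sup>2 \<partial>P))"
    by (simp add: ennreal_of_nat_eq_real_of_nat flip: ennreal_mult)
  also have "\<dots> \<le> ennreal (1 * (\<integral>z. (h z)\<^sup>2 \<partial>P))"
    using card n by (intro ennreal_leI mult_right_mono) (auto simp: divide_le_eq)
  finally show "(\<integral>\<^sup>+\<omega>. ennreal (((1 / sqrt n) * (\<Sum>j\<in>T n c. h (Z j \<omega>)))\<^sup>2) \<partial>M) \<le> ennreal (\<integral>z. (h z)\<^sup>2 \<partial>P)"
    by simp
qed simp

section \<open>Weighted sums and averages of the errors\<close>

context cross_fitted_rank
begin

lemma copy_cond_exp_properties:
  assumes [measurable]: "g \<in> borel_measurable P" and g: "AE z in P. \<bar>g z\<bar> \<le> 1"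
    and \<gamma>: "copy_cond_exp P (\<lambda>z' z. g z' * \<phi> (R z') (covar z') z) \<gamma>"
  shows "\<gamma> \<in> borel_measurable P" "integrable P (\<lambda>z. (\<gamma> z)\<^sup>2)" "(\<integral>z. \<gamma> z \<partial>P) = 0"
proof -
  obtain C where C: "moment_bound C"
    by (rule moment_bound_exists)
  interpret ck: centered_kernel P "\<lambda>z w. g z * infl z w" C
    by (rule centered_kernelI[OF _ g C]) auto
  show [measurable]: "\<gamma> \<in> borel_measurable P" using \<gamma> by (simp add: copy_cond_exp_def)
  have ae: "AE z in P. \<gamma> z = ck.proj z"
    by (rule ck.copy_cond_exp_eq_proj) (use \<gamma> in \<open>simp add: infl_def\<close>)
  have "AE z in P. (\<gamma> z)\<^sup>2 = (ck.proj z)\<^sup>2" using ae by eventually_elim simp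
  then show "integrable P (\<lambda>z. (\<gamma> z)\<^sup>2)"
    using ck.integrable_proj_square by (subst integrable_cong_AE) auto
  show "(\<integral>z. \<gamma> z \<partial>P) = 0"
    using ck.integral_proj ae by (subst integral_cong_AE[of _ _ ck.proj]) auto
qed

text \<open>The sum is split by folds and the kernel into \<open>rest\<close> and
  \<open>proj\<close>. The \<open>rest\<close> part is a degenerate double sum per fold. The
  \<open>proj\<close> part equals its target up to the deviation of the fold ratio from 1/(K - 1)
  times an \<open>O_p\<close> sum. The identity with \<open>G\<close> is exact, but only for
  balanced assignments; the other ones are left to the caller.\<close>

lemma o_p_weighted_lin_err:
  assumes "centered_kernel P (\<lambda>z w. g z * infl z w) C" and C: "0 \<le> C"
  defines "p \<equiv> centered_kernel.proj P (\<lambda>z w. g z * infl z w)"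
  shows "\<exists>G. o_p M G \<and> (\<forall>n \<omega>. \<omega> \<in> space M \<longrightarrow> balanced n (folds_of n \<omega>) \<longrightarrow>
    (1 / sqrt n) * (\<Sum>i<n. g (Z i \<omega>) * lin_err_at n \<omega> i) - (1 / sqrt n) * (\<Sum>i<n. p (Z i \<omega>)) = G n \<omega>)"
proof -
  interpret ck: centered_kernel P "\<lambda>z w. g z * infl z w" C by fact
  have p: "p = ck.proj" by (simp add: p_def)
  define A where "A k n c w = (if balanced n c then (1 / sqrt n) * ((1 / card (train_of n k c)) *
    (\<Sum>i\<in>fold_of n k c. \<Sum>j\<in>train_of n k c. ck.rest (w i) (w j))) else 0)" for k n c w
  define B where "B k n \<omega> = (1 / sqrt n) * (\<Sum>j\<in>train_of n k (folds_of n \<omega>). ck.proj (Z j \<omega>))" for k n \<omega>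
  define r where "r k n \<omega> = card (fold_of n k (folds_of n \<omega>)) / card (train_of n k (folds_of n \<omega>)) - 1 / (real K - 1)" for k n \<omega>
  have opA: "o_p M (\<lambda>n \<omega>. A k n (folds_of n \<omega>) (sample \<omega>))" if k: "k < K" for k
  \<comment> \<open>In the constant 16, one factor 4 comes from the second moment of
    \<open>rest\<close>, the other from 1/m \<le> 4/n; the fold size over \<open>n\<close> is at
    most 1.\<close>
  proof (rule o_p_decouple[of "A k" "\<lambda>n. 16 * C / n"])
    show "A k n (restrict c {..<n}) (restrict w {..<n}) = A k n c w" for n :: nat and c w
    proof -
      have "(\<Sum>i\<in>fold_of n k c. \<Sum>j\<in>train_of n k c. ck.rest (restrict w {..<n} i) (restrict w {..<n} j))
          = (\<Sum>i\<in>fold_of n k c. \<Sum>j\<in>train_of n k c. ck.rest (w i) (w j))"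
        by (intro sum.cong refl) (simp add: train_of_D fold_of_D)
      then show ?thesis unfolding A_def by simp
    qed
    show "A k n c \<in> borel_measurable (PiM {..<n} (\<lambda>_. borel))" for n :: nat and c
    proof -
      have "(\<lambda>w. \<Sum>i\<in>fold_of n k c. \<Sum>j\<in>train_of n k c. ck.rest (w i) (w j)) \<in> borel_measurable (PiM {..<n} (\<lambda>_. borel))"
        by (intro borel_measurable_sum measurable_pair_component[OF ck.measurable_rest] train_of_D fold_of_D)
      then show ?thesis by (cases "balanced n c") (simp_all add: A_def[abs_def])
    qed
    show "(\<lambda>n. 16 * C / real n) \<longlonglongrightarrow> 0"
      using tendsto_mult[OF tendsto_const lim_1_over_n, of "16 * C"] by simp
    show "0 \<le> 16 * C / real n" for n using C by simp
    fix n :: nat and c assume n: "n > 0"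
    show "(\<integral>\<^sup>+\<omega>. ennreal ((A k n c (sample \<omega>))\<^sup>2) \<partial>M) \<le> ennreal (16 * C / n)"
    proof (cases "balanced n c")
      case True
      define I T where "I = fold_of n k c" and "T = train_of n k c"
      define m where "m = real (card T)"
      have "n \<le> 4 * card T" using True k by (simp add: balanced_def T_def)
      then have m4: "real n \<le> 4 * m" unfolding m_def by linarith
      then have m0: "m > 0" using n by simp
      have In: "real (card I) \<le> n" unfolding I_def using card_fold_of_le by simp
      let ?s = "\<lambda>\<omega>. \<Sum>i\<in>I. \<Sum>j\<in>T. ck.rest (Z i \<omega>) (Z j \<omega>)"
      have "(\<integral>\<^sup>+\<omega>. ennreal ((A k n c (sample \<omega>))\<^sup>2) \<partial>M) = (\<integral>\<^sup>+\<omega>. ennreal (1 / (n * m\<^sup>2)) * ennreal ((?s \<omega>)\<^sup>2) \<partial>M)"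
        using True unfolding A_def I_def[symmetric] T_def[symmetric]
        by (intro nn_integral_cong) (simp add: m_def power_mult_distrib power_divide field_simps flip: ennreal_mult)
      also have "\<dots> = ennreal (1 / (n * m\<^sup>2)) * (\<integral>\<^sup>+\<omega>. ennreal ((?s \<omega>)\<^sup>2) \<partial>M)"
        by (rule nn_integral_cmult) measurable
      also have "\<dots> \<le> ennreal (1 / (n * m\<^sup>2)) * (of_nat (card I) * of_nat (card T) * ennreal (4 * C))"
      proof (rule mult_left_mono)
        have "(\<integral>\<^sup>+\<omega>. ennreal ((?s \<omega>)\<^sup>2) \<partial>M) \<le> of_nat (card I) * of_nat (card T) *
            (\<integral>\<^sup>+z. \<integral>\<^sup>+w. ennreal ((ck.rest z w)\<^sup>2) \<partial>P \<partial>P)"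
          by (rule square_double_sum[OF _ _ _ ck.measurable_rest ck.AE_rest ck.AE_rest_fst])
            (simp_all add: I_def T_def fold_of_Int_train_of)
        also have "\<dots> \<le> of_nat (card I) * of_nat (card T) * ennreal (4 * C)"
          by (intro mult_left_mono ck.second_moment_rest C) simp
        finally show "(\<integral>\<^sup>+\<omega>. ennreal ((?s \<omega>)\<^sup>2) \<partial>M) \<le> of_nat (card I) * of_nat (card T) * ennreal (4 * C)" .
      qed simp
      also have "\<dots> = ennreal (1 / (n * m\<^sup>2) * (card I * m * (4 * C)))"
        using C by (simp add: ennreal_of_nat_eq_real_of_nat m_def flip: ennreal_mult)
      also have "1 / (n * m\<^sup>2) * (card I * m * (4 * C)) = (card I / n) * (1 / m) * (4 * C)"
        using m0 n by (simp add: power2_eq_square field_simps)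
      also have "\<dots> \<le> 1 * (4 / n) * (4 * C)"
        using In m4 m0 n C by (intro mult_mono) (auto simp: field_simps)
      finally show ?thesis by (simp add: ennreal_leI)
    qed (use C in \<open>simp add: A_def\<close>)
  qed
  have OpB: "O_p M (B k)" for k
    unfolding B_def
    by (rule O_p_normalized_sum[where T = "\<lambda>n c. train_of n k c"])
      (auto simp: ck.integrable_proj_square ck.integral_proj dest: train_of_D)
  define G where "G n \<omega> = (\<Sum>k<K. A k n (folds_of n \<omega>) (sample \<omega>)) + (\<Sum>k<K. r k n \<omega> * B k n \<omega>)" for n \<omega>
  have "o_p M (\<lambda>n \<omega>. r k n \<omega> * B k n \<omega>)" if "k < K" for k
    using o_p_fold_ratio[OF that] OpB unfolding r_def by (rule o_p_mult_O_p)
  then have "o_p M G"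
    unfolding G_def by (intro o_p_add o_p_sum opA) auto
  moreover have "(1 / sqrt n) * (\<Sum>i<n. g (Z i \<omega>) * lin_err_at n \<omega> i) - (1 / sqrt n) * (\<Sum>i<n. p (Z i \<omega>)) = G n \<omega>"
    if \<omega>: "\<omega> \<in> space M" and bal: "balanced n (folds_of n \<omega>)" for n \<omega>
  proof -
    define c where "c = (folds_of n \<omega>)"
    define I T where "I k = fold_of n k c" and "T k = train_of n k c" for k
    have cK: "c i < K" if "i < n" for i using \<kappa>_less[OF that \<omega>] by (simp add: c_def)
    have "(\<Sum>i<n. g (Z i \<omega>) * lin_err n c (sample \<omega>) i)
        = (\<Sum>i<n. g (Z i \<omega>) * ((1 / card (T (c i))) * (\<Sum>j\<in>T (c i). infl (Z i \<omega>) (Z j \<omega>))))"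
      by (simp add: lin_err_def T_def)
    also have "\<dots> = (\<Sum>k<K. \<Sum>i\<in>I k. g (Z i \<omega>) * ((1 / card (T k)) * (\<Sum>j\<in>T k. infl (Z i \<omega>) (Z j \<omega>))))"
      unfolding I_def by (rule sum_fold_of[OF cK])
    also have "\<dots> = (\<Sum>k<K. (1 / card (T k)) * (\<Sum>i\<in>I k. \<Sum>j\<in>T k. ck.rest (Z i \<omega>) (Z j \<omega>) + ck.proj (Z j \<omega>)))"
      by (simp add: ck.rest_def sum_distrib_left mult.assoc mult.left_commute)
    also have "\<dots> = (\<Sum>k<K. (1 / card (T k)) * (\<Sum>i\<in>I k. \<Sum>j\<in>T k. ck.rest (Z i \<omega>) (Z j \<omega>)))
        + (\<Sum>k<K. (card (I k) / card (T k)) * (\<Sum>j\<in>T k. ck.proj (Z j \<omega>)))"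
      by (simp add: sum.distrib distrib_left add_divide_distrib)
    finally have 1: "(\<Sum>i<n. g (Z i \<omega>) * lin_err n c (sample \<omega>) i) = \<dots>" .
    have "(\<Sum>k<K. \<Sum>j\<in>T k. ck.proj (Z j \<omega>)) = (real K - 1) * (\<Sum>i<n. ck.proj (Z i \<omega>))"
      unfolding T_def using K2 by (intro sum_train_of[OF cK]) auto
    \<comment> \<open>Each index is used for training in K - 1 folds, so the full-sample sum is
      spread over the folds with the limiting ratio 1/(K - 1) as weight; subtracting it leaves
      \<open>r k\<close> times \<open>B k\<close> in every fold.\<close>
    then have 2: "(\<Sum>i<n. ck.proj (Z i \<omega>)) = (\<Sum>k<K. (1 / (real K - 1)) * (\<Sum>j\<in>T k. ck.proj (Z j \<omega>)))"
      using K2 by (simp add: sum_divide_distrib[symmetric])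
    have 3: "(\<Sum>k<K. r k n \<omega> * B k n \<omega>) = (1 / sqrt n) * ((\<Sum>k<K. (card (I k) / card (T k)) * (\<Sum>j\<in>T k. ck.proj (Z j \<omega>)))
        - (\<Sum>k<K. (1 / (real K - 1)) * (\<Sum>j\<in>T k. ck.proj (Z j \<omega>))))"
      unfolding r_def B_def c_def[symmetric] I_def T_def
      by (simp add: sum_subtractf[symmetric] sum_distrib_left left_diff_distrib right_diff_distrib mult.commute mult.left_commute)
    have 4: "(\<Sum>k<K. A k n c (sample \<omega>)) = (1 / sqrt n) * (\<Sum>k<K. (1 / card (T k)) * (\<Sum>i\<in>I k. \<Sum>j\<in>T k. ck.rest (Z i \<omega>) (Z j \<omega>)))"
      using bal by (simp add: A_def c_def[symmetric] I_def T_def sum_distrib_left)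
    show ?thesis
      unfolding G_def c_def[symmetric] p 1 2 3 4 by (simp only: distrib_left right_diff_distrib)
  qed
  ultimately show ?thesis by blast
qed

text \<open>Passing from \<open>err\<close> to \<open>lin_err\<close> costs at most 2 |rem|: there
  are \<open>n\<close> differences of size 2 |rem| / sqrt n, bounded weights, and a prefactor 1 /
  sqrt n.\<close>

lemma o_p_weighted_err:
  assumes [measurable]: "g \<in> borel_measurable P" and g: "AE z in P. \<bar>g z\<bar> \<le> 1"
    and \<gamma>: "copy_cond_exp P (\<lambda>z' z. g z' * \<phi> (R z') (covar z') z) \<gamma>"
  shows "o_p M (\<lambda>n \<omega>. (1 / sqrt n) * (\<Sum>i<n. g (Z i \<omega>) * err n \<omega> i) - (1 / sqrt n) * (\<Sum>i<n. \<gamma> (Z i \<omega>)))"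
proof -
  obtain C where C: "moment_bound C"
    by (rule moment_bound_exists)
  have ck: "centered_kernel P (\<lambda>z w. g z * infl z w) C"
    by (rule centered_kernelI[OF _ g C]) auto
  then interpret ck: centered_kernel P "\<lambda>z w. g z * infl z w" C .
  have ae: "AE z in P. \<gamma> z = ck.proj z"
    by (rule ck.copy_cond_exp_eq_proj) (use \<gamma> in \<open>simp add: infl_def\<close>)
  obtain rem negl where rem: "o_p M rem" "\<And>n. negl n \<subseteq> space M" "(\<lambda>n. outer_measure_of M (negl n)) \<longlonglongrightarrow> 0"
    "\<And>n \<omega>. \<omega> \<in> space M - negl n \<Longrightarrow> balanced n (folds_of n \<omega>)"
    "\<And>n \<omega> i. \<omega> \<in> space M - negl n \<Longrightarrow> i < n \<Longrightarrow> n > 0 \<Longrightarrow>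
       \<bar>err n \<omega> i - lin_err_at n \<omega> i\<bar> \<le> 2 * \<bar>rem n \<omega>\<bar> / sqrt n"
    by (rule remainder) blast
  obtain G where G: "o_p M G" "\<And>n \<omega>. \<omega> \<in> space M \<Longrightarrow> balanced n (folds_of n \<omega>) \<Longrightarrow>
    (1 / sqrt n) * (\<Sum>i<n. g (Z i \<omega>) * lin_err_at n \<omega> i) - (1 / sqrt n) * (\<Sum>i<n. ck.proj (Z i \<omega>)) = G n \<omega>"
    using o_p_weighted_lin_err[OF ck moment_bound_nonneg[OF C]] by blast
  \<comment> \<open>The bound on \<open>g\<close> holds only almost everywhere; clipping gives a
    weight bounded at every point, as the domination on the complement of \<open>negl n\<close>
    requires, without changing the sums almost surely.\<close>
  define g' where "g' z = max (-1) (min 1 (g z))" for z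
  have g'1: "\<bar>g' z\<bar> \<le> 1" for z by (auto simp: g'_def)
  have eq: "AE \<omega> in M. \<forall>i. \<gamma> (Z i \<omega>) = ck.proj (Z i \<omega>) \<and> g (Z i \<omega>) = g' (Z i \<omega>)"
  proof -
    have "AE z in P. \<gamma> z = ck.proj z \<and> g z = g' z"
      using ae g by eventually_elim (auto simp: g'_def)
    then show ?thesis unfolding AE_all_countable by (intro allI AE_Z)
  qed
  define H where "H n \<omega> = (1 / sqrt n) * (\<Sum>i<n. g' (Z i \<omega>) * (err n \<omega> i - lin_err_at n \<omega> i))" for n \<omega>
  have opH: "o_p M H"
  proof (rule o_p_dominated[OF o_p_cmult[OF rem(1), of 2] rem(2,3)])
    show "\<forall>\<^sub>F n in sequentially. \<forall>\<omega>\<in>space M - negl n. \<bar>H n \<omega>\<bar> \<le> \<bar>2 * rem n \<omega>\<bar>"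
      using eventually_gt_at_top[of 0]
    proof (eventually_elim, intro ballI)
      fix n :: nat and \<omega> assume n: "n > 0" and \<omega>: "\<omega> \<in> space M - negl n"
      let ?e = "\<lambda>i. err n \<omega> i - lin_err_at n \<omega> i"
      have "\<bar>\<Sum>i<n. g' (Z i \<omega>) * ?e i\<bar> \<le> (\<Sum>i<n. \<bar>g' (Z i \<omega>) * ?e i\<bar>)" by (rule sum_abs)
      also have "\<dots> \<le> (\<Sum>i<n. 1 * (2 * \<bar>rem n \<omega>\<bar> / sqrt n))"
        unfolding abs_mult using rem(5)[OF \<omega> _ n] g'1 by (intro sum_mono mult_mono) auto
      also have "\<dots> = sqrt n * (2 * \<bar>rem n \<omega>\<bar>)"
        using n by (simp add: field_simps)
      finally have "(1 / sqrt n) * \<bar>\<Sum>i<n. g' (Z i \<omega>) * ?e i\<bar> \<le> (1 / sqrt n) * (sqrt n * (2 * \<bar>rem n \<omega>\<bar>))"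
        by (rule mult_left_mono) simp
      then show "\<bar>H n \<omega>\<bar> \<le> \<bar>2 * rem n \<omega>\<bar>"
        using n by (simp add: H_def abs_mult)
    qed
  qed
  define f where "f n \<omega> = H n \<omega> + ((1 / sqrt n) * (\<Sum>i<n. g (Z i \<omega>) * lin_err_at n \<omega> i) - (1 / sqrt n) * (\<Sum>i<n. ck.proj (Z i \<omega>)))" for n \<omega>
  have "o_p M f"
    by (rule o_p_dominated[OF o_p_add[OF opH G(1)] rem(2,3)]) (use G(2) rem(4) in \<open>auto simp: f_def\<close>)
  then show ?thesis
  proof (rule o_p_cong_AE)
    show "AE \<omega> in M. \<forall>n. (1 / sqrt n) * (\<Sum>i<n. g (Z i \<omega>) * err n \<omega> i) - (1 / sqrt n) * (\<Sum>i<n. \<gamma> (Z i \<omega>)) = f n \<omega>"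
      using eq
    proof (eventually_elim, intro allI)
      fix \<omega> n assume "\<forall>i. \<gamma> (Z i \<omega>) = ck.proj (Z i \<omega>) \<and> g (Z i \<omega>) = g' (Z i \<omega>)"
      then show "(1 / sqrt n) * (\<Sum>i<n. g (Z i \<omega>) * err n \<omega> i) - (1 / sqrt n) * (\<Sum>i<n. \<gamma> (Z i \<omega>)) = f n \<omega>"
        unfolding f_def H_def by (simp add: right_diff_distrib sum_subtractf diff_divide_distrib)
    qed
  qed
qed

lemma U_half_range: "AE z in P. \<bar>rank.U z - 1/2\<bar> \<le> 1/2"
  using rank.AE_U_range
proof eventually_elim
  case (elim z)
  then show ?case unfolding atLeastAtMost_iff abs_le_iff by linarith
qed

lemma integrable_U_half: "integrable P (\<lambda>z. rank.U z - 1/2)" "integrable P (\<lambda>z. (rank.U z - 1/2)\<^sup>2)"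
proof -
  show "integrable P (\<lambda>z. rank.U z - 1/2)"
    using rank.integrable_U_power[of 1] by simp
  show "integrable P (\<lambda>z. (rank.U z - 1/2)\<^sup>2)"
  proof (rule P.integrable_const_bound[of _ 1])
    show "AE z in P. norm ((rank.U z - 1/2)\<^sup>2) \<le> 1"
      using U_half_range
    proof eventually_elim
      case (elim z)
      then have "\<bar>rank.U z - 1/2\<bar> \<le> 1" by linarith
      then show ?case by (simp only: abs_square_le_1 real_norm_def abs_of_nonneg zero_le_power2)
    qed
  qed measurable
qed

text \<open>Only the order of the average is needed, so Cauchy-Schwarz suffices for the errors: the
  normalized error sum \<open>x\<close> satisfies x^2 \<le> (sum of squared errors), and |x| \<le> 1
  + x^2.\<close>

lemma O_p_avg:
  "O_p M (\<lambda>n \<omega>. sqrt n * (avg n (oof_rank R est Z \<kappa> n \<omega>) - 1/2))"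
proof -
  have 1: "O_p M (\<lambda>n \<omega>. (1 / sqrt n) * (\<Sum>i\<in>{..<n}. (rank.U (Z i \<omega>) - 1/2)))"
    by (rule O_p_normalized_sum[where T = "\<lambda>n c. {..<n}" and h = "\<lambda>z. rank.U z - 1/2"])
      (use rank.integrable_U_power[of 1] in \<open>simp_all add: integrable_U_half rank.mean_U P.prob_space\<close>)
  have 2: "O_p M (\<lambda>n \<omega>. (1 / sqrt n) * (\<Sum>i<n. err n \<omega> i))"
  proof (rule O_p_mono)
    show "O_p M (\<lambda>n \<omega>. 1 + (\<Sum>i<n. (err n \<omega> i)\<^sup>2))"
      by (intro O_p_add O_p_const O_p_sum_square_err)
    have "\<bar>(1 / sqrt n) * (\<Sum>i<n. err n \<omega> i)\<bar> \<le> \<bar>1 + (\<Sum>i<n. (err n \<omega> i)\<^sup>2)\<bar>" if n: "n > 0" for n :: nat and \<omega>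
    proof -
      define x where "x = (1 / sqrt n) * (\<Sum>i<n. err n \<omega> i)"
      have "(\<Sum>i<n. 1 * err n \<omega> i)\<^sup>2 \<le> (\<Sum>i<n. 1\<^sup>2) * (\<Sum>i<n. (err n \<omega> i)\<^sup>2)"
        by (rule Cauchy_Schwarz_ineq_sum)
      then have "x\<^sup>2 \<le> (\<Sum>i<n. (err n \<omega> i)\<^sup>2)"
        using n by (simp add: x_def power_divide power_mult_distrib field_simps)
      moreover have "\<bar>x\<bar> \<le> 1 + x\<^sup>2"
        using zero_le_power2[of "\<bar>x\<bar> - 1"] by (simp add: power2_diff)
      ultimately show ?thesis unfolding x_def by linarith
    qed
    then show "\<forall>\<^sub>F n in sequentially. \<forall>\<omega>\<in>space M. \<bar>(1 / sqrt (real n)) * (\<Sum>i<n. err n \<omega> i)\<bar> \<le> \<bar>1 + (\<Sum>i<n. (err n \<omega> i)\<^sup>2)\<bar>"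
      by (intro eventually_mono[OF eventually_gt_at_top[of 0]]) blast
  qed
  show ?thesis
  proof (rule O_p_mono[OF O_p_add[OF 1 2]])
    have "sqrt n * (avg n (oof_rank R est Z \<kappa> n \<omega>) - 1/2) = (1 / sqrt n) * (\<Sum>i<n. (rank.U (Z i \<omega>) - 1/2)) + (1 / sqrt n) * (\<Sum>i<n. err n \<omega> i)"
      if n: "n > 0" for n :: nat and \<omega>
    proof -
      have "avg n (oof_rank R est Z \<kappa> n \<omega>) - 1/2 = (1 / n) * ((\<Sum>i<n. (rank.U (Z i \<omega>) - 1/2)) + (\<Sum>i<n. err n \<omega> i))"
        using n unfolding avg_def err_def sum_subtractf by (simp add: field_simps)
      moreover have "sqrt n * (1 / n) = 1 / sqrt n" using n by (simp add: field_simps)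
      ultimately show ?thesis by (simp only: mult.assoc[symmetric] distrib_left)
    qed
    then show "\<forall>\<^sub>F n in sequentially. \<forall>\<omega>\<in>space M. \<bar>sqrt (real n) * (avg n (oof_rank R est Z \<kappa> n \<omega>) - 1/2)\<bar>
        \<le> \<bar>(1 / sqrt n) * (\<Sum>i<n. (rank.U (Z i \<omega>) - 1/2)) + (1 / sqrt n) * (\<Sum>i<n. err n \<omega> i)\<bar>"
      by (intro eventually_mono[OF eventually_gt_at_top[of 0]]) simp
  qed
qed

end

section \<open>Asymptotic linearity of the estimators\<close>

text \<open>Pairing an outcome with itself gives the variance terms.\<close>

locale cross_fitted_rank_pair =
  X: cross_fitted_rank M P Z K \<kappa> R F f \<X> est \<phi> + Y: cross_fitted_rank M P Z K \<kappa> R' F' f' \<X> est' \<phi>'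
  for M :: "'a measure" and P :: "'p::finite obs measure" and Z K \<kappa> R F f \<X> est \<phi> R' F' f' est' \<phi>' +
  fixes \<gamma> \<gamma>' :: "'p obs \<Rightarrow> real"
  assumes \<gamma>: "copy_cond_exp P (\<lambda>z' z. (cond_rank R' F' z' - 1/2) * \<phi> (R z') (covar z') z) \<gamma>"
    and \<gamma>': "copy_cond_exp P (\<lambda>z' z. (cond_rank R F z' - 1/2) * \<phi>' (R' z') (covar z') z) \<gamma>'"
begin

abbreviation "U \<equiv> cond_rank R F"
abbreviation "V \<equiv> cond_rank R' F'"
abbreviation "u n \<omega> \<equiv> oof_rank R est Z \<kappa> n \<omega>"
abbreviation "v n \<omega> \<equiv> oof_rank R' est' Z \<kappa> n \<omega>"
abbreviation "\<psi> \<equiv> psi_A P U V \<gamma> \<gamma>'"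
abbreviation "A \<equiv> \<integral>z. (U z - 1/2) * (V z - 1/2) \<partial>P"

abbreviation "half_moment n \<omega> \<equiv> (1 / n) * (\<Sum>i<n. (u n \<omega> i - 1/2) * (v n \<omega> i - 1/2))"
abbreviation "sample_cov n \<omega> \<equiv>
  (1 / n) * (\<Sum>i<n. (u n \<omega> i - avg n (u n \<omega>)) * (v n \<omega> i - avg n (v n \<omega>)))"

lemma V_weight: "(\<lambda>z. V z - 1/2) \<in> borel_measurable P" "AE z in P. \<bar>V z - 1/2\<bar> \<le> 1"
  and U_weight: "(\<lambda>z. U z - 1/2) \<in> borel_measurable P" "AE z in P. \<bar>U z - 1/2\<bar> \<le> 1"
proof -
  show "(\<lambda>z. V z - 1/2) \<in> borel_measurable P" "(\<lambda>z. U z - 1/2) \<in> borel_measurable P"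
    using X.rank.measurable_U Y.rank.measurable_U by (simp_all add: X.measurable_P_iff)
  show "AE z in P. \<bar>V z - 1/2\<bar> \<le> 1"
    using Y.U_half_range by eventually_elim linarith
  show "AE z in P. \<bar>U z - 1/2\<bar> \<le> 1"
    using X.U_half_range by eventually_elim linarith
qed

lemmas \<gamma>_props = X.copy_cond_exp_properties[OF V_weight \<gamma>]
lemmas \<gamma>'_props = Y.copy_cond_exp_properties[OF U_weight \<gamma>']

lemma product_bound: "AE z in P. \<bar>(U z - 1/2) * (V z - 1/2)\<bar> \<le> 1"
  using U_weight(2) V_weight(2)
proof eventually_elim
  case (elim z)
  then have "\<bar>U z - 1/2\<bar> * \<bar>V z - 1/2\<bar> \<le> 1 * 1" by (intro mult_mono) auto
  then show ?case by (simp only: abs_mult mult_1)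
qed

lemma integrable_product: "integrable P (\<lambda>z. (U z - 1/2) * (V z - 1/2))"
  by (rule X.P.integrable_const_bound[of _ 1])
    (use product_bound borel_measurable_times[OF U_weight(1) V_weight(1)] in \<open>simp_all only: real_norm_def\<close>)

lemma cov_eq: "cov P U V = A"
  by (simp add: cov_def X.rank.mean_U Y.rank.mean_U)

lemma \<psi>_props: "\<psi> \<in> borel_measurable P" "integrable P (\<lambda>z. (\<psi> z)\<^sup>2)" "(\<integral>z. \<psi> z \<partial>P) = 0"
proof -
  define h where "h z = (U z - 1/2) * (V z - 1/2) - A" for z
  have [measurable]: "(\<lambda>z. U z - 1/2) \<in> borel_measurable P" "(\<lambda>z. V z - 1/2) \<in> borel_measurable P"
    using U_weight V_weight by auto
  note [measurable] = \<gamma>_props(1) \<gamma>'_props(1)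
  have h[measurable]: "h \<in> borel_measurable P" unfolding h_def by measurable
  have \<psi>: "\<psi> = (\<lambda>z. h z + \<gamma> z + \<gamma>' z)" by (simp add: fun_eq_iff psi_A_def h_def)
  show "\<psi> \<in> borel_measurable P" unfolding \<psi> by measurable
  have ih: "integrable P h" unfolding h_def using integrable_product by simp
  have ih2: "integrable P (\<lambda>z. (h z)\<^sup>2)"
  proof (rule X.P.integrable_const_bound[of _ "(1 + \<bar>A\<bar>)\<^sup>2"])
    show "AE z in P. norm ((h z)\<^sup>2) \<le> (1 + \<bar>A\<bar>)\<^sup>2"
      using product_bound
    proof eventually_elim
      case (elim z)
      then have "\<bar>h z\<bar> \<le> 1 + \<bar>A\<bar>" unfolding h_def by linarith
      then have "\<bar>h z\<bar>\<^sup>2 \<le> (1 + \<bar>A\<bar>)\<^sup>2" by (rule power_mono) simp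
      then show ?case by simp
    qed
  qed measurable
  have i\<gamma>: "integrable P \<gamma>" "integrable P \<gamma>'"
    by (rule X.P.square_integrable_imp_integrable[OF \<gamma>_props(1,2)]
        X.P.square_integrable_imp_integrable[OF \<gamma>'_props(1,2)])+
  show "integrable P (\<lambda>z. (\<psi> z)\<^sup>2)"
  proof (rule Bochner_Integration.integrable_bound)
    show "integrable P (\<lambda>z. 3 * (h z)\<^sup>2 + 3 * (\<gamma> z)\<^sup>2 + 3 * (\<gamma>' z)\<^sup>2)"
      using ih2 \<gamma>_props(2) \<gamma>'_props(2) by simp
    show "AE z in P. norm ((\<psi> z)\<^sup>2) \<le> norm (3 * (h z)\<^sup>2 + 3 * (\<gamma> z)\<^sup>2 + 3 * (\<gamma>' z)\<^sup>2)"
    proof (rule AE_I2)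
      fix z
      \<comment> \<open>The three squares add up to 3 (h^2 + \<gamma>^2 + \<gamma>'^2) - (h +
        \<gamma> + \<gamma>')^2.\<close>
      have "0 \<le> (h z - \<gamma> z)\<^sup>2 + (h z - \<gamma>' z)\<^sup>2 + (\<gamma> z - \<gamma>' z)\<^sup>2" by simp
      then have "(h z + \<gamma> z + \<gamma>' z)\<^sup>2 \<le> 3 * (h z)\<^sup>2 + 3 * (\<gamma> z)\<^sup>2 + 3 * (\<gamma>' z)\<^sup>2"
        by (simp add: power2_eq_square algebra_simps)
      then show "norm ((\<psi> z)\<^sup>2) \<le> norm (3 * (h z)\<^sup>2 + 3 * (\<gamma> z)\<^sup>2 + 3 * (\<gamma>' z)\<^sup>2)"
        by (simp add: \<psi>)
    qed
  qed (unfold \<psi>, measurable)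
  have "(\<integral>z. h z \<partial>P) = 0"
    unfolding h_def using integrable_product by (simp add: X.P.prob_space)
  then show "(\<integral>z. \<psi> z \<partial>P) = 0"
    unfolding \<psi> using ih i\<gamma> \<gamma>_props(3) \<gamma>'_props(3) by simp
qed

definition influence :: "nat \<Rightarrow> 'a \<Rightarrow> real" where
  "influence n \<omega> = (1 / sqrt n) * (\<Sum>i<n. \<psi> (Z i \<omega>))"

lemma O_p_influence: "O_p M influence"
  using X.O_p_normalized_sum[where T = "\<lambda>n c. {..<n}" and h = \<psi>] \<psi>_props
  unfolding influence_def[abs_def] by simp

text \<open>Writing each fitted rank as true rank plus error, the product expands into four terms:
  the true product supplies the first part of \<open>\<psi>\<close>, the two mixed terms
  \<open>a\<close> and \<open>b\<close> are weighted error sums that produce \<open>\<gamma>\<close>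
  and \<open>\<gamma>'\<close>, and the error product \<open>c\<close> is dominated by the two sums
  of squared errors over sqrt n.\<close>

lemma asymp_linear_half_moment:
  "asymp_linear M half_moment A influence"
  unfolding asymp_linear_def
proof
  define a where "a n \<omega> = (1 / sqrt n) * (\<Sum>i<n. (V (Z i \<omega>) - 1/2) * X.err n \<omega> i) - (1 / sqrt n) * (\<Sum>i<n. \<gamma> (Z i \<omega>))" for n \<omega>
  define b where "b n \<omega> = (1 / sqrt n) * (\<Sum>i<n. (U (Z i \<omega>) - 1/2) * Y.err n \<omega> i) - (1 / sqrt n) * (\<Sum>i<n. \<gamma>' (Z i \<omega>))" for n \<omega>
  define c where "c n \<omega> = (1 / sqrt n) * (\<Sum>i<n. X.err n \<omega> i * Y.err n \<omega> i)" for n \<omega>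
  have "o_p M a" "o_p M b"
    unfolding a_def b_def using X.o_p_weighted_err[OF V_weight \<gamma>] Y.o_p_weighted_err[OF U_weight \<gamma>'] .
  moreover have "o_p M c"
  proof (rule o_p_mono)
    have "(\<lambda>n. 1 / sqrt (real n)) \<longlonglongrightarrow> 0"
      by (intro tendsto_divide_0[OF tendsto_const] filterlim_at_top_imp_at_infinity
          filterlim_compose[OF sqrt_at_top] filterlim_real_sequentially)
    then show "o_p M (\<lambda>n \<omega>. (1 / sqrt n) * ((\<Sum>i<n. (X.err n \<omega> i)\<^sup>2) + (\<Sum>i<n. (Y.err n \<omega> i)\<^sup>2)))"
      by (intro o_p_mult_O_p o_p_sequence O_p_add X.O_p_sum_square_err Y.O_p_sum_square_err)
    show "\<forall>\<^sub>F n in sequentially. \<forall>\<omega>\<in>space M.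
        \<bar>c n \<omega>\<bar> \<le> \<bar>(1 / sqrt (real n)) * ((\<Sum>i<n. (X.err n \<omega> i)\<^sup>2) + (\<Sum>i<n. (Y.err n \<omega> i)\<^sup>2))\<bar>"
    proof (intro always_eventually allI ballI)
      fix n \<omega>
      have "\<bar>\<Sum>i<n. X.err n \<omega> i * Y.err n \<omega> i\<bar> \<le> (\<Sum>i<n. \<bar>X.err n \<omega> i * Y.err n \<omega> i\<bar>)" by (rule sum_abs)
      also have "\<dots> \<le> (\<Sum>i<n. (X.err n \<omega> i)\<^sup>2 + (Y.err n \<omega> i)\<^sup>2)"
      proof (rule sum_mono)
        fix i
        show "\<bar>X.err n \<omega> i * Y.err n \<omega> i\<bar> \<le> (X.err n \<omega> i)\<^sup>2 + (Y.err n \<omega> i)\<^sup>2"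
          using sum_squares_bound[of "\<bar>X.err n \<omega> i\<bar>" "\<bar>Y.err n \<omega> i\<bar>"]
            mult_nonneg_nonneg[OF abs_ge_zero abs_ge_zero, of "X.err n \<omega> i" "Y.err n \<omega> i"]
          unfolding abs_mult power2_abs by linarith
      qed
      also have "\<dots> = (\<Sum>i<n. (X.err n \<omega> i)\<^sup>2) + (\<Sum>i<n. (Y.err n \<omega> i)\<^sup>2)" by (rule sum.distrib)
      finally have "(1 / sqrt n) * \<bar>\<Sum>i<n. X.err n \<omega> i * Y.err n \<omega> i\<bar>
          \<le> (1 / sqrt n) * ((\<Sum>i<n. (X.err n \<omega> i)\<^sup>2) + (\<Sum>i<n. (Y.err n \<omega> i)\<^sup>2))"
        by (rule mult_left_mono) simp
      then show "\<bar>c n \<omega>\<bar> \<le> \<bar>(1 / sqrt (real n)) * ((\<Sum>i<n. (X.err n \<omega> i)\<^sup>2) + (\<Sum>i<n. (Y.err n \<omega> i)\<^sup>2))\<bar>"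
        unfolding c_def abs_mult by (simp add: abs_of_nonneg sum_nonneg)
    qed
  qed
  ultimately have "o_p M (\<lambda>n \<omega>. a n \<omega> + b n \<omega> + c n \<omega>)" by (intro o_p_add)
  moreover have "sqrt n * (half_moment n \<omega> - A) - influence n \<omega> = a n \<omega> + b n \<omega> + c n \<omega>"
    for n \<omega>
  proof (cases "n = 0")
    case False
    have s: "sqrt n * (1 / n) = 1 / sqrt n" using False by (simp add: field_simps)
    have gen: "sqrt n * ((1 / n) * S - B) = (1 / sqrt n) * S - (1 / sqrt n) * (\<Sum>i<n. B)" for S B :: real
    proof -
      have "sqrt n * B = (1 / sqrt n) * (\<Sum>i<n. B)" using False by (simp add: field_simps)
      moreover have "sqrt n * ((1 / n) * S) = (1 / sqrt n) * S" using s by (metis mult.assoc)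
      ultimately show ?thesis by (simp only: right_diff_distrib)
    qed
    have "sqrt n * (half_moment n \<omega> - A) - influence n \<omega>
        = (1 / sqrt n) * (\<Sum>i<n. (u n \<omega> i - 1/2) * (v n \<omega> i - 1/2)) - (1 / sqrt n) * (\<Sum>i<n. A) - influence n \<omega>"
      unfolding gen ..
    also have "\<dots> = (1 / sqrt n) * (\<Sum>i<n. (u n \<omega> i - 1/2) * (v n \<omega> i - 1/2) - A - \<psi> (Z i \<omega>))"
      unfolding influence_def by (simp only: sum_subtractf right_diff_distrib)
    also have "(\<Sum>i<n. (u n \<omega> i - 1/2) * (v n \<omega> i - 1/2) - A - \<psi> (Z i \<omega>))
        = (\<Sum>i<n. (V (Z i \<omega>) - 1/2) * X.err n \<omega> i - \<gamma> (Z i \<omega>) + ((U (Z i \<omega>) - 1/2) * Y.err n \<omega> i - \<gamma>' (Z i \<omega>))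
            + X.err n \<omega> i * Y.err n \<omega> i)"
      by (intro sum.cong refl) (simp add: psi_A_def X.err_def Y.err_def algebra_simps)
    also have "(1 / sqrt n) * \<dots> = a n \<omega> + b n \<omega> + c n \<omega>"
      unfolding a_def b_def c_def by (simp only: sum.distrib sum_subtractf right_diff_distrib distrib_left)
    finally show ?thesis .
  qed (simp add: influence_def a_def b_def c_def)
  ultimately show "o_p M (\<lambda>n \<omega>. sqrt n * (half_moment n \<omega> - A) - influence n \<omega>)"
    by simp
qed (rule O_p_influence)

text \<open>Centring at the sample means instead of 1/2 subtracts the product of the two mean
  deviations. Each of these is of order n^(-1/2), so the influence function is the same as for the
  known mean 1/2.\<close>

lemma asymp_linear_covariance:
  "asymp_linear M sample_cov A influence"
  unfolding asymp_linear_def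
proof
  let ?H = "\<lambda>n \<omega>. sqrt n * (half_moment n \<omega> - A) - influence n \<omega>"
  have "o_p M (\<lambda>n \<omega>. ?H n \<omega> - (avg n (u n \<omega>) - 1/2) * (sqrt n * (avg n (v n \<omega>) - 1/2)))"
    by (rule o_p_diff[OF conjunct1[OF asymp_linear_half_moment[unfolded asymp_linear_def]]
          o_p_mult_O_p[OF o_p_of_sqrt_O_p[OF X.O_p_avg] Y.O_p_avg]])
  moreover have "sqrt n * (sample_cov n \<omega> - A) - influence n \<omega>
      = ?H n \<omega> - (avg n (u n \<omega>) - 1/2) * (sqrt n * (avg n (v n \<omega>) - 1/2))" for n \<omega>
  proof (cases "n = 0")
    case False
    define x y where "x = avg n (u n \<omega>) - 1/2" and "y = avg n (v n \<omega>) - 1/2"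
    define r s where "r i = u n \<omega> i - 1/2" and "s i = v n \<omega> i - 1/2" for i
    have sums: "(\<Sum>i<n. r i) = n * x" "(\<Sum>i<n. s i) = n * y"
      using False by (simp_all add: x_def y_def r_def s_def avg_def sum_subtractf right_diff_distrib)
    have "(\<Sum>i<n. (u n \<omega> i - avg n (u n \<omega>)) * (v n \<omega> i - avg n (v n \<omega>))) = (\<Sum>i<n. (r i - x) * (s i - y))"
      by (simp add: x_def y_def r_def s_def)
    also have "\<dots> = (\<Sum>i<n. r i * s i) - (\<Sum>i<n. r i) * y - x * (\<Sum>i<n. s i) + n * (x * y)"
      by (simp add: left_diff_distrib right_diff_distrib sum_subtractf sum.distrib sum_distrib_left sum_distrib_right)
    also have "\<dots> = (\<Sum>i<n. r i * s i) - n * (x * y)" unfolding sums by (simp add: algebra_simps)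
    finally have e: "sample_cov n \<omega>
        = (1 / n) * (\<Sum>i<n. r i * s i) - x * y"
      using False by (simp add: right_diff_distrib)
    have "sqrt n * (B - x * y - A) - C = sqrt n * (B - A) - C - x * (sqrt n * y)" for B C
      by (simp add: algebra_simps)
    then show ?thesis
      unfolding e unfolding x_def y_def r_def s_def .
  qed (simp add: influence_def)
  ultimately show "o_p M (\<lambda>n \<omega>. sqrt n * (sample_cov n \<omega> - A) - influence n \<omega>)"
    by (simp only:)
qed (rule O_p_influence)

end

section \<open>From second moments to the three estimators\<close>

lemma asymp_linear_cong:
  assumes "asymp_linear M x a \<alpha>" "\<And>n \<omega>. y n \<omega> = x n \<omega>" "b = a" "\<And>n \<omega>. \<beta> n \<omega> = \<alpha> n \<omega>"
  shows "asymp_linear M y b \<beta>"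
proof -
  have "y = x" "\<beta> = \<alpha>" using assms(2,4) by (simp_all add: fun_eq_iff)
  then show ?thesis using assms(1,3) by simp
qed

text \<open>When an outcome is paired with itself, the error enters through each of the two factors,
  and each contributes half of \<open>\<delta>\<close>.\<close>

lemma psi_sq_eq_psi_A: "psi_sq P U \<delta> = psi_A P U U (\<lambda>z. \<delta> z / 2) (\<lambda>z. \<delta> z / 2)"
  by (simp add: fun_eq_iff psi_sq_def psi_A_def power2_eq_square)

text \<open>A product of a second moment and a function of another one, the shape required by the
  product rule and the delta method. It is an identity of total functions, so \<open>n = 0\<close>
  and a zero sample variance are included.\<close>

lemma rho_ols_eq:
  "rho_ols n u v = ((1 / n) * (\<Sum>i<n. (u i - avg n u) * (v i - avg n v))) *
     (1 / ((1 / n) * (\<Sum>i<n. (v i - avg n v) * (v i - avg n v))))"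
  by (cases "n = 0") (simp_all add: rho_ols_def power2_eq_square)

text \<open>The factor 1/n on the covariance cancels against the two roots of 1/n below. Separate
  reciprocal roots let the one-dimensional delta method treat each variance on its own.\<close>

lemma rho_corr_eq:
  "rho_corr n u v = ((1 / n) * (\<Sum>i<n. (u i - avg n u) * (v i - avg n v))) *
     (1 / sqrt ((1 / n) * (\<Sum>i<n. (u i - avg n u) * (u i - avg n u)))) *
     (1 / sqrt ((1 / n) * (\<Sum>i<n. (v i - avg n v) * (v i - avg n v))))"
proof (cases "n = 0")
  case False
  have "a / sqrt (b * c) = ((1 / n) * a) * (1 / sqrt ((1 / n) * b)) * (1 / sqrt ((1 / n) * c))" for a b c :: real
  proof -
    have "(1 / real n) * a * (1 / (x / s)) * (1 / (y / s)) = (s * s) / n * (a / (x * y))" for x y s :: real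
      by (simp add: ac_simps)
    moreover have "sqrt ((1 / n) * x) = sqrt x / sqrt n" for x by (simp add: real_sqrt_divide)
    ultimately have "(1 / n) * a * (1 / sqrt ((1 / n) * b)) * (1 / sqrt ((1 / n) * c))
        = (sqrt n * sqrt n) / n * (a / (sqrt b * sqrt c))"
      by (simp only:)
    also have "(sqrt n * sqrt n) / n = 1" using False by simp
    finally show ?thesis by (simp only: real_sqrt_mult[of b c] mult_1_left)
  qed
  then show ?thesis unfolding rho_corr_def power2_eq_square .
qed (simp add: rho_corr_def)

theorem theorem2:
  fixes M :: "'a measure"
    and P :: "'p::finite obs measure"
    and Z :: "nat \<Rightarrow> 'a \<Rightarrow> 'p obs"
    and \<X> :: "(real ^ 'p) set"
    and N :: "real measure" and arch :: nn_arch and J :: nat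
    and \<Theta>Y \<Theta>W :: "'p nn_param set"
    and FY FW fY fW :: "real \<Rightarrow> real ^ 'p \<Rightarrow> real"
    and K :: nat and \<kappa> :: "nat \<Rightarrow> nat \<Rightarrow> 'a \<Rightarrow> nat"
    and estY estW :: "'p est_rule"
    and \<phi>Y \<phi>W :: "real \<Rightarrow> real ^ 'p \<Rightarrow> 'p obs \<Rightarrow> real"
    and \<gamma>Y \<gamma>W \<delta>Y \<delta>W :: "'p obs \<Rightarrow> real"
  defines "\<F>Y \<equiv> dctm_class N arch J \<Theta>Y"
    and "\<F>W \<equiv> dctm_class N arch J \<Theta>W"
    and "U \<equiv> cond_rank out_Y FY"
    and "V \<equiv> cond_rank out_W FW"
    and "Uhat \<equiv> oof_rank out_Y estY Z \<kappa>"
    and "Vhat \<equiv> oof_rank out_W estW Z \<kappa>"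
    and "\<rho> \<equiv> rho_C P (cond_rank out_Y FY) (cond_rank out_W FW)"
    and "\<psi>A \<equiv> psi_A P (cond_rank out_Y FY) (cond_rank out_W FW) \<gamma>Y \<gamma>W"
    and "\<psi>U \<equiv> psi_sq P (cond_rank out_Y FY) \<delta>Y"
    and "\<psi>V \<equiv> psi_sq P (cond_rank out_W FW) \<delta>W"
  assumes prob: "prob_space M"
    and iid_law: "\<And>i. distr M borel (Z i) = P"
    and iid_indep: "prob_space.indep_vars M (\<lambda>_. borel) Z UNIV"
    and compact_X: "compact \<X>"
    and range_Z: "AE z in P. out_Y z \<in> {0..1} \<and> out_W z \<in> {0..1} \<and> covar z \<in> \<X>"
    and cdf_Y: "cond_cdf P out_Y FY" and cdf_W: "cond_cdf P out_W FW"
    and regular_Y: "cond_regular P FY fY" and regular_W: "cond_regular P FW fW"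
    and reference_law: "real_distribution N"
    and loss_Y: "loss_well_defined P out_Y \<X> \<F>Y"
    and loss_W: "loss_well_defined P out_W \<X> \<F>W"
    and specified_Y: "correctly_specified \<X> \<F>Y FY"
    and specified_W: "correctly_specified \<X> \<F>W FW"
    and unique_Y: "unique_risk_minimizer P out_Y \<F>Y FY"
    and unique_W: "unique_risk_minimizer P out_W \<F>W FW"
    and folds: "2 \<le> K" "random_folds M Z K \<kappa>"
    and erm_Y: "is_erm M out_Y \<F>Y estY Z K \<kappa>"
    and erm_W: "is_erm M out_W \<F>W estW Z K \<kappa>"
    and ranks_measurable_Y: "\<And>n i. i < n \<Longrightarrow> (\<lambda>\<omega>. Uhat n \<omega> i) \<in> borel_measurable M"
    and ranks_measurable_W: "\<And>n i. i < n \<Longrightarrow> (\<lambda>\<omega>. Vhat n \<omega> i) \<in> borel_measurable M"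
    and lln_Y: "uniform_lln M P out_Y \<F>Y Z K \<kappa>"
    and lln_W: "uniform_lln M P out_W \<F>W Z K \<kappa>"
    and kernel_Y: "expansion_kernel P \<X> \<phi>Y"
    and kernel_W: "expansion_kernel P \<X> \<phi>W"
    and expansion_Y: "linear_expansion M \<X> estY FY \<phi>Y Z K \<kappa>"
    and expansion_W: "linear_expansion M \<X> estW FW \<phi>W Z K \<kappa>"
    and gamma_Y: "copy_cond_exp P (\<lambda>z' z. (V z' - 1/2) * \<phi>Y (out_Y z') (covar z') z) \<gamma>Y"
    and gamma_W: "copy_cond_exp P (\<lambda>z' z. (U z' - 1/2) * \<phi>W (out_W z') (covar z') z) \<gamma>W"
    and delta_Y: "copy_cond_exp P (\<lambda>z' z. (U z' - 1/2) * \<phi>Y (out_Y z') (covar z') z) (\<lambda>z. \<delta>Y z / 2)"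
    and delta_W: "copy_cond_exp P (\<lambda>z' z. (V z' - 1/2) * \<phi>W (out_W z') (covar z') z) (\<lambda>z. \<delta>W z / 2)"
  shows "asymp_normal_with_influence M P Z (\<lambda>n \<omega>. rho_cov n (Uhat n \<omega>) (Vhat n \<omega>)) \<rho>
           (\<lambda>z. 12 * \<psi>A z) \<and>
         asymp_normal_with_influence M P Z (\<lambda>n \<omega>. rho_ols n (Uhat n \<omega>) (Vhat n \<omega>)) \<rho>
           (\<lambda>z. 12 * (\<psi>A z - \<rho> * \<psi>V z)) \<and>
         asymp_normal_with_influence M P Z (\<lambda>n \<omega>. rho_corr n (Uhat n \<omega>) (Vhat n \<omega>)) \<rho>
           (\<lambda>z. 12 * (\<psi>A z - \<rho> / 2 * (\<psi>U z + \<psi>V z)))"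
proof -
  interpret prob_space M by (rule prob)
  interpret iid: iid_sample M P Z
    by unfold_locales (use iid_law iid_indep in auto)
  have rY: "AE z in P. out_Y z \<in> {0..1}" and rW: "AE z in P. out_W z \<in> {0..1}" and rX: "AE z in P. covar z \<in> \<X>"
    using range_Z by (auto elim!: eventually_mono)
  interpret cf: cross_fitting M P Z K \<kappa>
    by unfold_locales (use folds in auto)
  interpret rankY: conditional_rank P out_Y FY fY
    by unfold_locales (use rY cdf_Y regular_Y iid.sets_P in auto)
  interpret rankW: conditional_rank P out_W FW fW
    by unfold_locales (use rW cdf_W regular_W iid.sets_P in auto)
  interpret cY: cross_fitted_rank M P Z K \<kappa> out_Y FY fY \<X> estY \<phi>Y
    by unfold_locales (use rX kernel_Y expansion_Y in auto)
  interpret cW: cross_fitted_rank M P Z K \<kappa> out_W FW fW \<X> estW \<phi>W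
    by unfold_locales (use rX kernel_W expansion_W in auto)
  interpret UV: cross_fitted_rank_pair M P Z K \<kappa> out_Y FY fY \<X> estY \<phi>Y out_W FW fW estW \<phi>W \<gamma>Y \<gamma>W
    by unfold_locales (use gamma_Y gamma_W in \<open>auto simp: U_def V_def\<close>)
  \<comment> \<open>Both slots receive half of \<open>\<delta>Y\<close>; \<open>delta_Y\<close>
    states that this half is a version of the required conditional expectation.\<close>
  interpret UU: cross_fitted_rank_pair M P Z K \<kappa> out_Y FY fY \<X> estY \<phi>Y out_Y FY fY estY \<phi>Y "\<lambda>z. \<delta>Y z / 2" "\<lambda>z. \<delta>Y z / 2"
    by unfold_locales (use delta_Y in \<open>auto simp: U_def\<close>)
  interpret VV: cross_fitted_rank_pair M P Z K \<kappa> out_W FW fW \<X> estW \<phi>W out_W FW fW estW \<phi>W "\<lambda>z. \<delta>W z / 2" "\<lambda>z. \<delta>W z / 2"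
    by unfold_locales (use delta_W in \<open>auto simp: V_def\<close>)
  define A where "A = (\<integral>z. (U z - 1/2) * (V z - 1/2) \<partial>P)"
  have var_UV: "(\<integral>z. (U z - 1/2) * (U z - 1/2) \<partial>P) = 1/12" "(\<integral>z. (V z - 1/2) * (V z - 1/2) \<partial>P) = 1/12"
    using rankY.variance_U rankW.variance_U by (simp_all only: U_def V_def power2_eq_square)
  \<comment> \<open>Uniformity of the rank \<open>V\<close> fixes the denominator of the target at
    1/12.\<close>
  have \<rho>: "\<rho> = 12 * A"
    unfolding \<rho>_def rho_C_def UV.cov_eq VV.cov_eq var_UV(2)[unfolded V_def] by (simp add: A_def U_def V_def)
  have \<psi>A: "\<psi>A = UV.\<psi>" and \<psi>U: "\<psi>U = UU.\<psi>" and \<psi>V: "\<psi>V = VV.\<psi>"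
    by (simp_all only: \<psi>A_def \<psi>U_def \<psi>V_def psi_sq_eq_psi_A)
  define S where "S h n \<omega> = (1 / sqrt n) * (\<Sum>i<n. h (Z i \<omega>))" for h :: "'p obs \<Rightarrow> real" and n \<omega>
  have infl: "UV.influence = S \<psi>A" "UU.influence = S \<psi>U" "VV.influence = S \<psi>V"
    by (simp_all add: fun_eq_iff S_def UV.influence_def UU.influence_def VV.influence_def \<psi>A \<psi>U \<psi>V)
  let ?c = "\<lambda>(u :: nat \<Rightarrow> 'a \<Rightarrow> nat \<Rightarrow> real) v n \<omega>. (1 / real n) * (\<Sum>i<n. (u n \<omega> i - avg n (u n \<omega>)) * (v n \<omega> i - avg n (v n \<omega>)))"
  have cUV: "asymp_linear M (?c Uhat Vhat) A (S \<psi>A)"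
    using UV.asymp_linear_covariance unfolding infl A_def U_def V_def Uhat_def Vhat_def .
  have cUU: "asymp_linear M (?c Uhat Uhat) (1/12) (S \<psi>U)"
    using UU.asymp_linear_covariance unfolding infl var_UV(1)[unfolded U_def] Uhat_def .
  have cVV: "asymp_linear M (?c Vhat Vhat) (1/12) (S \<psi>V)"
    using VV.asymp_linear_covariance unfolding infl var_UV(2)[unfolded V_def] Vhat_def .
  have half: "asymp_linear M (\<lambda>n \<omega>. (1 / n) * (\<Sum>i<n. (Uhat n \<omega> i - 1/2) * (Vhat n \<omega> i - 1/2))) A (S \<psi>A)"
    using UV.asymp_linear_half_moment unfolding infl A_def U_def V_def Uhat_def Vhat_def .

  note [measurable] = UV.\<psi>_props(1)[folded \<psi>A] UU.\<psi>_props(1)[folded \<psi>U] VV.\<psi>_props(1)[folded \<psi>V]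
  note L2 = UV.\<psi>_props(2)[folded \<psi>A] UU.\<psi>_props(2)[folded \<psi>U] VV.\<psi>_props(2)[folded \<psi>V]
  note mean0 = UV.\<psi>_props(3)[folded \<psi>A] UU.\<psi>_props(3)[folded \<psi>U] VV.\<psi>_props(3)[folded \<psi>V]
  have L1: "integrable P \<psi>A" "integrable P \<psi>U" "integrable P \<psi>V"
    using L2 by (auto intro!: iid.P.square_integrable_imp_integrable)
  \<comment> \<open>The three influence functions are the cases (a, b) = (0, 0), (0, \<rho>) and
    (\<rho>/2, \<rho>/2) of one form.\<close>
  have result: "asymp_normal_with_influence M P Z T \<rho> (\<lambda>z. 12 * (\<psi>A z - (a * \<psi>U z + b * \<psi>V z)))"
    if T: "\<And>n. T n \<in> borel_measurable M"
      and lin: "asymp_linear M T \<rho> (\<lambda>n \<omega>. 12 * (S \<psi>A n \<omega> - (a * S \<psi>U n \<omega> + b * S \<psi>V n \<omega>)))" for T a b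
  proof (rule asymp_normalI[OF iid_law iid_indep _ _ _ T])
    show "(\<lambda>z. 12 * (\<psi>A z - (a * \<psi>U z + b * \<psi>V z))) \<in> borel_measurable P" by measurable
    show "integrable P (\<lambda>z. (12 * (\<psi>A z - (a * \<psi>U z + b * \<psi>V z)))\<^sup>2)"
    proof (rule Bochner_Integration.integrable_bound)
      show "integrable P (\<lambda>z. 144 * (3 * (\<psi>A z)\<^sup>2 + 3 * (a\<^sup>2 * (\<psi>U z)\<^sup>2) + 3 * (b\<^sup>2 * (\<psi>V z)\<^sup>2)))"
        using L2 by simp
      show "AE z in P. norm ((12 * (\<psi>A z - (a * \<psi>U z + b * \<psi>V z)))\<^sup>2)
          \<le> norm (144 * (3 * (\<psi>A z)\<^sup>2 + 3 * (a\<^sup>2 * (\<psi>U z)\<^sup>2) + 3 * (b\<^sup>2 * (\<psi>V z)\<^sup>2)))"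
      proof (rule AE_I2)
        fix z
        define x y w where "x = \<psi>A z" and "y = a * \<psi>U z" and "w = b * \<psi>V z"
        \<comment> \<open>The same sum-of-squares identity with the signs of x - y - w.\<close>
        have "0 \<le> (x + y)\<^sup>2 + (x + w)\<^sup>2 + (y - w)\<^sup>2" by simp
        then have "(x - (y + w))\<^sup>2 \<le> 3 * x\<^sup>2 + 3 * y\<^sup>2 + 3 * w\<^sup>2"
          by (simp add: power2_eq_square algebra_simps)
        then have "(12 * (x - (y + w)))\<^sup>2 \<le> 144 * (3 * x\<^sup>2 + 3 * y\<^sup>2 + 3 * w\<^sup>2)"
          unfolding power_mult_distrib[of 12] by simp
        then show "norm ((12 * (\<psi>A z - (a * \<psi>U z + b * \<psi>V z)))\<^sup>2)
          \<le> norm (144 * (3 * (\<psi>A z)\<^sup>2 + 3 * (a\<^sup>2 * (\<psi>U z)\<^sup>2) + 3 * (b\<^sup>2 * (\<psi>V z)\<^sup>2)))"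
          by (simp add: x_def y_def w_def power_mult_distrib)
      qed
    qed measurable
    show "(\<integral>z. 12 * (\<psi>A z - (a * \<psi>U z + b * \<psi>V z)) \<partial>P) = 0"
      using L1 mean0 by simp
    show "asymp_linear M T \<rho> (\<lambda>n \<omega>. (1 / sqrt n) * (\<Sum>i<n. 12 * (\<psi>A (Z i \<omega>) - (a * \<psi>U (Z i \<omega>) + b * \<psi>V (Z i \<omega>)))))"
      by (rule asymp_linear_cong[OF lin])
        (simp_all add: S_def sum_subtractf sum.distrib sum_distrib_left[symmetric] right_diff_distrib distrib_left)
  qed

  \<comment> \<open>At variance 1/12 the reciprocal is 12 and its slope is -12^2. With A = \<rho>/12
    the product rule then gives 12 \<psi>A - 144 A \<psi>V = 12 (\<psi>A - \<rho> \<psi>V).\<close>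
  have d1: "DERIV (\<lambda>x. 1 / x) (1/12) :> - (144::real)"
    by (auto intro!: derivative_eq_intros simp: power2_eq_square)
  have s12: "sqrt (1/12) = 1 / sqrt 12" by (simp add: real_sqrt_divide)
  \<comment> \<open>The slope of x^(-1/2) at 1/12 is -(1/2) 12^(3/2) = -6 sqrt 12. Multiplied by the
    other reciprocal root sqrt 12 and by A it becomes -72 A = -6 \<rho>, which is 12 times -\<rho>/2
    for each variance.\<close>
  have d2: "DERIV (\<lambda>x. 1 / sqrt x) (1/12) :> - (6 * sqrt 12)"
    by (rule derivative_eq_intros refl | simp)+ (simp add: s12 power2_eq_square field_simps real_sqrt_divide)
  note [measurable] = ranks_measurable_Y ranks_measurable_W
  have [measurable]: "(\<lambda>\<omega>. avg n (Uhat n \<omega>)) \<in> borel_measurable M" "(\<lambda>\<omega>. avg n (Vhat n \<omega>)) \<in> borel_measurable M" for n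
    unfolding avg_def by measurable

  have "asymp_normal_with_influence M P Z (\<lambda>n \<omega>. rho_cov n (Uhat n \<omega>) (Vhat n \<omega>)) \<rho> (\<lambda>z. 12 * (\<psi>A z - (0 * \<psi>U z + 0 * \<psi>V z)))"
  proof (rule result)
    show "(\<lambda>\<omega>. rho_cov n (Uhat n \<omega>) (Vhat n \<omega>)) \<in> borel_measurable M" for n
      unfolding rho_cov_def by measurable
    show "asymp_linear M (\<lambda>n \<omega>. rho_cov n (Uhat n \<omega>) (Vhat n \<omega>)) \<rho> (\<lambda>n \<omega>. 12 * (S \<psi>A n \<omega> - (0 * S \<psi>U n \<omega> + 0 * S \<psi>V n \<omega>)))"
      by (rule asymp_linear_cong[OF asymp_linear_deriv[OF half, of "\<lambda>x. 12 * x" 12]])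
        (auto intro!: derivative_eq_intros simp: rho_cov_def \<rho>)
  qed
  moreover have "asymp_normal_with_influence M P Z (\<lambda>n \<omega>. rho_ols n (Uhat n \<omega>) (Vhat n \<omega>)) \<rho> (\<lambda>z. 12 * (\<psi>A z - (0 * \<psi>U z + \<rho> * \<psi>V z)))"
  proof (rule result)
    show "(\<lambda>\<omega>. rho_ols n (Uhat n \<omega>) (Vhat n \<omega>)) \<in> borel_measurable M" for n
      unfolding rho_ols_def by measurable
    show "asymp_linear M (\<lambda>n \<omega>. rho_ols n (Uhat n \<omega>) (Vhat n \<omega>)) \<rho> (\<lambda>n \<omega>. 12 * (S \<psi>A n \<omega> - (0 * S \<psi>U n \<omega> + \<rho> * S \<psi>V n \<omega>)))"
      by (rule asymp_linear_cong[OF asymp_linear_mult[OF cUV asymp_linear_deriv[OF cVV d1]]])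
        (simp_all add: rho_ols_eq \<rho> algebra_simps)
  qed
  moreover have "asymp_normal_with_influence M P Z (\<lambda>n \<omega>. rho_corr n (Uhat n \<omega>) (Vhat n \<omega>)) \<rho> (\<lambda>z. 12 * (\<psi>A z - (\<rho> / 2 * \<psi>U z + \<rho> / 2 * \<psi>V z)))"
  proof (rule result)
    show "(\<lambda>\<omega>. rho_corr n (Uhat n \<omega>) (Vhat n \<omega>)) \<in> borel_measurable M" for n
      unfolding rho_corr_def by measurable
    have s: "sqrt 12 * (sqrt 12 * x) = 12 * x" for x :: real by (simp flip: mult.assoc)
    show "asymp_linear M (\<lambda>n \<omega>. rho_corr n (Uhat n \<omega>) (Vhat n \<omega>)) \<rho> (\<lambda>n \<omega>. 12 * (S \<psi>A n \<omega> - (\<rho> / 2 * S \<psi>U n \<omega> + \<rho> / 2 * S \<psi>V n \<omega>)))"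
    proof (rule asymp_linear_cong[OF asymp_linear_mult[OF asymp_linear_mult[OF cUV asymp_linear_deriv[OF cUU d2]] asymp_linear_deriv[OF cVV d2]]])
      show "rho_corr n (Uhat n \<omega>) (Vhat n \<omega>) = ?c Uhat Vhat n \<omega> * (1 / sqrt (?c Uhat Uhat n \<omega>)) * (1 / sqrt (?c Vhat Vhat n \<omega>))" for n \<omega>
        by (rule rho_corr_eq)
      show "\<rho> = A * (1 / sqrt (1/12)) * (1 / sqrt (1/12))"
        unfolding s12 by (simp add: \<rho> mult.assoc)
      show "12 * (S \<psi>A n \<omega> - (\<rho> / 2 * S \<psi>U n \<omega> + \<rho> / 2 * S \<psi>V n \<omega>)) =
        A * (1 / sqrt (1/12)) * (- (6 * sqrt 12) * S \<psi>V n \<omega>)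
        + 1 / sqrt (1/12) * (A * (- (6 * sqrt 12) * S \<psi>U n \<omega>) + 1 / sqrt (1/12) * S \<psi>A n \<omega>)" for n \<omega>
        unfolding s12 by (simp add: \<rho> algebra_simps s)
    qed
  qed
  ultimately show ?thesis
    by (simp add: distrib_left)
qed

end
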